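(* For all $m,n\ge1$ the linear map $$\Phi_{m,n}:S(U')\to S(U),\qquad \prod_{(k,\ell)\in I_{m,n}}(z'_{k,\ell})^{d_{k,\ell}}(z'_{-k,\ell})^{\varepsilon_{k,\ell}}\mapsto(-1)^{\xi(\varepsilon)}\prod_{(k,\ell)\in I_{m,n}}z_{k,\ell}^{d_{k,\ell}}z_{k,-\ell}^{1-\varepsilon_{k,\ell}}$$ ($d_{k,\ell}\in\mathbb Z_{\ge0}$, $\varepsilon_{k,\ell}\in\{0,1\}$, $\varepsilon=(\varepsilon_{k,\ell})$), where $\xi(\varepsilon)=\sum_{(a,b)\in I_{m,n}}\big(n(a-1)+b+mn-1\big)\varepsilon_{a,b}$, is an isomorphism of $U(\tilde{\mathfrak p}(m))\otimes U(\mathfrak p(n))$-modules.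
   Context: $\Bbbk$ is an algebraically closed field of characteristic zero; everything is $\mathbb Z_2$-graded. A homogeneous linear map $f$ between supermodules is a homomorphism if $f(x.v)=(-1)^{|f||x|}x.f(v)$ for homogeneous $x$ (here $\Phi_{m,n}$ has parity $\overline{mn}$). $I_{m,n}=\{1,\dots,m\}\times\{1,\dots,n\}$ with lexicographic order; products over $I_{m,n}$ are taken in this order. $I_{n|n}=\{1,\dots,n,-1,\dots,-n\}$, $|i|=\bar0$ for $i>0$, $|i|=\bar1$ for $i<0$. $V_n$ has basis $v_i$ ($i\in I_{n|n}$), $W_m$ has basis $w_i$ ($i\in I_{m|m}$), $|v_i|=|w_i|=|i|$. $\mathfrak p(n)\subset\mathfrak{gl}(V_n)$ consists of the matrices $\begin{bmatrix}A&B\\ C&-A^T\end{bmatrix}$ with $B$ symmetric, $C$ skew-symmetric; basis $a_{i,j}=E_{i,j}-E_{-j,-i}$, $b_{i,j}=2^{-\delta_{i,j}}(E_{i,-j}+E_{j,-i})$ ($i\le j$), $c_{i,j}=E_{-i,j}-E_{-j,i}$ ($i<j$). $\tilde{\mathfrak p}(m)\subset\mathfrak{gl}(W_m)$ consists of the matrices $\begin{bmatrix}A&C\\ B&-A^T\end{bmatrix}$ with $B$ symmetric, $C$ skew-symmetric; basis $\tilde a_{i,j}=E_{i,j}-E_{-j,-i}$, $\tilde b_{i,j}=2^{-\delta_{i,j}}(E_{-i,j}+E_{-j,i})$ ($i\le j$), $\tilde c_{i,j}=E_{i,-j}-E_{j,-i}$ ($i<j$). $Y_k$ is a purely even superspace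 with basis $y_1,\dots,y_k$ and trivial action. $U=Y_m\otimes V_n$ has basis $z_{i,j}=y_i\otimes v_j$ ($1\le i\le m$, $j\in I_{n|n}$), parity $|j|$. $U'=W_m\otimes Y_n$ has basis $z'_{k,\ell}=w_k\otimes y_\ell$ ($k\in I_{m|m}$, $1\le\ell\le n$), parity $|k|$. These symbols also denote left multiplication on $S(U)$, $S(U')$; $\partial_{i,j}$ and $\partial'_{k,\ell}$ are the superderivations, of the same parities, dual to the generators. Module structure on $S(U)$: $\mathfrak p(n)$ acts by the action induced from the natural action on $V_n$. $\tilde{\mathfrak p}(m)$ acts by $\tilde a_{i,j}\mapsto\sum_{r\in I_{n|n}}z_{i,r}\partial_{j,r}-n\delta_{i,j}$; $\tilde b_{i,j}\mapsto\sum_{r\in I_{n|n}}\partial_{i,r}\partial_{j,-r}$ ($i\ne j$); $\tilde b_{i,i}\mapsto\sum_{r=1}^n\partial_{i,r}\partial_{i,-r}$; $\tilde c_{i,j}\mapsto\sum_{r\in I_{n|n}}(-1)^{|r|}z_{i,r}z_{j,-r}$ ($i<j$). Module structure on $S(U')$: $\tilde{\mathfrak p}(m)$ acts by the action induced from the natural action on $W_m$. $\mathfrak p(n)$ acts by $a_{i,j}\mapsto\sum_{r\in I_{m|m}}z'_{r,i}\partial'_{r,j}-m\delta_{i,j}$; $b_{i,j}\mapsto\sum_{r\in I_{m|m}}z'_{r,i}z'_{-r,j}$ ($i\neq j$); $b_{i,i}\mapsto\sum_{r=1}^mz'_{r,i}z'_{-r,i}$; $c_{i,j}\mapsto\sum_{r\in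 I_{m|m}}(-1)^{|r|}\partial'_{-r,i}\partial'_{r,j}$ ($i<j$). In each case the two actions supercommute. *)

theory Defs
  imports
    "HOL-Computational_Algebra.Polynomial"
    "HOL-Library.Poly_Mapping"
    "HOL-Library.Product_Lexorder"
    "HOL-Library.FSet"
begin

section \<open>Formal linear combinations\<close>

definition pscale :: "'k \<Rightarrow> ('a \<Rightarrow>\<^sub>0 'k) \<Rightarrow> ('a \<Rightarrow>\<^sub>0 'k::comm_ring_1)" where
  "pscale c f = Poly_Mapping.map ((*) c) f"

definition lin_ext :: "('a \<Rightarrow> 'b \<Rightarrow>\<^sub>0 'k) \<Rightarrow> ('a \<Rightarrow>\<^sub>0 'k) \<Rightarrow> ('b \<Rightarrow>\<^sub>0 'k::comm_ring_1)" where
  "lin_ext h f = (\<Sum>a\<in>Poly_Mapping.keys f. pscale (Poly_Mapping.lookup f a) (h a))"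

lemma lookup_pscale [simp]: "Poly_Mapping.lookup (pscale c f) a = c * Poly_Mapping.lookup f a"
  unfolding pscale_def by transfer (simp add: when_def)

lemma lookup_lin_ext_superset:
  assumes "finite A" "Poly_Mapping.keys f \<subseteq> A"
  shows "Poly_Mapping.lookup (lin_ext h f) b =
    (\<Sum>a\<in>A. Poly_Mapping.lookup f a * Poly_Mapping.lookup (h a) b)"
  unfolding lin_ext_def lookup_sum lookup_pscale
  by (rule sum.mono_neutral_left) (use assms in \<open>auto simp: in_keys_iff\<close>)

lemma lin_ext_add: "lin_ext h (f + g) = lin_ext h f + lin_ext h g"
proof (rule poly_mapping_eqI)
  fix b
  let ?A = "Poly_Mapping.keys f \<union> Poly_Mapping.keys g"
  have "finite ?A" "Poly_Mapping.keys f \<subseteq> ?A" "Poly_Mapping.keys g \<subseteq> ?A"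
    "Poly_Mapping.keys (f + g) \<subseteq> ?A"
    using Poly_Mapping.keys_add[of f g] by auto
  then show "Poly_Mapping.lookup (lin_ext h (f + g)) b =
      Poly_Mapping.lookup (lin_ext h f + lin_ext h g) b"
    by (simp add: lookup_lin_ext_superset[of ?A] lookup_add sum.distrib distrib_right)
qed

lemma lin_ext_pscale: "lin_ext h (pscale c f) = pscale c (lin_ext h f)"
proof (rule poly_mapping_eqI)
  fix b
  have "Poly_Mapping.keys (pscale c f) \<subseteq> Poly_Mapping.keys f" by (auto simp: in_keys_iff)
  then show "Poly_Mapping.lookup (lin_ext h (pscale c f)) b =
      Poly_Mapping.lookup (pscale c (lin_ext h f)) b"
    by (simp add: lookup_lin_ext_superset[of "Poly_Mapping.keys f"] sum_distrib_left mult.assoc)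
qed

lemma pscale_1 [simp]: "pscale 1 f = f"
  by (rule poly_mapping_eqI) simp

lemma pscale_pscale [simp]: "pscale c (pscale d f) = pscale (c * d) f"
  by (rule poly_mapping_eqI) (simp add: mult.assoc)

lemma pscale_add_right: "pscale c (f + g) = pscale c f + pscale c g"
  by (rule poly_mapping_eqI) (simp add: lookup_add distrib_left)

lemma pscale_add_left: "pscale (c + d) f = pscale c f + pscale d f"
  by (rule poly_mapping_eqI) (simp add: lookup_add distrib_right)

lemma pscale_0 [simp]: "pscale c 0 = 0" "pscale 0 f = 0"
  by (rule poly_mapping_eqI, simp)+

lemma pscale_single [simp]: "pscale c (Poly_Mapping.single a d) = Poly_Mapping.single a (c * d)"
  by (rule poly_mapping_eqI) (simp add: lookup_single when_def)

lemma lin_ext_0 [simp]: "lin_ext h 0 = 0"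
  by (simp add: lin_ext_def)

lemma lin_ext_single [simp]: "lin_ext h (Poly_Mapping.single a c) = pscale c (h a)"
  by (cases "c = 0") (simp_all add: lin_ext_def)

lemma lin_ext_0_fun [simp]: "lin_ext (\<lambda>_. 0) f = 0"
  by (simp add: lin_ext_def)

lemma lin_ext_add_fun: "lin_ext (\<lambda>a. h a + k a) f = lin_ext h f + lin_ext k f"
  by (simp add: lin_ext_def pscale_add_right sum.distrib)

lemma pscale_sum: "pscale c (sum f A) = (\<Sum>a\<in>A. pscale c (f a))"
  by (induction A rule: infinite_finite_induct) (simp_all add: pscale_add_right)

lemma lin_ext_pscale_fun: "lin_ext (\<lambda>a. pscale c (h a)) f = pscale c (lin_ext h f)"
  by (simp add: lin_ext_def pscale_sum mult.commute)

lemma poly_mapping_lin_induct [case_names zero single add]: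
  fixes f :: "'a \<Rightarrow>\<^sub>0 'k::comm_ring_1"
  assumes zero: "P 0" and single: "\<And>a c. P (Poly_Mapping.single a c)"
    and add: "\<And>f g. P f \<Longrightarrow> P g \<Longrightarrow> P (f + g)"
  shows "P f"
proof -
  have "f = (\<Sum>a\<in>Poly_Mapping.keys f. Poly_Mapping.single a (Poly_Mapping.lookup f a))"
    by (rule poly_mapping_eqI) (auto simp: lookup_sum lookup_single when_def sum.delta' in_keys_iff)
  moreover have "P (\<Sum>a\<in>A. Poly_Mapping.single a (Poly_Mapping.lookup f a))" if "finite A" for A
    using that by (induction A) (auto intro: zero single add)
  ultimately show ?thesis by (metis finite_keys)
qed

global_interpretation pm: vector_space "pscale :: 'k \<Rightarrow> ('a \<Rightarrow>\<^sub>0 'k) \<Rightarrow> ('a \<Rightarrow>\<^sub>0 'k::field)"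
  defines pm_span = pm.span
  by standard (simp_all add: pscale_add_right pscale_add_left)

section \<open>Supersymmetric algebras\<close>

text \<open>The type \<open>('i, 'k) ssym\<close> is the symmetric superalgebra, over \<open>'k\<close>, of the superspace with
  even basis vectors $x_e$ and odd basis vectors $\theta_e$, both indexed by \<open>'i\<close>, i.e. the
  polynomial algebra in the $x_e$ tensored with the exterior algebra in the $\theta_e$. The pair
  \<open>(a, A)\<close> stands for the monomial $x^a \prod_{e \in A} \theta_e$, the last product in increasing
  order.\<close>

typedef (overloaded) ('i, 'k) ssym = "UNIV :: (('i \<Rightarrow>\<^sub>0 nat) \<times> 'i fset \<Rightarrow>\<^sub>0 'k::zero) set"
  morphisms coeffs Ssym ..

setup_lifting type_definition_ssym

definition inversions :: "'i::linorder fset \<Rightarrow> 'i fset \<Rightarrow> nat" where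
  "inversions A B = card {(s, t). s |\<in>| A \<and> t |\<in>| B \<and> t < s}"

fun mon_mult :: "('i::linorder \<Rightarrow>\<^sub>0 nat) \<times> 'i fset \<Rightarrow> ('i \<Rightarrow>\<^sub>0 nat) \<times> 'i fset
    \<Rightarrow> (('i \<Rightarrow>\<^sub>0 nat) \<times> 'i fset \<Rightarrow>\<^sub>0 'k::comm_ring_1)" where
  "mon_mult (a, A) (b, B) =
     (if A |\<inter>| B = {||} then Poly_Mapping.single (a + b, A |\<union>| B) ((- 1) ^ inversions A B) else 0)"

instantiation ssym :: (type, comm_ring_1) ab_group_add
begin
lift_definition zero_ssym :: "('a, 'b) ssym" is 0 .
lift_definition plus_ssym :: "('a, 'b) ssym \<Rightarrow> ('a, 'b) ssym \<Rightarrow> ('a, 'b) ssym" is "(+)" .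
lift_definition minus_ssym :: "('a, 'b) ssym \<Rightarrow> ('a, 'b) ssym \<Rightarrow> ('a, 'b) ssym" is "(-)" .
lift_definition uminus_ssym :: "('a, 'b) ssym \<Rightarrow> ('a, 'b) ssym" is uminus .
instance by standard (transfer; simp)+
end

lemma inversions_union:
  assumes "A |\<inter>| B = {||}"
  shows "inversions (A |\<union>| B) C = inversions A C + inversions B C"
    and "inversions C (A |\<union>| B) = inversions C A + inversions C B"
proof -
  have fin: "finite {(s, t). s |\<in>| X \<and> t |\<in>| Y \<and> t < s}" for X Y :: "'a fset"
    by (rule finite_subset[of _ "fset X \<times> fset Y"]) auto
  have "{(s, t). s |\<in>| A |\<union>| B \<and> t |\<in>| C \<and> t < s} =
      {(s, t). s |\<in>| A \<and> t |\<in>| C \<and> t < s} \<union> {(s, t). s |\<in>| B \<and> t |\<in>| C \<and> t < s}" by auto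
  moreover have "{(s, t). s |\<in>| A \<and> t |\<in>| C \<and> t < s} \<inter> {(s, t). s |\<in>| B \<and> t |\<in>| C \<and> t < s} = {}"
    using assms by (auto simp: fset_eq_iff)
  ultimately show "inversions (A |\<union>| B) C = inversions A C + inversions B C"
    by (simp add: inversions_def card_Un_disjoint fin)
  have "{(s, t). s |\<in>| C \<and> t |\<in>| A |\<union>| B \<and> t < s} =
      {(s, t). s |\<in>| C \<and> t |\<in>| A \<and> t < s} \<union> {(s, t). s |\<in>| C \<and> t |\<in>| B \<and> t < s}" by auto
  moreover have "{(s, t). s |\<in>| C \<and> t |\<in>| A \<and> t < s} \<inter> {(s, t). s |\<in>| C \<and> t |\<in>| B \<and> t < s} = {}"
    using assms by (auto simp: fset_eq_iff)
  ultimately show "inversions C (A |\<union>| B) = inversions C A + inversions C B"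
    by (simp add: inversions_def card_Un_disjoint fin)
qed

lemma inversions_empty [simp]: "inversions {||} A = 0" "inversions A {||} = 0"
  by (simp_all add: inversions_def)

lemma mon_mult_assoc:
  "lin_ext (\<lambda>v. mon_mult v w) (mon_mult u v) = lin_ext (mon_mult u) (mon_mult v w)"
proof -
  obtain a A b B c C where [simp]: "u = (a, A)" "v = (b, B)" "w = (c, C)"
    by (cases u, cases v, cases w) auto
  show ?thesis
    by (auto simp: inversions_union power_add inf_sup_distrib1 inf_sup_distrib2 add.assoc sup_assoc mult_ac)
qed

instantiation ssym :: (linorder, comm_ring_1) ring_1
begin
lift_definition one_ssym :: "('a, 'b) ssym" is "Poly_Mapping.single (0, {||}) 1" .
lift_definition times_ssym :: "('a, 'b) ssym \<Rightarrow> ('a, 'b) ssym \<Rightarrow> ('a, 'b) ssym" is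
  "\<lambda>f g. lin_ext (\<lambda>u. lin_ext (mon_mult u) g) f" .
instance
proof
  fix f g h :: "('a, 'b) ssym"
  show "f * g * h = f * (g * h)"
  proof transfer
    fix f g h :: "('a \<Rightarrow>\<^sub>0 nat) \<times> 'a fset \<Rightarrow>\<^sub>0 'b"
    show "lin_ext (\<lambda>u. lin_ext (mon_mult u) h) (lin_ext (\<lambda>u. lin_ext (mon_mult u) g) f) =
      lin_ext (\<lambda>u. lin_ext (mon_mult u) (lin_ext (\<lambda>u. lin_ext (mon_mult u) h) g)) f"
    proof (induction f rule: poly_mapping_lin_induct)
      case (single u c)
      show ?case
      proof (induction g rule: poly_mapping_lin_induct)
        case (single v d)
        show ?case
        proof (induction h rule: poly_mapping_lin_induct)
          case (single w e)
          show ?case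
            using mon_mult_assoc[of w u v, where ?'b = 'b]
            by (simp add: lin_ext_pscale lin_ext_pscale_fun mult_ac)
        qed (simp_all add: lin_ext_add lin_ext_add_fun pscale_add_right)
      qed (simp_all add: lin_ext_add lin_ext_add_fun pscale_add_right)
    qed (simp_all add: lin_ext_add)
  qed
  show "1 * f = f"
  proof transfer
    fix f :: "('a \<Rightarrow>\<^sub>0 nat) \<times> 'a fset \<Rightarrow>\<^sub>0 'b"
    show "lin_ext (\<lambda>u. lin_ext (mon_mult u) f) (Poly_Mapping.single (0, {||}) 1) = f"
    proof (induction f rule: poly_mapping_lin_induct)
      case (single v d)
      then show ?case by (cases v) simp
    qed (simp_all add: lin_ext_add)
  qed
  show "f * 1 = f"
  proof transfer
    fix f :: "('a \<Rightarrow>\<^sub>0 nat) \<times> 'a fset \<Rightarrow>\<^sub>0 'b"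
    show "lin_ext (\<lambda>u. lin_ext (mon_mult u) (Poly_Mapping.single (0, {||}) 1)) f = f"
    proof (induction f rule: poly_mapping_lin_induct)
      case (single v d)
      then show ?case by (cases v) simp
    qed (simp_all add: lin_ext_add)
  qed
  show "(f + g) * h = f * h + g * h" by transfer (simp add: lin_ext_add)
  show "f * (g + h) = f * g + f * h" by transfer (simp add: lin_ext_add lin_ext_add_fun)
  show "(0 :: ('a, 'b) ssym) \<noteq> 1"
    by transfer (metis lookup_single_eq lookup_zero zero_neq_one)
qed
end

lift_definition sscale :: "'k \<Rightarrow> ('i, 'k) ssym \<Rightarrow> ('i, 'k::comm_ring_1) ssym" is pscale .

global_interpretation ssym: vector_space "sscale :: 'k \<Rightarrow> ('i, 'k) ssym \<Rightarrow> ('i, 'k::field) ssym"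
  defines ssym_span = ssym.span
  by standard (transfer; simp add: pscale_add_right pscale_add_left)+

lemma sscale_mult: "sscale c (f * g) = sscale c f * g" "sscale c (f * g) = f * sscale c g"
  by (transfer; simp add: lin_ext_pscale lin_ext_pscale_fun)+

lemma sscale_simps:
  fixes f g :: "('i, 'k::comm_ring_1) ssym"
  shows "sscale 1 f = f" "sscale c (0 :: ('i, 'k) ssym) = 0" "sscale 0 f = 0"
    "sscale c (f + g) = sscale c f + sscale c g" "sscale c (sscale d f) = sscale (c * d) f"
  by (transfer; simp add: pscale_add_right)+

text \<open>Parities are Booleans, \<open>True\<close> being odd, so that \<open>p \<noteq> q\<close> is the sum of the parities \<open>p\<close>
  and \<open>q\<close>, and \<open>ssgn p q\<close> is $(-1)^{pq}$.\<close>

definition ssgn :: "bool \<Rightarrow> bool \<Rightarrow> 'k::comm_ring_1" where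
  "ssgn p q = (if p \<and> q then - 1 else 1)"

definition ssym_homog :: "bool \<Rightarrow> ('i, 'k::comm_ring_1) ssym \<Rightarrow> bool" where
  "ssym_homog p f \<longleftrightarrow> (\<forall>(a, A)\<in>Poly_Mapping.keys (coeffs f). odd (fcard A) = p)"

lift_definition even_gen :: "'i \<Rightarrow> ('i, 'k::comm_ring_1) ssym" is
  "\<lambda>e. Poly_Mapping.single (Poly_Mapping.single e 1, {||}) 1" .

lift_definition odd_gen :: "'i \<Rightarrow> ('i, 'k::comm_ring_1) ssym" is
  "\<lambda>e. Poly_Mapping.single (0, {|e|}) 1" .

fun even_der_mon :: "'i::linorder \<Rightarrow> ('i \<Rightarrow>\<^sub>0 nat) \<times> 'i fset
    \<Rightarrow> (('i \<Rightarrow>\<^sub>0 nat) \<times> 'i fset \<Rightarrow>\<^sub>0 'k::comm_ring_1)" where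
  "even_der_mon e (a, A) =
     Poly_Mapping.single (a - Poly_Mapping.single e 1, A) (of_nat (Poly_Mapping.lookup a e))"

fun odd_der_mon :: "'i::linorder \<Rightarrow> ('i \<Rightarrow>\<^sub>0 nat) \<times> 'i fset
    \<Rightarrow> (('i \<Rightarrow>\<^sub>0 nat) \<times> 'i fset \<Rightarrow>\<^sub>0 'k::comm_ring_1)" where
  "odd_der_mon e (a, A) =
     (if e |\<in>| A then Poly_Mapping.single (a, A |-| {|e|}) ((- 1) ^ inversions {|e|} A) else 0)"

text \<open>The partial derivatives; the lemmas below show that they are the (left) superderivations dual
  to the generators.\<close>

lift_definition even_der :: "'i::linorder \<Rightarrow> ('i, 'k) ssym \<Rightarrow> ('i, 'k::comm_ring_1) ssym" is
  "\<lambda>e. lin_ext (even_der_mon e)" .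

lift_definition odd_der :: "'i::linorder \<Rightarrow> ('i, 'k) ssym \<Rightarrow> ('i, 'k::comm_ring_1) ssym" is
  "\<lambda>e. lin_ext (odd_der_mon e)" .

definition superderivation :: "bool \<Rightarrow> (('i::linorder, 'k) ssym \<Rightarrow> ('i, 'k::comm_ring_1) ssym) \<Rightarrow> bool"
  where "superderivation p D \<longleftrightarrow>
    (\<forall>f g. D (f + g) = D f + D g) \<and> (\<forall>c f. D (sscale c f) = sscale c (D f)) \<and>
    (\<forall>q f g. ssym_homog q f \<longrightarrow> D (f * g) = D f * g + sscale (ssgn p q) (f * D g))"


lemma coeffs_simps:
  "coeffs (f + g) = coeffs f + coeffs g" "coeffs 0 = 0" "coeffs (sscale c f) = pscale c (coeffs f)"
  by (transfer; simp)+

lemma ssym_mon_induct [consumes 1, case_names zero single add]: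
  fixes f :: "('i, 'k::comm_ring_1) ssym"
  assumes "ssym_homog q f" and zero: "P 0"
    and single: "\<And>a A c. odd (fcard A) = q \<Longrightarrow> P (Ssym (Poly_Mapping.single (a, A) c))"
    and add: "\<And>f g. P f \<Longrightarrow> P g \<Longrightarrow> P (f + g)"
  shows "P f"
proof -
  have "P (Ssym (\<Sum>u\<in>K. Poly_Mapping.single u (Poly_Mapping.lookup (coeffs f) u)))"
    if "finite K" "K \<subseteq> Poly_Mapping.keys (coeffs f)" for K
    using that
  proof (induction K)
    case empty
    then show ?case using zero by (simp add: zero_ssym_def)
  next
    case (insert u K)
    obtain a A where u: "u = (a, A)" by (cases u)
    have "P (Ssym (Poly_Mapping.single u (Poly_Mapping.lookup (coeffs f) u)))"
      unfolding u
    proof (rule single)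
      have "(a, A) \<in> Poly_Mapping.keys (coeffs f)" using insert.prems u by simp
      with assms(1) show "odd (fcard A) = q" unfolding ssym_homog_def by (auto dest: bspec)
    qed
    moreover have "Ssym (x + y) = Ssym x + Ssym y" for x y :: "('i \<Rightarrow>\<^sub>0 nat) \<times> 'i fset \<Rightarrow>\<^sub>0 'k"
      by (simp add: plus_ssym.abs_eq eq_onp_same_args)
    moreover have "P (Ssym (\<Sum>u\<in>K. Poly_Mapping.single u (Poly_Mapping.lookup (coeffs f) u)))"
      by (rule insert.IH) (use insert.prems in simp)
    ultimately show ?case unfolding sum.insert[OF insert.hyps] by (simp only: add)
  qed
  moreover have "coeffs f = (\<Sum>u\<in>Poly_Mapping.keys (coeffs f).
      Poly_Mapping.single u (Poly_Mapping.lookup (coeffs f) u))"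
    by (rule poly_mapping_eqI) (auto simp: lookup_sum lookup_single when_def sum.delta' in_keys_iff)
  ultimately show ?thesis by (metis (no_types, lifting) coeffs_inverse finite_keys order_refl)
qed

lemma Ssym_mult:
  "Ssym f * Ssym g = Ssym (lin_ext (\<lambda>u. lin_ext (mon_mult u) g) f)"
  by (simp add: times_ssym.abs_eq eq_onp_same_args)

lemma even_der_mon_mult:
  "lin_ext (even_der_mon e) (mon_mult u v) =
   lin_ext (\<lambda>u. mon_mult u v) (even_der_mon e u) + lin_ext (mon_mult u) (even_der_mon e v)"
proof -
  obtain a A b B where [simp]: "u = (a, A)" "v = (b, B)" by (cases u, cases v) auto
  have 1: "Poly_Mapping.lookup a e \<noteq> 0 \<Longrightarrow>
      a + b - Poly_Mapping.single e 1 = a - Poly_Mapping.single e 1 + b" for a b :: "'a \<Rightarrow>\<^sub>0 nat"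
    by (rule poly_mapping_eqI) (auto simp: lookup_add lookup_minus lookup_single when_def)
  have 2: "Poly_Mapping.lookup b e \<noteq> 0 \<Longrightarrow>
      a + b - Poly_Mapping.single e 1 = a + (b - Poly_Mapping.single e 1)"
    using 1[of b a] by (simp add: add.commute)
  have key: "Poly_Mapping.single (a + b - Poly_Mapping.single e 1, C)
        (of_nat (Poly_Mapping.lookup (a + b) e) * x :: 'b) =
      Poly_Mapping.single (a - Poly_Mapping.single e 1 + b, C) (of_nat (Poly_Mapping.lookup a e) * x) +
      Poly_Mapping.single (a + (b - Poly_Mapping.single e 1), C) (of_nat (Poly_Mapping.lookup b e) * x)"
    for C :: "'a fset" and x
  proof (cases "Poly_Mapping.lookup a e = 0")
    case True
    then show ?thesis
      by (cases "Poly_Mapping.lookup b e = 0") (simp_all only: lookup_add add_0 2 not_False_eq_True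
          of_nat_0 mult_zero_left single_zero)
  next
    case False
    note a = 1[OF False]
    show ?thesis
    proof (cases "Poly_Mapping.lookup b e = 0")
      case True
      then show ?thesis by (simp only: a lookup_add add_0_right of_nat_0 mult_zero_left single_zero)
    next
      case False
      show ?thesis
        by (simp only: 2[OF False, symmetric] a[symmetric] lookup_add of_nat_add distrib_right single_add)
    qed
  qed
  show ?thesis
    by (cases "A |\<inter>| B = {||}") (simp_all add: key mult.commute[of _ "of_nat _"] del: One_nat_def)
qed

lemma inversions_singleton:
  "inversions {|e|} A + inversions A {|e|} + (if e |\<in>| A then 1 else 0) = fcard A"
proof -
  let ?L = "{t \<in> fset A. t < e}" and ?G = "{t \<in> fset A. e < t}"
  have "{(s, t). s |\<in>| {|e|} \<and> t |\<in>| A \<and> t < s} = Pair e ` ?L"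
    "{(s, t). s |\<in>| A \<and> t |\<in>| {|e|} \<and> t < s} = (\<lambda>s. (s, e)) ` ?G" by auto
  then have 1: "inversions {|e|} A = card ?L" "inversions A {|e|} = card ?G"
    by (simp_all add: inversions_def card_image inj_on_def)
  have "fset A = ?L \<union> ?G \<union> (if e |\<in>| A then {e} else {})"
    by (auto, metis linorder_neqE)
  then have "card (fset A) = card (?L \<union> ?G \<union> (if e |\<in>| A then {e} else {}))"
    by (rule arg_cong)
  also have "\<dots> = card (?L \<union> ?G) + card (if e |\<in>| A then {e} else {})"
    by (rule card_Un_disjoint) auto
  also have "card (?L \<union> ?G) = card ?L + card ?G" by (rule card_Un_disjoint) auto
  finally show ?thesis using 1 by (simp add: fcard.rep_eq)
qed

lemma inversions_remove:
  assumes "e |\<in>| A"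
  shows "inversions A B = inversions {|e|} B + inversions (A |-| {|e|}) B"
    and "inversions B A = inversions B {|e|} + inversions B (A |-| {|e|})"
proof -
  have "{|e|} |\<inter>| (A |-| {|e|}) = {||}" by auto
  note this[THEN inversions_union(1), of B] this[THEN inversions_union(2), of B]
  moreover have "{|e|} |\<union>| (A |-| {|e|}) = A" using assms by auto
  ultimately show "inversions A B = inversions {|e|} B + inversions (A |-| {|e|}) B"
    "inversions B A = inversions B {|e|} + inversions B (A |-| {|e|})" by simp_all
qed

lemma minus_one_power_eq: "even (a + b) \<Longrightarrow> (- 1 :: 'k::comm_ring_1) ^ a = (- 1) ^ b"
  by (metis even_add minus_one_power_iff)

lemma odd_der_mon_mult:
  "lin_ext (odd_der_mon e) (mon_mult (a, A) v) =
   lin_ext (\<lambda>u. mon_mult u v) (odd_der_mon e (a, A)) +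
   pscale ((- 1) ^ fcard A) (lin_ext (mon_mult (a, A)) (odd_der_mon e v))"
proof -
  obtain b B where [simp]: "v = (b, B)" by (cases v)
  note [simp] = power_add[symmetric]
  consider "e |\<notin>| A" "e |\<notin>| B" | "e |\<in>| A" "e |\<notin>| B" | "e |\<notin>| A" "e |\<in>| B"
    | "e |\<in>| A" "e |\<in>| B" by blast
  then show ?thesis
  proof cases
    case 1
    then show ?thesis by simp
  next
    case 2
    have "A |\<inter>| B = {||} \<longleftrightarrow> (A |-| {|e|}) |\<inter>| B = {||}" using 2 by auto
    moreover have "(A |\<union>| B) |-| {|e|} = (A |-| {|e|}) |\<union>| B" using 2 by auto
    moreover have "A |\<inter>| B = {||} \<Longrightarrow>
      (- 1 :: 'b) ^ (inversions A B + inversions {|e|} (A |\<union>| B)) =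
      (- 1) ^ (inversions {|e|} A + inversions (A |-| {|e|}) B)"
      by (rule minus_one_power_eq) (simp only: inversions_union inversions_remove(1)[OF 2(1), of B], presburger)
    ultimately show ?thesis using 2 by simp
  next
    case 3
    have "A |\<inter>| B = {||} \<longleftrightarrow> A |\<inter>| (B |-| {|e|}) = {||}" using 3 by auto
    moreover have "(A |\<union>| B) |-| {|e|} = A |\<union>| (B |-| {|e|})" using 3 by auto
    moreover have "A |\<inter>| B = {||} \<Longrightarrow>
      (- 1 :: 'b) ^ (inversions A B + inversions {|e|} (A |\<union>| B)) =
      (- 1) ^ (fcard A + (inversions {|e|} B + inversions A (B |-| {|e|})))"
      using 3 by (intro minus_one_power_eq) (simp only: inversions_union
        inversions_remove(2)[OF 3(2), of A] inversions_singleton[of e A, symmetric] if_False, presburger)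
    ultimately show ?thesis using 3 by (simp add: add.assoc)
  next
    case 4
    define l where "l = inversions {|e|} A + inversions (A |-| {|e|}) B"
    define r where "r = fcard A + (inversions {|e|} B + inversions A (B |-| {|e|}))"
    have "inversions {|e|} B + inversions (A |-| {|e|}) B =
        inversions A {|e|} + inversions A (B |-| {|e|})"
      using inversions_remove(2)[OF 4(2), of A] inversions_remove(1)[OF 4(1), of B] by simp
    moreover have "inversions {|e|} A + inversions A {|e|} + 1 = fcard A"
      using inversions_singleton[of e A] 4 by simp
    ultimately have "odd (l + r)" unfolding l_def r_def by presburger
    then have sgn: "(- 1 :: 'b) ^ l + (- 1) ^ r = 0"
      by (auto simp: minus_one_power_iff)
    have AB: "(A |-| {|e|}) |\<inter>| B = A |\<inter>| (B |-| {|e|})"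
      "(A |-| {|e|}) |\<union>| B = A |\<union>| (B |-| {|e|})" "A |\<inter>| B \<noteq> {||}" using 4 by auto
    show ?thesis
    proof (cases "A |\<inter>| (B |-| {|e|}) = {||}")
      case True
      have "lin_ext (\<lambda>u. mon_mult u v) (odd_der_mon e (a, A)) =
          Poly_Mapping.single (a + b, A |\<union>| (B |-| {|e|})) ((- 1) ^ l :: 'b)"
        using 4 True AB by (simp add: l_def)
      moreover have "pscale ((- 1) ^ fcard A) (lin_ext (mon_mult (a, A)) (odd_der_mon e v)) =
          Poly_Mapping.single (a + b, A |\<union>| (B |-| {|e|})) ((- 1) ^ r :: 'b)"
        using 4 True by (simp add: r_def add.assoc)
      moreover have "lin_ext (odd_der_mon e) (mon_mult (a, A) v :: _ \<Rightarrow>\<^sub>0 'b) = 0"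
        using AB(3) by simp
      ultimately show ?thesis by (simp add: sgn flip: single_add)
    next
      case False
      then show ?thesis using 4 AB by simp
    qed
  qed
qed

lemma superderivation_even_der: "superderivation False (even_der e)"
  unfolding superderivation_def
proof (intro conjI allI impI)
  fix q and f g :: "('a, 'b) ssym"
  have "even_der e (f * g) = even_der e f * g + f * even_der e g"
  proof transfer
    fix e :: 'a and f g :: "('a \<Rightarrow>\<^sub>0 nat) \<times> 'a fset \<Rightarrow>\<^sub>0 'b"
    show "lin_ext (even_der_mon e) (lin_ext (\<lambda>u. lin_ext (mon_mult u) g) f) =
      lin_ext (\<lambda>u. lin_ext (mon_mult u) g) (lin_ext (even_der_mon e) f) +
      lin_ext (\<lambda>u. lin_ext (mon_mult u) (lin_ext (even_der_mon e) g)) f"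
    proof (induction f rule: poly_mapping_lin_induct)
      case (single u c)
      show ?case
      proof (induction g rule: poly_mapping_lin_induct)
        case (single v d)
        show ?case
          by (simp add: lin_ext_pscale lin_ext_pscale_fun even_der_mon_mult pscale_add_right mult_ac)
      qed (simp_all add: lin_ext_add lin_ext_add_fun pscale_add_right add_ac)
    qed (simp_all add: lin_ext_add add_ac)
  qed
  then show "even_der e (f * g) = even_der e f * g + sscale (ssgn False q) (f * even_der e g)"
    by (simp add: ssgn_def sscale_simps)
qed (transfer; simp add: lin_ext_add lin_ext_pscale)+

lemma superderivation_odd_der: "superderivation True (odd_der e)"
  unfolding superderivation_def
proof (intro conjI allI impI)
  fix q and f g :: "('a, 'b) ssym"
  have add: "odd_der e (f + g) = odd_der e f + odd_der e g" for f g :: "('a, 'b) ssym"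
    by transfer (simp add: lin_ext_add)
  assume "ssym_homog q f"
  then show "odd_der e (f * g) = odd_der e f * g + sscale (ssgn True q) (f * odd_der e g)"
  proof (induction f rule: ssym_mon_induct)
    case zero
    have "odd_der e (0 :: ('a, 'b) ssym) = 0" by transfer simp
    then show ?case by (simp add: sscale_simps)
  next
    case (single a A c)
    have 1: "ssgn True q = ((- 1) ^ fcard A :: 'b)"
      using single by (auto simp: ssgn_def minus_one_power_iff)
    have "lin_ext (odd_der_mon e) (lin_ext (mon_mult (a, A)) h) =
        lin_ext (\<lambda>u. lin_ext (mon_mult u) h) (odd_der_mon e (a, A)) +
        pscale ((- 1) ^ fcard A) (lin_ext (mon_mult (a, A)) (lin_ext (odd_der_mon e) h))"
      for h :: "('a \<Rightarrow>\<^sub>0 nat) \<times> 'a fset \<Rightarrow>\<^sub>0 'b"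
    proof (induction h rule: poly_mapping_lin_induct)
      case (single v d)
      show ?case
        by (simp only: lin_ext_single lin_ext_pscale lin_ext_pscale_fun odd_der_mon_mult
            pscale_add_right pscale_pscale mult_ac)
    qed (simp_all add: lin_ext_add lin_ext_add_fun pscale_add_right add_ac)
    then show ?case
      by (simp add: 1 flip: coeffs_inject add: coeffs_simps times_ssym.rep_eq odd_der.rep_eq
          Ssym_inverse lin_ext_pscale pscale_add_right mult_ac del: odd_der_mon.simps)
  next
    case (add f g)
    then show ?case by (simp add: \<open>\<And>f g. odd_der e (f + g) = odd_der e f + odd_der e g\<close> sscale_simps distrib_right add_ac)
  qed
qed (transfer; simp add: lin_ext_add lin_ext_pscale)+

lemma gen_derivatives:
  "even_der e (even_gen d) = (if d = e then 1 else 0)" "even_der e (odd_gen d) = 0"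
  "odd_der e (even_gen d) = 0" "odd_der e (odd_gen d) = (if d = e then 1 else 0)"
proof -
  have "{(s, t). s |\<in>| {|d|} \<and> t |\<in>| {|d|} \<and> t < s} = {}" by auto
  then have "inversions {|d|} {|d|} = 0" by (simp only: inversions_def card.empty)
  then show "even_der e (even_gen d) = (if d = e then 1 else 0)" "even_der e (odd_gen d) = 0"
    "odd_der e (even_gen d) = 0" "odd_der e (odd_gen d) = (if d = e then 1 else 0)"
    unfolding coeffs_inject[symmetric] even_der.rep_eq odd_der.rep_eq even_gen.rep_eq odd_gen.rep_eq
    by (simp_all add: zero_ssym.rep_eq one_ssym.rep_eq lookup_single)
qed

lemma even_gen_commute: "even_gen e * f = f * even_gen e"
proof transfer
  fix e :: 'a and f :: "('a \<Rightarrow>\<^sub>0 nat) \<times> 'a fset \<Rightarrow>\<^sub>0 'b"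
  show "lin_ext (\<lambda>u. lin_ext (mon_mult u) f) (Poly_Mapping.single (Poly_Mapping.single e 1, {||}) 1) =
    lin_ext (\<lambda>u. lin_ext (mon_mult u) (Poly_Mapping.single (Poly_Mapping.single e 1, {||}) 1)) f"
  proof (induction f rule: poly_mapping_lin_induct)
    case (single v d)
    then show ?case by (cases v) (simp add: add.commute)
  qed (simp_all add: lin_ext_add)
qed

lemma odd_gen_commute:
  assumes "ssym_homog q f"
  shows "odd_gen e * f = sscale (ssgn True q) (f * odd_gen e)"
  using assms
proof (induction f rule: ssym_mon_induct)
  case zero
  then show ?case by (simp add: sscale_simps)
next
  case (single a A c)
  have 1: "ssgn True q = ((- 1) ^ fcard A :: 'b)"
    using single by (auto simp: ssgn_def minus_one_power_iff)
  have 2: "e |\<notin>| A \<Longrightarrow>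
      (- 1 :: 'b) ^ inversions {|e|} A = (- 1) ^ (fcard A + inversions A {|e|})"
    using inversions_singleton[of e A] by (intro minus_one_power_eq) presburger
  show ?case
    unfolding 1 coeffs_inject[symmetric] coeffs_simps times_ssym.rep_eq odd_gen.rep_eq
      Ssym_inverse[OF UNIV_I]
    by (cases "e |\<in>| A") (simp_all add: 2 power_add mult_ac)
next
  case (add f g)
  then show ?case by (simp add: sscale_simps distrib_right distrib_left)
qed

section \<open>The two superspaces and the periplectic Lie superalgebras\<close>

type_synonym 'k salg = "(int \<times> int, 'k) ssym"

type_synonym 'k smat = "int \<Rightarrow> int \<Rightarrow> 'k"

definition I2 :: "nat \<Rightarrow> int set" where
  "I2 n = {1..int n} \<union> {- int n..-1}"

definition z :: "int \<Rightarrow> int \<Rightarrow> 'k::comm_ring_1 salg" where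
  "z i j = (if j > 0 then even_gen (i, j) else odd_gen (i, - j))"

definition dz :: "int \<Rightarrow> int \<Rightarrow> 'k salg \<Rightarrow> 'k::comm_ring_1 salg" where
  "dz i j = (if j > 0 then even_der (i, j) else odd_der (i, - j))"

definition z' :: "int \<Rightarrow> int \<Rightarrow> 'k::comm_ring_1 salg" where
  "z' k l = (if k > 0 then even_gen (k, l) else odd_gen (- k, l))"

definition dz' :: "int \<Rightarrow> int \<Rightarrow> 'k salg \<Rightarrow> 'k::comm_ring_1 salg" where
  "dz' k l = (if k > 0 then even_der (k, l) else odd_der (- k, l))"

lemma z_derivatives:
  assumes "j \<noteq> 0" "s \<noteq> 0"
  shows "dz i j (z r s) = (if r = i \<and> s = j then 1 else 0)"
    and "dz' j i (z' s r) = (if s = j \<and> r = i then 1 else 0)"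
  using assms by (auto simp: dz_def z_def dz'_def z'_def gen_derivatives)

lemma superderivation_dz: "superderivation (j < 0) (dz i j)" "superderivation (j < 0) (dz' j i)"
  if "j \<noteq> 0" using that
  by (auto simp: dz_def dz'_def superderivation_even_der superderivation_odd_der)

text \<open>The underlying superspaces $U$ and $U'$ both have $mn$ even and $mn$ odd basis vectors, so the
  same algebra serves for both; they differ in which index carries the sign.
  $S(U)$ and $S(U')$ are the subalgebras generated by the \<open>z i j\<close> and by the \<open>z' k l\<close>.\<close>

definition SU :: "nat \<Rightarrow> nat \<Rightarrow> 'k::field salg set" where
  "SU m n = ssym_span {prod_list us |us. set us \<subseteq> {z i j |i j. i \<in> {1..int m} \<and> j \<in> I2 n}}"

definition SU' :: "nat \<Rightarrow> nat \<Rightarrow> 'k::field salg set" where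
  "SU' m n = ssym_span {prod_list us |us. set us \<subseteq> {z' k l |k l. k \<in> I2 m \<and> l \<in> {1..int n}}}"

definition gl :: "nat \<Rightarrow> 'k::zero smat set" where
  "gl n = {X. \<forall>i j. X i j \<noteq> 0 \<longrightarrow> i \<in> I2 n \<and> j \<in> I2 n}"

definition smat_homog :: "bool \<Rightarrow> 'k::zero smat \<Rightarrow> bool" where
  "smat_homog p X \<longleftrightarrow> (\<forall>i j. X i j \<noteq> 0 \<longrightarrow> ((i < 0) \<noteq> (j < 0)) = p)"

definition smat_bracket :: "nat \<Rightarrow> bool \<Rightarrow> bool \<Rightarrow> 'k smat \<Rightarrow> 'k smat \<Rightarrow> 'k::comm_ring_1 smat" where
  "smat_bracket n p q X Y =
     (\<lambda>i j. (\<Sum>r\<in>I2 n. X i r * Y r j) - ssgn p q * (\<Sum>r\<in>I2 n. Y i r * X r j))"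

text \<open>\<open>peri n\<close> is $\mathfrak p(n)$ and \<open>peri_t m\<close> is $\tilde{\mathfrak p}(m)$.\<close>

definition peri :: "nat \<Rightarrow> 'k::field smat set" where
  "peri n = {X \<in> gl n. \<forall>i\<in>{1..int n}. \<forall>j\<in>{1..int n}.
     X (- i) (- j) = - X j i \<and> X i (- j) = X j (- i) \<and> X (- i) j = - X (- j) i}"

definition peri_t :: "nat \<Rightarrow> 'k::field smat set" where
  "peri_t m = {X \<in> gl m. \<forall>i\<in>{1..int m}. \<forall>j\<in>{1..int m}.
     X (- i) (- j) = - X j i \<and> X (- i) j = X (- j) i \<and> X i (- j) = - X j (- i)}"

definition munit :: "int \<Rightarrow> int \<Rightarrow> 'k::zero_neq_one smat" where
  "munit i j = (\<lambda>r s. if r = i \<and> s = j then 1 else 0)"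

definition mat_a :: "int \<Rightarrow> int \<Rightarrow> 'k::field smat" where
  "mat_a i j = (\<lambda>r s. munit i j r s - munit (- j) (- i) r s)"

definition mat_b :: "int \<Rightarrow> int \<Rightarrow> 'k::field smat" where
  "mat_b i j = (\<lambda>r s. (if i = j then 1 / 2 else 1) * (munit i (- j) r s + munit j (- i) r s))"

definition mat_c :: "int \<Rightarrow> int \<Rightarrow> 'k::field smat" where
  "mat_c i j = (\<lambda>r s. munit (- i) j r s - munit (- j) i r s)"

definition mat_bt :: "int \<Rightarrow> int \<Rightarrow> 'k::field smat" where
  "mat_bt i j = (\<lambda>r s. (if i = j then 1 / 2 else 1) * (munit (- i) j r s + munit (- j) i r s))"

definition mat_ct :: "int \<Rightarrow> int \<Rightarrow> 'k::field smat" where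
  "mat_ct i j = (\<lambda>r s. munit i (- j) r s - munit j (- i) r s)"

lemma double_sum_delta:
  fixes F :: "'a \<Rightarrow> 'b \<Rightarrow> 'c::semiring_1"
  assumes "finite A" "\<And>i. i \<in> A \<Longrightarrow> finite (B i)" and P: "\<And>i j. P i j \<longleftrightarrow> i = a \<and> j = b"
  shows "(\<Sum>i\<in>A. \<Sum>j\<in>B i. F i j * (if P i j then 1 else 0)) = (if a \<in> A \<and> b \<in> B a then F a b else 0)"
proof -
  have "(\<Sum>j\<in>B i. F i j * (if P i j then 1 else 0)) =
      (if i = a then if b \<in> B a then F a b else 0 else 0)" if "i \<in> A" for i
    using assms(2)[OF that] by (auto simp: P sum.delta if_distrib[of "\<lambda>x. _ * x"] cong: if_cong)
  then have "(\<Sum>i\<in>A. \<Sum>j\<in>B i. F i j * (if P i j then 1 else 0)) =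
      (\<Sum>i\<in>A. if i = a then if b \<in> B a then F a b else 0 else 0)" by (intro sum.cong) auto
  also have "\<dots> = (if a \<in> A \<and> b \<in> B a then F a b else 0)" using assms(1) by (simp add: sum.delta)
  finally show ?thesis .
qed

text \<open>The coordinates of an element with respect to the two bases.\<close>

lemma peri_expand:
  fixes X :: "'k::field_char_0 smat"
  assumes "X \<in> peri n"
  shows "X r s = (\<Sum>i\<in>{1..int n}. \<Sum>j\<in>{1..int n}. X i j * mat_a i j r s)
    + (\<Sum>i\<in>{1..int n}. \<Sum>j\<in>{i..int n}. X i (- j) * mat_b i j r s)
    + (\<Sum>i\<in>{1..int n}. \<Sum>j\<in>{i<..int n}. X (- i) j * mat_c i j r s)"
proof -
  let ?R = "{1..int n}"
  have half: "x / 2 + x / 2 = x" for x :: 'k by (simp flip: mult_2 add_divide_distrib)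
  have supp: "X r s = 0" if "r \<notin> I2 n \<or> s \<notin> I2 n" for r s
    using assms that by (auto simp: peri_def gl_def)
  have rel: "X (- i) (- j) = - X j i" "X i (- j) = X j (- i)" "X (- i) j = - X (- j) i"
    if "i \<in> ?R" "j \<in> ?R" for i j
    using assms that unfolding peri_def by blast+
  have a: "(\<Sum>i\<in>?R. \<Sum>j\<in>?R. X i j * mat_a i j r s) =
      (if r \<in> ?R \<and> s \<in> ?R then X r s else 0) - (if - s \<in> ?R \<and> - r \<in> ?R then X (- s) (- r) else 0)"
    unfolding mat_a_def munit_def right_diff_distrib sum_subtractf
    by (intro arg_cong2[of _ _ _ _ "(-)"] double_sum_delta) auto
  have b: "(\<Sum>i\<in>?R. \<Sum>j\<in>{i..int n}. X i (- j) * mat_b i j r s) =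
      (if r \<in> ?R \<and> - s \<in> {r..int n} then X r (- (- s)) * (if r = - s then 1 / 2 else 1) else 0)
      + (if - s \<in> ?R \<and> r \<in> {- s..int n} then X (- s) (- r) * (if - s = r then 1 / 2 else 1) else 0)"
    unfolding mat_b_def munit_def distrib_left sum.distrib mult.assoc[symmetric]
    by (intro arg_cong2[of _ _ _ _ "(+)"] double_sum_delta) auto
  have c: "(\<Sum>i\<in>?R. \<Sum>j\<in>{i<..int n}. X (- i) j * mat_c i j r s) =
      (if - r \<in> ?R \<and> s \<in> {- r<..int n} then X (- (- r)) s else 0)
      - (if s \<in> ?R \<and> - r \<in> {s<..int n} then X (- s) (- r) else 0)"
    unfolding mat_c_def munit_def right_diff_distrib sum_subtractf
    by (intro arg_cong2[of _ _ _ _ "(-)"] double_sum_delta) auto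
  consider "r \<in> ?R" "s \<in> ?R" | "- r \<in> ?R" "- s \<in> ?R" | "r \<in> ?R" "- s \<in> ?R"
    | "- r \<in> ?R" "s \<in> ?R" | "r \<notin> I2 n \<or> s \<notin> I2 n"
    by (force simp: I2_def)
  then show ?thesis
  proof cases
    case 1
    then show ?thesis unfolding a b c by auto
  next
    case 2
    then show ?thesis using rel(1)[of "- r" "- s"] unfolding a b c by auto
  next
    case 3
    then have E: "X (- s) (- r) = X r s" using rel(2)[of r "- s"] by simp
    consider "r < - s" | "r = - s" | "- s < r" by linarith
    then show ?thesis using 3 unfolding a b c
      by cases (simp_all add: E half)
  next
    case 4
    note out = this
    then have E: "X (- s) (- r) = - X r s" using rel(3)[of s "- r"] by simp
    have "X r (- r) = 0" if "s = - r"
      using rel(3)[of "- r" "- r"] 4 that by (simp add: eq_neg_iff_add_eq_0 flip: mult_2)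
    then have D: "X r s = 0" if "s = - r" using that by simp
    consider "- r < s" | "s = - r" | "s < - r" by linarith
    then show ?thesis
    proof cases
      case 1
      then show ?thesis using out unfolding a b c by (simp add: E)
    next
      case 2
      then show ?thesis using out D[OF 2] unfolding a b c by simp
    next
      case 3
      then show ?thesis using out unfolding a b c by (simp add: E)
    qed
  next
    case 5
    have "\<not> (r \<in> ?R \<and> s \<in> ?R)" "\<not> (- s \<in> ?R \<and> - r \<in> ?R)" "\<not> (r \<in> ?R \<and> - s \<in> {r..int n})" "\<not> (- s \<in> ?R \<and> r \<in> {- s..int n})" "\<not> (- r \<in> ?R \<and> s \<in> {- r<..int n})" "\<not> (s \<in> ?R \<and> - r \<in> {s<..int n})"
      using 5 by (auto simp: I2_def)
    then show ?thesis unfolding a b c using supp[OF 5] by (simp only: if_False) simp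
  qed
qed

lemma peri_t_expand:
  fixes X :: "'k::field_char_0 smat"
  assumes "X \<in> peri_t n"
  shows "X r s = (\<Sum>i\<in>{1..int n}. \<Sum>j\<in>{1..int n}. X i j * mat_a i j r s)
    + (\<Sum>i\<in>{1..int n}. \<Sum>j\<in>{i..int n}. X (- i) j * mat_bt i j r s)
    + (\<Sum>i\<in>{1..int n}. \<Sum>j\<in>{i<..int n}. X i (- j) * mat_ct i j r s)"
proof -
  let ?R = "{1..int n}"
  have half: "x / 2 + x / 2 = x" for x :: 'k by (simp flip: mult_2 add_divide_distrib)
  have supp: "X r s = 0" if "r \<notin> I2 n \<or> s \<notin> I2 n" for r s
    using assms that by (auto simp: peri_t_def gl_def)
  have rel: "X (- i) (- j) = - X j i" "X (- i) j = X (- j) i" "X i (- j) = - X j (- i)"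
    if "i \<in> ?R" "j \<in> ?R" for i j
    using assms that unfolding peri_t_def by blast+
  have a: "(\<Sum>i\<in>?R. \<Sum>j\<in>?R. X i j * mat_a i j r s) =
      (if r \<in> ?R \<and> s \<in> ?R then X r s else 0) - (if - s \<in> ?R \<and> - r \<in> ?R then X (- s) (- r) else 0)"
    unfolding mat_a_def munit_def right_diff_distrib sum_subtractf
    by (intro arg_cong2[of _ _ _ _ "(-)"] double_sum_delta) auto
  have b: "(\<Sum>i\<in>?R. \<Sum>j\<in>{i..int n}. X (- i) j * mat_bt i j r s) =
      (if - r \<in> ?R \<and> s \<in> {- r..int n} then X (- (- r)) s * (if - r = s then 1 / 2 else 1) else 0)
      + (if s \<in> ?R \<and> - r \<in> {s..int n} then X (- s) (- r) * (if s = - r then 1 / 2 else 1) else 0)"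
    unfolding mat_bt_def munit_def distrib_left sum.distrib mult.assoc[symmetric]
    by (intro arg_cong2[of _ _ _ _ "(+)"] double_sum_delta) auto
  have c: "(\<Sum>i\<in>?R. \<Sum>j\<in>{i<..int n}. X i (- j) * mat_ct i j r s) =
      (if r \<in> ?R \<and> - s \<in> {r<..int n} then X r (- (- s)) else 0)
      - (if - s \<in> ?R \<and> r \<in> {- s<..int n} then X (- s) (- r) else 0)"
    unfolding mat_ct_def munit_def right_diff_distrib sum_subtractf
    by (intro arg_cong2[of _ _ _ _ "(-)"] double_sum_delta) auto
  consider "r \<in> ?R" "s \<in> ?R" | "- r \<in> ?R" "- s \<in> ?R" | "r \<in> ?R" "- s \<in> ?R"
    | "- r \<in> ?R" "s \<in> ?R" | "r \<notin> I2 n \<or> s \<notin> I2 n"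
    by (force simp: I2_def)
  then show ?thesis
  proof cases
    case 1
    then show ?thesis unfolding a b c by auto
  next
    case 2
    then show ?thesis using rel(1)[of "- r" "- s"] unfolding a b c by auto
  next
    case 3
    note out = this
    then have E: "X (- s) (- r) = - X r s" using rel(3)[of "- s" r] by simp
    have "X r (- r) = 0" if "s = - r"
      using rel(3)[of r r] 3 that by (simp add: eq_neg_iff_add_eq_0 flip: mult_2)
    then have D: "X r s = 0" if "s = - r" using that by simp
    consider "r < - s" | "s = - r" | "- s < r" by linarith
    then show ?thesis
    proof cases
      case 1
      then show ?thesis using out unfolding a b c by (simp add: E)
    next
      case 2
      then show ?thesis using out D[OF 2] unfolding a b c by simp
    next
      case 3
      then show ?thesis using out unfolding a b c by (simp add: E)
    qed
  next
    case 4
    then have E: "X (- s) (- r) = X r s" using rel(2)[of "- r" s] by simp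
    consider "- r < s" | "s = - r" | "s < - r" by linarith
    then show ?thesis using 4 unfolding a b c
      by cases (simp_all add: E half)
  next
    case 5
    have "\<not> (r \<in> ?R \<and> s \<in> ?R)" "\<not> (- s \<in> ?R \<and> - r \<in> ?R)" "\<not> (- r \<in> ?R \<and> s \<in> {- r..int n})" "\<not> (s \<in> ?R \<and> - r \<in> {s..int n})" "\<not> (r \<in> ?R \<and> - s \<in> {r<..int n})" "\<not> (- s \<in> ?R \<and> r \<in> {- s<..int n})"
      using 5 by (auto simp: I2_def)
    then show ?thesis unfolding a b c using supp[OF 5] by (simp only: if_False) simp
  qed
qed

section \<open>The module structures\<close>

text \<open>The action of \<open>X\<close> on $S(U)$, resp. $S(U')$, induced from the natural action is the
  superderivation which is $y_i \otimes v_j \mapsto y_i \otimes X v_j$ on $U$, resp.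
  $w_k \otimes y_l \mapsto X w_k \otimes y_l$ on $U'$.\<close>

definition p_U :: "nat \<Rightarrow> nat \<Rightarrow> 'k smat \<Rightarrow> 'k salg \<Rightarrow> 'k::field salg" where
  "p_U m n X f = (\<Sum>i\<in>{1..int m}. \<Sum>j\<in>I2 n. (\<Sum>r\<in>I2 n. sscale (X r j) (z i r)) * dz i j f)"

definition pt_U' :: "nat \<Rightarrow> nat \<Rightarrow> 'k smat \<Rightarrow> 'k salg \<Rightarrow> 'k::field salg" where
  "pt_U' m n X f = (\<Sum>k\<in>I2 m. \<Sum>l\<in>{1..int n}. (\<Sum>r\<in>I2 m. sscale (X r k) (z' r l)) * dz' k l f)"

lemma superderivation_sum:
  assumes "\<And>a. a \<in> A \<Longrightarrow> superderivation p (D a)"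
  shows "superderivation p (\<lambda>f. \<Sum>a\<in>A. D a f)"
  using assms
proof (induction A rule: infinite_finite_induct)
  case (insert a A)
  then have "superderivation p (D a)" "superderivation p (\<lambda>f. \<Sum>a\<in>A. D a f)" by auto
  with insert.hyps show ?case
    unfolding superderivation_def by (simp add: sscale_simps algebra_simps)
qed (simp_all add: superderivation_def sscale_simps)

lemma superderivation_mult_left:
  fixes G :: "('i::linorder, 'k::comm_ring_1) ssym"
  assumes "superderivation p D"
    and "\<And>q f. ssym_homog q f \<Longrightarrow> G * f = sscale (ssgn t q) (f * G)"
  shows "superderivation (t \<noteq> p) (\<lambda>f. G * D f)"
  unfolding superderivation_def
proof (intro conjI allI impI)
  fix q and f g :: "('i, 'k) ssym" assume f: "ssym_homog q f"
  have "G * D (f * g) = G * D f * g + sscale (ssgn p q) (G * f * D g)"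
    using assms(1) f by (simp add: superderivation_def distrib_left mult.assoc flip: sscale_mult(2))
  also have "sscale (ssgn p q) (G * f * D g) = sscale (ssgn (t \<noteq> p) q) (f * (G * D g))"
    unfolding assms(2)[OF f] sscale_mult(1)[symmetric] sscale_simps
    by (auto simp: ssgn_def mult.assoc)
  finally show "G * D (f * g) = G * D f * g + sscale (ssgn (t \<noteq> p) q) (f * (G * D g))" .
qed (use assms(1) in \<open>simp_all add: superderivation_def distrib_left sscale_mult(2)\<close>)

lemma z_supercommute:
  assumes "ssym_homog q f" "j \<noteq> 0"
  shows "z i j * f = sscale (ssgn (j < 0) q) (f * z i j)"
    and "z' j i * f = sscale (ssgn (j < 0) q) (f * z' j i)"
proof -
  have "sscale (ssgn False q) f = f" for f :: "('i, 'k::comm_ring_1) ssym"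
    by (simp add: ssgn_def sscale_simps)
  then show "z i j * f = sscale (ssgn (j < 0) q) (f * z i j)"
    "z' j i * f = sscale (ssgn (j < 0) q) (f * z' j i)"
    using odd_gen_commute[OF assms(1)] assms(2)
    by (auto simp: z_def z'_def even_gen_commute ssgn_def sscale_simps)
qed

lemma superderivation_p_U:
  assumes "smat_homog p X"
  shows "superderivation p (p_U m n X)"
proof -
  have par: "((p \<noteq> b) \<noteq> b) = p" for b by auto
  have "superderivation ((p \<noteq> (j < 0)) \<noteq> (j < 0))
      (\<lambda>f. (\<Sum>r\<in>I2 n. sscale (X r j) (z i r)) * dz i j f)" if "j \<in> I2 n" for i j
  proof (rule superderivation_mult_left)
    fix q and f :: "'a salg" assume f: "ssym_homog q f"
    have "sscale (X r j) (z i r) * f = sscale (ssgn (p \<noteq> (j < 0)) q) (f * sscale (X r j) (z i r))"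
        if "r \<in> I2 n" for r
    proof (cases "X r j = 0")
      case False
      with assms have "(r < 0) = (p \<noteq> (j < 0))" by (auto simp: smat_homog_def)
      then show ?thesis
        using z_supercommute(1)[OF f, of r i] that by (auto simp: I2_def sscale_simps mult.commute simp flip: sscale_mult)
    qed (simp add: sscale_simps)
    then show "(\<Sum>r\<in>I2 n. sscale (X r j) (z i r)) * f =
        sscale (ssgn (p \<noteq> (j < 0)) q) (f * (\<Sum>r\<in>I2 n. sscale (X r j) (z i r)))"
      by (simp add: sum_distrib_left sum_distrib_right ssym.scale_sum_right)
  qed (use that in \<open>auto intro: superderivation_dz simp: I2_def\<close>)
  then have "superderivation p (\<lambda>f. (\<Sum>r\<in>I2 n. sscale (X r j) (z i r)) * dz i j f)"
    if "j \<in> I2 n" for i j using that by (simp only: par)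
  then show ?thesis
    unfolding p_U_def[abs_def] by (intro superderivation_sum)
qed

lemma superderivation_pt_U':
  assumes "smat_homog p X"
  shows "superderivation p (pt_U' m n X)"
proof -
  have par: "((p \<noteq> b) \<noteq> b) = p" for b by auto
  have "superderivation ((p \<noteq> (j < 0)) \<noteq> (j < 0))
      (\<lambda>f. (\<Sum>r\<in>I2 m. sscale (X r j) (z' r i)) * dz' j i f)" if "j \<in> I2 m" for i j
  proof (rule superderivation_mult_left)
    fix q and f :: "'a salg" assume f: "ssym_homog q f"
    have "sscale (X r j) (z' r i) * f = sscale (ssgn (p \<noteq> (j < 0)) q) (f * sscale (X r j) (z' r i))"
        if "r \<in> I2 m" for r
    proof (cases "X r j = 0")
      case False
      with assms have "(r < 0) = (p \<noteq> (j < 0))" by (auto simp: smat_homog_def)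
      then show ?thesis
        using z_supercommute(2)[OF f, of r i] that by (auto simp: I2_def sscale_simps mult.commute simp flip: sscale_mult)
    qed (simp add: sscale_simps)
    then show "(\<Sum>r\<in>I2 m. sscale (X r j) (z' r i)) * f =
        sscale (ssgn (p \<noteq> (j < 0)) q) (f * (\<Sum>r\<in>I2 m. sscale (X r j) (z' r i)))"
      by (simp add: sum_distrib_left sum_distrib_right ssym.scale_sum_right)
  qed (use that in \<open>auto intro: superderivation_dz simp: I2_def\<close>)
  then have "superderivation p (\<lambda>f. (\<Sum>r\<in>I2 m. sscale (X r j) (z' r i)) * dz' j i f)"
    if "j \<in> I2 m" for i j using that by (simp only: par)
  then show ?thesis
    unfolding pt_U'_def[abs_def] by (intro superderivation_sum)
qed

lemma natural_action:
  shows "i \<in> {1..int m} \<Longrightarrow> j \<in> I2 n \<Longrightarrow> p_U m n X (z i j) = (\<Sum>r\<in>I2 n. sscale (X r j) (z i r))"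
    and "k \<in> I2 m \<Longrightarrow> l \<in> {1..int n} \<Longrightarrow> pt_U' m n X (z' k l) = (\<Sum>r\<in>I2 m. sscale (X r k) (z' r l))"
proof -
  have nz: "j \<noteq> 0" if "j \<in> I2 n" for j n using that by (auto simp: I2_def)
  have fin: "finite (I2 n)" for n by (simp add: I2_def)
  { assume ij: "i \<in> {1..int m}" "j \<in> I2 n"
    have "p_U m n X (z i j) = (\<Sum>a\<in>{1..int m}. \<Sum>b\<in>I2 n.
        (\<Sum>r\<in>I2 n. sscale (X r b) (z a r)) * (if a = i \<and> b = j then 1 else 0))"
      unfolding p_U_def using ij nz by (intro sum.cong) (auto simp: z_derivatives)
    also have "\<dots> = (\<Sum>r\<in>I2 n. sscale (X r j) (z i r))"
      by (subst double_sum_delta[where a = i and b = j]) (use ij fin in auto)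
    finally show "p_U m n X (z i j) = (\<Sum>r\<in>I2 n. sscale (X r j) (z i r))" . }
  { assume kl: "k \<in> I2 m" "l \<in> {1..int n}"
    have "pt_U' m n X (z' k l) = (\<Sum>a\<in>I2 m. \<Sum>b\<in>{1..int n}.
        (\<Sum>r\<in>I2 m. sscale (X r a) (z' r b)) * (if a = k \<and> b = l then 1 else 0))"
      unfolding pt_U'_def using kl nz by (intro sum.cong) (auto simp: z_derivatives)
    also have "\<dots> = (\<Sum>r\<in>I2 m. sscale (X r k) (z' r l))"
      by (subst double_sum_delta[where a = k and b = l]) (use kl fin in auto)
    finally show "pt_U' m n X (z' k l) = (\<Sum>r\<in>I2 m. sscale (X r k) (z' r l))" . }
qed

text \<open>The other two actions are given on the bases \<open>mat_a\<close>, \<open>mat_bt\<close>, \<open>mat_ct\<close> and \<open>mat_a\<close>, \<open>mat_b\<close>,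
  \<open>mat_c\<close>, and extended linearly by the coordinates of \<open>peri_t_expand\<close> and \<open>peri_expand\<close>.\<close>

definition at_U :: "nat \<Rightarrow> int \<Rightarrow> int \<Rightarrow> 'k salg \<Rightarrow> 'k::field salg" where
  "at_U n i j f = (\<Sum>r\<in>I2 n. z i r * dz j r f) - sscale (if i = j then of_nat n else 0) f"

definition bt_U :: "nat \<Rightarrow> int \<Rightarrow> int \<Rightarrow> 'k salg \<Rightarrow> 'k::field salg" where
  "bt_U n i j f =
     (if i = j then \<Sum>r\<in>{1..int n}. dz i r (dz i (- r) f) else \<Sum>r\<in>I2 n. dz i r (dz j (- r) f))"

definition ct_U :: "nat \<Rightarrow> int \<Rightarrow> int \<Rightarrow> 'k salg \<Rightarrow> 'k::field salg" where
  "ct_U n i j f = (\<Sum>r\<in>I2 n. sscale (if r < 0 then - 1 else 1) (z i r * z j (- r) * f))"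

definition pt_U :: "nat \<Rightarrow> nat \<Rightarrow> 'k smat \<Rightarrow> 'k salg \<Rightarrow> 'k::field salg" where
  "pt_U m n X f = (\<Sum>i\<in>{1..int m}. \<Sum>j\<in>{1..int m}. sscale (X i j) (at_U n i j f))
    + (\<Sum>i\<in>{1..int m}. \<Sum>j\<in>{i..int m}. sscale (X (- i) j) (bt_U n i j f))
    + (\<Sum>i\<in>{1..int m}. \<Sum>j\<in>{i<..int m}. sscale (X i (- j)) (ct_U n i j f))"

definition a_U' :: "nat \<Rightarrow> int \<Rightarrow> int \<Rightarrow> 'k salg \<Rightarrow> 'k::field salg" where
  "a_U' m i j f = (\<Sum>r\<in>I2 m. z' r i * dz' r j f) - sscale (if i = j then of_nat m else 0) f"

definition b_U' :: "nat \<Rightarrow> int \<Rightarrow> int \<Rightarrow> 'k salg \<Rightarrow> 'k::field salg" where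
  "b_U' m i j f =
     (if i = j then \<Sum>r\<in>{1..int m}. z' r i * z' (- r) i * f else \<Sum>r\<in>I2 m. z' r i * z' (- r) j * f)"

definition c_U' :: "nat \<Rightarrow> int \<Rightarrow> int \<Rightarrow> 'k salg \<Rightarrow> 'k::field salg" where
  "c_U' m i j f = (\<Sum>r\<in>I2 m. sscale (if r < 0 then - 1 else 1) (dz' (- r) i (dz' r j f)))"

definition p_U' :: "nat \<Rightarrow> nat \<Rightarrow> 'k smat \<Rightarrow> 'k salg \<Rightarrow> 'k::field salg" where
  "p_U' m n X f = (\<Sum>i\<in>{1..int n}. \<Sum>j\<in>{1..int n}. sscale (X i j) (a_U' m i j f))
    + (\<Sum>i\<in>{1..int n}. \<Sum>j\<in>{i..int n}. sscale (X i (- j)) (b_U' m i j f))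
    + (\<Sum>i\<in>{1..int n}. \<Sum>j\<in>{i<..int n}. sscale (X (- i) j) (c_U' m i j f))"

section \<open>Modules over the tensor product of two enveloping superalgebras\<close>

text \<open>Elements of \<open>free_alg g\<close> are linear combinations of words in elements of \<open>g\<close>, i.e.
  \<open>free_alg g\<close> is the free associative algebra on the set \<open>g\<close>. The universal enveloping
  superalgebra $U(g)$ is its quotient by the two-sided ideal \<open>env_ideal N g\<close>, which identifies
  the linear structure of \<open>g\<close> with that of the algebra, and the bracket with the supercommutator.\<close>

definition free_alg :: "'k smat set \<Rightarrow> ('k smat list \<Rightarrow>\<^sub>0 'k::field) set" where
  "free_alg g = {t. \<forall>xs\<in>Poly_Mapping.keys t. set xs \<subseteq> g}"

abbreviation word :: "'a \<Rightarrow> ('a \<Rightarrow>\<^sub>0 'k::field)" where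
  "word w \<equiv> Poly_Mapping.single w 1"

definition env_ideal :: "nat \<Rightarrow> 'k smat set \<Rightarrow> ('k smat list \<Rightarrow>\<^sub>0 'k::field) set" where
  "env_ideal N g = pm_span (
     {word (us @ [\<lambda>i j. x i j + y i j] @ ws) - word (us @ [x] @ ws) - word (us @ [y] @ ws)
        |us ws x y. set us \<subseteq> g \<and> set ws \<subseteq> g \<and> x \<in> g \<and> y \<in> g}
   \<union> {word (us @ [\<lambda>i j. c * x i j] @ ws) - pscale c (word (us @ [x] @ ws))
        |us ws c x. set us \<subseteq> g \<and> set ws \<subseteq> g \<and> x \<in> g}
   \<union> {word (us @ [x, y] @ ws) - pscale (ssgn p q) (word (us @ [y, x] @ ws))
          - word (us @ [smat_bracket N p q x y] @ ws)
        |us ws p q x y. set us \<subseteq> g \<and> set ws \<subseteq> g \<and> x \<in> g \<and> y \<in> g \<and>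
           smat_homog p x \<and> smat_homog q y})"

definition tens :: "('a \<Rightarrow>\<^sub>0 'k) \<Rightarrow> ('b \<Rightarrow>\<^sub>0 'k) \<Rightarrow> ('a \<times> 'b \<Rightarrow>\<^sub>0 'k::field)" where
  "tens s t = lin_ext (\<lambda>xs. lin_ext (\<lambda>ys. word (xs, ys)) t) s"

text \<open>$U(g) \otimes U(h)$ is the tensor product of the free algebras on \<open>g\<close> and \<open>h\<close> modulo
  $I(g) \otimes T(h) + T(g) \otimes I(h)$, where $T$ is the free algebra and $I$ the defining
  ideal. The sets \<open>g\<close> and \<open>h\<close> consist of matrices over \<open>I2 M\<close> and \<open>I2 N\<close>.\<close>

definition env2_free :: "'k smat set \<Rightarrow> 'k smat set \<Rightarrow>
    ('k smat list \<times> 'k smat list \<Rightarrow>\<^sub>0 'k::field) set" where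
  "env2_free g h = {t. \<forall>(xs, ys)\<in>Poly_Mapping.keys t. set xs \<subseteq> g \<and> set ys \<subseteq> h}"

definition env2_null :: "nat \<Rightarrow> 'k smat set \<Rightarrow> nat \<Rightarrow> 'k smat set \<Rightarrow>
    ('k smat list \<times> 'k smat list \<Rightarrow>\<^sub>0 'k::field) set" where
  "env2_null M g N h = pm_span ({tens s t |s t. s \<in> env_ideal M g \<and> t \<in> free_alg h}
     \<union> {tens s t |s t. s \<in> free_alg g \<and> t \<in> env_ideal N h})"

definition env2 :: "nat \<Rightarrow> 'k smat set \<Rightarrow> nat \<Rightarrow> 'k smat set \<Rightarrow>
    ('k smat list \<times> 'k smat list \<Rightarrow>\<^sub>0 'k::field) set set" where
  "env2 M g N h = (\<lambda>t. {t + u |u. u \<in> env2_null M g N h}) ` env2_free g h"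

fun word_homog :: "bool \<Rightarrow> 'k::zero smat list \<Rightarrow> bool" where
  "word_homog p [] \<longleftrightarrow> \<not> p"
| "word_homog p (x # xs) \<longleftrightarrow> (\<exists>q. smat_homog q x \<and> word_homog (p \<noteq> q) xs)"

text \<open>A class is homogeneous if it contains a homogeneous representative.\<close>

definition env2_homog :: "bool \<Rightarrow> ('k smat list \<times> 'k smat list \<Rightarrow>\<^sub>0 'k::field) set \<Rightarrow> bool" where
  "env2_homog p C \<longleftrightarrow>
     (\<exists>t\<in>C. \<forall>(xs, ys)\<in>Poly_Mapping.keys t. \<exists>q. word_homog q xs \<and> word_homog (p \<noteq> q) ys)"

text \<open>Here \<open>\<rho>\<close> and \<open>\<sigma>\<close> are the actions of \<open>g\<close> and of \<open>h\<close>.\<close>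

definition free_act :: "('k smat \<Rightarrow> 'k salg \<Rightarrow> 'k salg) \<Rightarrow> ('k smat \<Rightarrow> 'k salg \<Rightarrow> 'k salg)
    \<Rightarrow> ('k smat list \<times> 'k smat list \<Rightarrow>\<^sub>0 'k::field) \<Rightarrow> 'k salg \<Rightarrow> 'k salg" where
  "free_act \<rho> \<sigma> t f =
     (\<Sum>(xs, ys)\<in>Poly_Mapping.keys t. sscale (Poly_Mapping.lookup t (xs, ys)) (foldr \<rho> xs (foldr \<sigma> ys f)))"

definition env2_act :: "('k smat \<Rightarrow> 'k salg \<Rightarrow> 'k salg) \<Rightarrow> ('k smat \<Rightarrow> 'k salg \<Rightarrow> 'k salg)
    \<Rightarrow> ('k smat list \<times> 'k smat list \<Rightarrow>\<^sub>0 'k::field) set \<Rightarrow> 'k salg \<Rightarrow> 'k salg" where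
  "env2_act \<rho> \<sigma> C f = the_elem ((\<lambda>t. free_act \<rho> \<sigma> t f) ` C)"

definition lin_on :: "'k salg set \<Rightarrow> ('k salg \<Rightarrow> 'k::field salg) \<Rightarrow> bool" where
  "lin_on S \<Phi> \<longleftrightarrow> (\<forall>f\<in>S. \<forall>g\<in>S. \<Phi> (f + g) = \<Phi> f + \<Phi> g) \<and> (\<forall>c. \<forall>f\<in>S. \<Phi> (sscale c f) = sscale c (\<Phi> f))"

definition homog_on :: "'k salg set \<Rightarrow> bool \<Rightarrow> ('k salg \<Rightarrow> 'k::field salg) \<Rightarrow> bool" where
  "homog_on S p \<Phi> \<longleftrightarrow> (\<forall>q. \<forall>f\<in>S. ssym_homog q f \<longrightarrow> ssym_homog (p \<noteq> q) (\<Phi> f))"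

text \<open>The last two conditions of the following definition say that the action of the free algebras
  factors through the enveloping superalgebras, and that the two actions supercommute.\<close>

definition env2_module :: "nat \<Rightarrow> 'k smat set \<Rightarrow> nat \<Rightarrow> 'k smat set \<Rightarrow> 'k salg set
    \<Rightarrow> ('k smat \<Rightarrow> 'k salg \<Rightarrow> 'k salg) \<Rightarrow> ('k smat \<Rightarrow> 'k salg \<Rightarrow> 'k::field salg) \<Rightarrow> bool" where
  "env2_module M g N h S \<rho> \<sigma> \<longleftrightarrow>
     (\<forall>x\<in>g. lin_on S (\<rho> x) \<and> \<rho> x ` S \<subseteq> S \<and> (\<forall>p. smat_homog p x \<longrightarrow> homog_on S p (\<rho> x))) \<and>
     (\<forall>y\<in>h. lin_on S (\<sigma> y) \<and> \<sigma> y ` S \<subseteq> S \<and> (\<forall>p. smat_homog p y \<longrightarrow> homog_on S p (\<sigma> y))) \<and>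
     (\<forall>t\<in>env2_null M g N h. \<forall>f\<in>S. free_act \<rho> \<sigma> t f = 0) \<and>
     (\<forall>p q. \<forall>x\<in>g. \<forall>y\<in>h. smat_homog p x \<and> smat_homog q y \<longrightarrow>
        (\<forall>f\<in>S. \<rho> x (\<sigma> y f) = sscale (ssgn p q) (\<sigma> y (\<rho> x f))))"

text \<open>\<open>\<Phi>\<close> is an isomorphism of parity \<open>p\<close> from \<open>S\<close> to \<open>S'\<close>.\<close>

definition env2_iso :: "nat \<Rightarrow> 'k smat set \<Rightarrow> nat \<Rightarrow> 'k smat set
    \<Rightarrow> 'k salg set \<Rightarrow> ('k smat \<Rightarrow> 'k salg \<Rightarrow> 'k salg) \<Rightarrow> ('k smat \<Rightarrow> 'k salg \<Rightarrow> 'k salg)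
    \<Rightarrow> 'k salg set \<Rightarrow> ('k smat \<Rightarrow> 'k salg \<Rightarrow> 'k salg) \<Rightarrow> ('k smat \<Rightarrow> 'k salg \<Rightarrow> 'k salg)
    \<Rightarrow> bool \<Rightarrow> ('k salg \<Rightarrow> 'k::field salg) \<Rightarrow> bool" where
  "env2_iso M g N h S \<rho> \<sigma> S' \<rho>' \<sigma>' p \<Phi> \<longleftrightarrow>
     env2_module M g N h S \<rho> \<sigma> \<and> env2_module M g N h S' \<rho>' \<sigma>' \<and>
     lin_on S \<Phi> \<and> bij_betw \<Phi> S S' \<and> homog_on S p \<Phi> \<and>
     (\<forall>C\<in>env2 M g N h. \<forall>q. env2_homog q C \<longrightarrow>
        (\<forall>f\<in>S. \<Phi> (env2_act \<rho> \<sigma> C f) = sscale (ssgn p q) (env2_act \<rho>' \<sigma>' C (\<Phi> f))))"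

section \<open>The map\<close>

definition xi :: "nat \<Rightarrow> nat \<Rightarrow> (int \<Rightarrow> int \<Rightarrow> nat) \<Rightarrow> nat" where
  "xi m n \<epsilon> = (\<Sum>a\<in>{1..int m}. \<Sum>b\<in>{1..int n}.
     nat (int n * (a - 1) + b + int m * int n - 1) * \<epsilon> a b)"

definition is_Phi :: "nat \<Rightarrow> nat \<Rightarrow> ('k salg \<Rightarrow> 'k::field salg) \<Rightarrow> bool" where
  "is_Phi m n \<Phi> \<longleftrightarrow> lin_on (SU' m n) \<Phi> \<and>
     (\<forall>d \<epsilon>. (\<forall>k\<in>{1..int m}. \<forall>l\<in>{1..int n}. \<epsilon> k l \<in> {0, 1}) \<longrightarrow>
        \<Phi> (\<Prod>(k, l)\<leftarrow>List.product [1..int m] [1..int n]. z' k l ^ d k l * z' (- k) l ^ \<epsilon> k l) =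
        sscale ((- 1) ^ xi m n \<epsilon>)
          (\<Prod>(k, l)\<leftarrow>List.product [1..int m] [1..int n]. z k l ^ d k l * z k (- l) ^ (1 - \<epsilon> k l)))"

end

theory Submission
  imports Defs
begin

text \<open>
  Write $e = (k, l)$ for the indices $1 \le k \le m$, $1 \le l \le n$. Both $S(U')$ and $S(U)$ are the
  algebra of polynomials in $mn$ even variables $x_e$ and $mn$ odd variables $\theta_e$: in both of
  them $x_e$ is the generator with positive indices, while $\theta_e$ is $z'_{-k,l}$ in the
  first and $z_{k,-l}$ in the second. In these terms \<open>\<Phi>\<close> sends $x^a \theta_A$ to
  $\pm x^a \theta_{I - A}$, with \<open>I\<close> the set of all indices; it is the Hodge star, or Fourier
  transform, in the odd variables. The sign $\xi$ is the one for which \<open>\<Phi>\<close> commutes with $x_e$ and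
  with $\partial / \partial x_e$ and exchanges $\theta_e$ with $\partial / \partial \theta_e$, up to the
  factor $(-1)^{mn}$ that an operator of parity $\overline{mn}$ picks up when it passes an
  odd one (\<open>star_even\<close>, \<open>star_odd_gen\<close>, \<open>star_odd_der\<close>).

  A natural action is given by operators $\sum X_{rk} z'_{r,l} \partial'_{k,l}$ of degree two in
  the generators and derivatives. Exchanging $\theta_e$ and $\partial / \partial \theta_e$ in
  them gives again operators of degree two: according to the signs of \<open>r\<close> and \<open>k\<close> they are of type
  $z \partial$, $\partial \partial$, $z z$ or $\partial z$. The symmetries of the
  blocks of \<open>X\<close> turn these into the formulas that define the oscillator action, the constant
  $-n \delta_{i,j}$ being the price of writing $\partial z$ as $1 - z \partial$
  (\<open>pt_U_quadratic\<close>, \<open>p_U'_quadratic\<close>). Hence \<open>\<Phi>\<close> intertwines both actions (\<open>star_pt\<close>, \<open>star_p\<close>).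

  As \<open>\<Phi> \<circ> \<Phi>\<close> is multiplication by \<open>\<plusminus> 1\<close>, the map \<open>\<Phi>\<close> is bijective, and properties of actions can be carried
  along it in both directions. That the natural actions respect brackets is a comparison of
  superderivations on generators (\<open>p_U_bracket\<close>, \<open>pt_U'_bracket\<close>); the oscillator actions inherit
  it (\<open>superrep_transfer\<close>). Supercommutation of the two actions is computed on $S(U')$, where one of
  them acts by superderivations (\<open>supercommute_U'\<close>), and carried over to $S(U)$. What remains is the
  passage from the Lie superalgebras to words in the free algebras and to classes
  in $U(\tilde{\mathfrak p}(m)) \otimes U(\mathfrak p(n))$ (\<open>env2_null_acts_zero\<close>, \<open>intertwine_env2\<close>).
\<close>

section \<open>Monomials of a supersymmetric algebra\<close>

definition mon :: "('i \<Rightarrow>\<^sub>0 nat) \<Rightarrow> 'i fset \<Rightarrow> ('i, 'k::comm_ring_1) ssym" where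
  "mon a A = Ssym (Poly_Mapping.single (a, A) 1)"

lemma coeffs_mon: "coeffs (mon a A) = Poly_Mapping.single (a, A) 1"
  by (simp add: mon_def Ssym_inverse)

lemma coeffs_sscale_mon: "coeffs (sscale c (mon a A)) = Poly_Mapping.single (a, A) c"
  by (simp add: coeffs_simps coeffs_mon)

lemma one_eq_mon: "1 = mon 0 {||}"
  by (simp add: mon_def one_ssym_def)

text \<open>Most statements below are linear in an element of which only the supporting monomials are
  restricted, by parity or by the variables that occur. This induction keeps track of
  exactly that.\<close>

lemma ssym_keys_induct [case_names zero mon add]:
  assumes zero: "P 0"
    and mon: "\<And>a A c. (a, A) \<in> Poly_Mapping.keys (coeffs f) \<Longrightarrow> P (sscale c (mon a A))"
    and add: "\<And>f g. P f \<Longrightarrow> P g \<Longrightarrow> P (f + g)"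
  shows "P f"
proof -
  let ?g = "\<lambda>K. \<Sum>(a, A)\<in>K. sscale (Poly_Mapping.lookup (coeffs f) (a, A)) (mon a A)"
  have *: "P (?g K)" if "finite K" "K \<subseteq> Poly_Mapping.keys (coeffs f)" for K
    using that by (induction K) (auto intro!: zero mon add)
  have "f = ?g (Poly_Mapping.keys (coeffs f))"
  proof -
    have *: "coeffs (sum h K) = (\<Sum>x\<in>K. coeffs (h x))" for h :: "'c \<Rightarrow> ('a, 'b) ssym" and K
      by (induction K rule: infinite_finite_induct) (simp_all add: coeffs_simps)
    have "coeffs f = coeffs (?g (Poly_Mapping.keys (coeffs f)))"
      by (rule poly_mapping_eqI)
        (auto simp: * coeffs_sscale_mon case_prod_unfold lookup_sum lookup_single when_def sum.delta' in_keys_iff)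
    then show ?thesis by (simp only: coeffs_inject)
  qed
  then show ?thesis using *[OF finite_keys order_refl] by (rule ssubst)
qed

lemma ssym_all_induct [case_names zero mon add]:
  assumes "P 0" "\<And>c a A. P (sscale c (mon a A))" "\<And>f g. P f \<Longrightarrow> P g \<Longrightarrow> P (f + g)"
  shows "P f"
  by (rule ssym_keys_induct) (use assms in auto)

lemma gen_mult_mon:
  "even_gen e * mon a A = mon (Poly_Mapping.single e 1 + a) A"
  "odd_gen e * mon a A =
    (if e |\<in>| A then 0 else sscale ((- 1) ^ inversions {|e|} A) (mon a (finsert e A)))"
proof -
  have "{|e|} |\<inter>| A = {||} \<longleftrightarrow> e |\<notin>| A" by auto
  then show "even_gen e * mon a A = mon (Poly_Mapping.single e 1 + a) A"
    "odd_gen e * mon a A =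
      (if e |\<in>| A then 0 else sscale ((- 1) ^ inversions {|e|} A) (mon a (finsert e A)))"
    unfolding coeffs_inject[symmetric] times_ssym.rep_eq even_gen.rep_eq odd_gen.rep_eq coeffs_mon
    by (simp_all add: coeffs_simps coeffs_mon)
qed

lemma der_mon:
  "even_der e (mon a A) =
    sscale (of_nat (Poly_Mapping.lookup a e)) (mon (a - Poly_Mapping.single e 1) A)"
  "odd_der e (mon a A) =
    (if e |\<in>| A then sscale ((- 1) ^ inversions {|e|} A) (mon a (A |-| {|e|})) else 0)"
  unfolding coeffs_inject[symmetric] even_der.rep_eq odd_der.rep_eq coeffs_mon
  by (simp_all add: coeffs_simps coeffs_mon)

lemma sscale_m1: "sscale (- 1) f = - f"
  by (transfer, rule poly_mapping_eqI) simp

lemma der_linear: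
  "even_der e (f + g) = even_der e f + even_der e g" "even_der e (sscale c f) = sscale c (even_der e f)"
  "odd_der e (f + g) = odd_der e f + odd_der e g" "odd_der e (sscale c f) = sscale c (odd_der e f)"
  "even_der e 0 = 0" "odd_der e 0 = 0"
  by (transfer; simp add: lin_ext_add lin_ext_pscale)+

text \<open>This is the subalgebra generated by the variables with index in \<open>I\<close>;
  \<open>generated_eq_ssym_on\<close> identifies the two descriptions.\<close>

definition ssym_on :: "'i set \<Rightarrow> ('i, 'k::comm_ring_1) ssym set" where
  "ssym_on I = {f. \<forall>(a, A)\<in>Poly_Mapping.keys (coeffs f). Poly_Mapping.keys a \<subseteq> I \<and> fset A \<subseteq> I}"

lemma ssym_on_zero: "0 \<in> ssym_on I"
  by (simp add: ssym_on_def coeffs_simps)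

lemma ssym_on_add: "f \<in> ssym_on I \<Longrightarrow> g \<in> ssym_on I \<Longrightarrow> f + g \<in> ssym_on I"
  by (auto simp: ssym_on_def coeffs_simps dest!: subsetD[OF keys_add])

lemma keys_pscale: "k \<in> Poly_Mapping.keys (pscale c g) \<Longrightarrow> k \<in> Poly_Mapping.keys g"
  by (auto simp: in_keys_iff)

lemma ssym_on_scale: "f \<in> ssym_on I \<Longrightarrow> sscale c f \<in> ssym_on I"
  by (auto simp: ssym_on_def coeffs_simps dest!: keys_pscale)

lemma ssym_on_sum: "(\<And>x. x \<in> X \<Longrightarrow> h x \<in> ssym_on I) \<Longrightarrow> sum h X \<in> ssym_on I"
  by (induction X rule: infinite_finite_induct) (simp_all add: ssym_on_zero ssym_on_add)

lemma ssym_on_mon: "Poly_Mapping.keys a \<subseteq> I \<Longrightarrow> fset A \<subseteq> I \<Longrightarrow> mon a A \<in> ssym_on I"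
  by (simp add: ssym_on_def coeffs_mon)

lemma ssym_on_induct [consumes 1, case_names zero mon add]:
  assumes "f \<in> ssym_on I" and "P 0"
    and "\<And>a A c. Poly_Mapping.keys a \<subseteq> I \<Longrightarrow> fset A \<subseteq> I \<Longrightarrow> P (sscale c (mon a A))"
    and "\<And>f g. P f \<Longrightarrow> P g \<Longrightarrow> P (f + g)"
  shows "P f"
  by (rule ssym_keys_induct[of P f]) (use assms in \<open>auto simp: ssym_on_def\<close>)

lemma ssym_on_gen_mult:
  assumes "f \<in> ssym_on I" "e \<in> I"
  shows "even_gen e * f \<in> ssym_on I" "odd_gen e * f \<in> ssym_on I"
proof -
  show "even_gen e * f \<in> ssym_on I"
    using assms(1)
  proof (induction rule: ssym_on_induct)
    case (mon a A c)
    have "Poly_Mapping.keys (Poly_Mapping.single e 1 + a) \<subseteq> I"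
      using keys_add[of "Poly_Mapping.single e 1" a] mon assms(2) by auto
    then show ?case
      using mon by (simp add: gen_mult_mon ssym_on_scale ssym_on_mon flip: sscale_mult)
  qed (simp_all add: ssym_on_zero ssym_on_add distrib_left)
  show "odd_gen e * f \<in> ssym_on I"
    using assms(1)
  proof (induction rule: ssym_on_induct)
    case (mon a A c)
    then show ?case
      using assms(2) by (simp add: gen_mult_mon ssym_on_scale ssym_on_mon ssym_on_zero sscale_simps flip: sscale_mult)
  qed (simp_all add: ssym_on_zero ssym_on_add distrib_left)
qed

lemma ssym_on_der:
  assumes "f \<in> ssym_on I"
  shows "even_der e f \<in> ssym_on I" "odd_der e f \<in> ssym_on I"
proof -
  show "even_der e f \<in> ssym_on I"
    using assms
  proof (induction rule: ssym_on_induct)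
    case (mon a A c)
    have "Poly_Mapping.keys (a - Poly_Mapping.single e 1) \<subseteq> I"
      using mon by (auto simp: in_keys_iff lookup_minus)
    then show ?case
      using mon by (simp add: der_linear der_mon ssym_on_scale ssym_on_mon)
  qed (simp_all add: ssym_on_zero ssym_on_add der_linear)
  show "odd_der e f \<in> ssym_on I"
    using assms
  proof (induction rule: ssym_on_induct)
    case (mon a A c)
    then have "fset (A |-| {|e|}) \<subseteq> I" by auto
    with mon show ?case
      by (simp add: der_linear der_mon ssym_on_scale ssym_on_mon ssym_on_zero sscale_simps)
  qed (simp_all add: ssym_on_zero ssym_on_add der_linear)
qed

text \<open>A monomial is built up by multiplying with one generator at a time; for the odd ones this
  produces the ordered product only up to a sign, which the scaling case absorbs.\<close>

lemma ssym_on_gen_induct [consumes 1, case_names one scale add even odd]: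
  fixes f :: "('i::linorder, 'k::comm_ring_1) ssym"
  assumes "f \<in> ssym_on I" and one: "P 1"
    and scale: "\<And>c f. P f \<Longrightarrow> P (sscale c f)" and add: "\<And>f g. P f \<Longrightarrow> P g \<Longrightarrow> P (f + g)"
    and even: "\<And>e f. e \<in> I \<Longrightarrow> P f \<Longrightarrow> P (even_gen e * f)"
    and odd: "\<And>e f. e \<in> I \<Longrightarrow> P f \<Longrightarrow> P (odd_gen e * f)"
  shows "P f"
proof -
  have odd_mon: "P (mon 0 A)" if "fset A \<subseteq> I" for A :: "'i fset"
    using that
  proof (induction A)
    case (insert e A)
    then have "P (odd_gen e * mon 0 A)" by (auto intro: odd)
    then have "P (sscale ((- 1) ^ inversions {|e|} A) (odd_gen e * mon 0 A))" by (rule scale)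
    then show ?case
      using insert.hyps by (simp add: gen_mult_mon sscale_simps flip: power_mult_distrib)
  qed (use one in \<open>simp add: one_eq_mon\<close>)
  have mon: "P (mon a A)" if "Poly_Mapping.keys a \<subseteq> I" "fset A \<subseteq> I" for a :: "'i \<Rightarrow>\<^sub>0 nat" and A
    using that(1)
  proof (induction "\<Sum>e\<in>Poly_Mapping.keys a. Poly_Mapping.lookup a e" arbitrary: a rule: less_induct)
    case less
    show ?case
    proof (cases "a = 0")
      case False
      then obtain e where e: "e \<in> Poly_Mapping.keys a" by fastforce
      define b where "b = a - Poly_Mapping.single e 1"
      have a: "a = Poly_Mapping.single e 1 + b"
        using e by (intro poly_mapping_eqI) (auto simp: b_def lookup_add lookup_minus lookup_single when_def in_keys_iff)
      have b: "Poly_Mapping.keys b \<subseteq> Poly_Mapping.keys a"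
        by (auto simp: b_def in_keys_iff lookup_minus)
      have "(\<Sum>e\<in>Poly_Mapping.keys b. Poly_Mapping.lookup b e) = (\<Sum>e\<in>Poly_Mapping.keys a. Poly_Mapping.lookup b e)"
        by (rule sum.mono_neutral_left) (use b in \<open>auto simp: in_keys_iff\<close>)
      also have "\<dots> < (\<Sum>e\<in>Poly_Mapping.keys a. Poly_Mapping.lookup a e)"
        by (rule sum_strict_mono_ex1) (use e in \<open>auto simp: b_def lookup_minus lookup_single when_def in_keys_iff\<close>)
      finally have "P (mon b A)" using less b by auto
      then have "P (even_gen e * mon b A)" using e less.prems by (auto intro: even)
      then show ?thesis by (simp add: a gen_mult_mon)
    qed (use odd_mon that(2) in simp)
  qed
  have "P (sscale 0 1)" using one by (rule scale)
  with assms(1) show ?thesis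
    by (induction rule: ssym_on_induct) (auto simp: sscale_simps intro: mon scale add)
qed

lemma ssym_on_UNIV: "ssym_on UNIV = UNIV"
  by (auto simp: ssym_on_def)

section \<open>Homogeneous elements\<close>

lemma homog_zero: "ssym_homog q 0"
  by (simp add: ssym_homog_def coeffs_simps)

lemma homog_add: "ssym_homog q f \<Longrightarrow> ssym_homog q g \<Longrightarrow> ssym_homog q (f + g)"
  by (auto simp: ssym_homog_def coeffs_simps dest!: subsetD[OF keys_add])

lemma homog_scale: "ssym_homog q f \<Longrightarrow> ssym_homog q (sscale c f)"
  by (auto simp: ssym_homog_def coeffs_simps dest!: keys_pscale)

lemma homog_sum: "(\<And>x. x \<in> X \<Longrightarrow> ssym_homog q (h x)) \<Longrightarrow> ssym_homog q (sum h X)"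
  by (induction X rule: infinite_finite_induct) (simp_all add: homog_zero homog_add)

lemma homog_mon: "odd (fcard A) = q \<Longrightarrow> ssym_homog q (mon a A)"
  by (simp add: ssym_homog_def coeffs_mon)

lemma homog_induct [consumes 1, case_names zero mon add]:
  assumes "ssym_homog q f" and "P 0"
    and "\<And>a A c. odd (fcard A) = q \<Longrightarrow> P (sscale c (mon a A))"
    and "\<And>f g. P f \<Longrightarrow> P g \<Longrightarrow> P (f + g)"
  shows "P f"
  by (rule ssym_keys_induct[of P f]) (use assms in \<open>auto simp: ssym_homog_def\<close>)

lemma homog_gen_mult:
  assumes "ssym_homog q f"
  shows "ssym_homog q (even_gen e * f)" "ssym_homog (\<not> q) (odd_gen e * f)"
proof -
  show "ssym_homog q (even_gen e * f)"
    using assms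
    by (induction rule: homog_induct)
      (simp_all add: homog_zero homog_add distrib_left gen_mult_mon homog_scale homog_mon flip: sscale_mult)
  show "ssym_homog (\<not> q) (odd_gen e * f)"
    using assms
  proof (induction rule: homog_induct)
    case (mon a A c)
    then show ?case
      by (cases "e |\<in>| A")
        (simp_all add: gen_mult_mon homog_scale homog_mon homog_zero sscale_simps fcard_finsert_disjoint flip: sscale_mult)
  qed (simp_all add: homog_zero homog_add distrib_left)
qed

lemma homog_der:
  assumes "ssym_homog q f"
  shows "ssym_homog q (even_der e f)" "ssym_homog (\<not> q) (odd_der e f)"
proof -
  show "ssym_homog q (even_der e f)"
    using assms
    by (induction rule: homog_induct)
      (simp_all add: homog_zero homog_add der_linear der_mon homog_scale homog_mon)
  show "ssym_homog (\<not> q) (odd_der e f)"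
    using assms
  proof (induction rule: homog_induct)
    case (mon a A c)
    show ?case
    proof (cases "e |\<in>| A")
      case True
      then have "fcard A = Suc (fcard (A |-| {|e|}))" by (metis fcard_Suc_fminus1)
      with mon have "odd (fcard (A |-| {|e|})) = (\<not> q)" by (metis even_Suc)
      with True show ?thesis by (simp only: der_linear der_mon if_True) (intro homog_scale homog_mon)
    qed (simp add: der_linear der_mon sscale_simps homog_zero)
  qed (simp_all add: homog_zero homog_add der_linear)
qed

section \<open>Superderivations\<close>

lemma superderivation_linear:
  assumes "superderivation p D"
  shows "D (f + g) = D f + D g" "D (sscale c f) = sscale c (D f)" "D 0 = 0"
    "D (sum h X) = (\<Sum>x\<in>X. D (h x))"
proof -
  show 1: "D (f + g) = D f + D g" "D (sscale c f) = sscale c (D f)" for f g c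
    using assms by (auto simp: superderivation_def)
  show 2: "D 0 = 0" using 1(2)[of 0 0] by (simp add: sscale_simps)
  show "D (sum h X) = (\<Sum>x\<in>X. D (h x))"
    by (induction X rule: infinite_finite_induct) (simp_all add: 1 2)
qed

lemma homog_one: "ssym_homog False 1"
  by (simp add: one_eq_mon homog_mon fcard.rep_eq)

lemma homog_gen: "ssym_homog False (even_gen e)" "ssym_homog True (odd_gen e)"
  for e :: "'i::linorder"
  using homog_gen_mult[OF homog_one, of e] by simp_all

lemma ssgn_simps:
  "ssgn False q = 1" "ssgn q False = 1" "ssgn True True = - 1"
  by (simp_all add: ssgn_def)

lemma superderivation_gen:
  assumes "superderivation p D"
  shows "D (even_gen e * f) = D (even_gen e) * f + even_gen e * D f"
    "D (odd_gen e * f) = D (odd_gen e) * f + sscale (ssgn p True) (odd_gen e * D f)"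
proof -
  have "D (g * f) = D g * f + sscale (ssgn p q) (g * D f)" if "ssym_homog q g" for q g
    using assms that by (simp add: superderivation_def)
  from this[OF homog_gen(1)] this[OF homog_gen(2)]
  show "D (even_gen e * f) = D (even_gen e) * f + even_gen e * D f"
    "D (odd_gen e * f) = D (odd_gen e) * f + sscale (ssgn p True) (odd_gen e * D f)"
    by (simp_all add: ssgn_simps sscale_simps)
qed

lemma superderivation_one:
  assumes "superderivation p D"
  shows "D 1 = 0"
proof -
  have "D (1 * 1) = D 1 * 1 + sscale (ssgn p False) (1 * D 1)"
    using assms homog_one unfolding superderivation_def by blast
  then show ?thesis by (simp add: ssgn_simps sscale_simps)
qed

text \<open>By the Leibniz rule a superderivation is determined by its values on the generators. All operator
  identities between superderivations below are reduced to generators by this fact.\<close>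

lemma superderivation_eqI:
  assumes D: "superderivation p D" and E: "superderivation p E"
    and even: "\<And>e. D (even_gen e) = E (even_gen e)" and odd: "\<And>e. D (odd_gen e) = E (odd_gen e)"
  shows "D f = E f"
proof -
  have "f \<in> ssym_on UNIV" by (simp add: ssym_on_UNIV)
  then show ?thesis
    by (induction rule: ssym_on_gen_induct)
      (simp_all add: superderivation_one[OF D] superderivation_one[OF E] superderivation_linear[OF D] superderivation_linear[OF E]
        superderivation_gen[OF D] superderivation_gen[OF E] even odd)
qed

lemma superderivation_zero: "superderivation p (\<lambda>_. 0)"
  by (simp add: superderivation_def sscale_simps)

text \<open>The mixed terms $D f \cdot E g$ and $E f \cdot D g$ of the two iterated Leibniz rules cancel. For this
  the parity of \<open>E f\<close> and \<open>D f\<close> has to be known, and \<open>superderivation\<close> contains only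
  the Leibniz rule; hence the two assumptions on homogeneity.\<close>

lemma superderivation_supercommutator:
  fixes D E :: "('i::linorder, 'k::comm_ring_1) ssym \<Rightarrow> ('i, 'k) ssym"
  assumes D: "superderivation p D" and E: "superderivation q E"
    and hD: "\<And>r f. ssym_homog r f \<Longrightarrow> ssym_homog (p \<noteq> r) (D f)"
    and hE: "\<And>r f. ssym_homog r f \<Longrightarrow> ssym_homog (q \<noteq> r) (E f)"
  shows "superderivation (p \<noteq> q) (\<lambda>f. D (E f) - sscale (ssgn p q) (E (D f)))"
  unfolding superderivation_def
proof (intro conjI allI impI)
  note lin = superderivation_linear[OF D] superderivation_linear[OF E]
  have neg: "sscale c (f - g) = sscale c f - sscale c g" for c and f g :: "('i, 'k) ssym"
    by (transfer, rule poly_mapping_eqI) (simp add: lookup_minus algebra_simps)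
  show "D (E (f + g)) - sscale (ssgn p q) (E (D (f + g))) =
      D (E f) - sscale (ssgn p q) (E (D f)) + (D (E g) - sscale (ssgn p q) (E (D g)))" for f g
    by (simp add: lin sscale_simps)
  show "D (E (sscale c f)) - sscale (ssgn p q) (E (D (sscale c f))) =
      sscale c (D (E f) - sscale (ssgn p q) (E (D f)))" for c f
    by (simp add: lin sscale_simps neg mult.commute)
  fix r and f g :: "('i, 'k) ssym" assume f: "ssym_homog r f"
  have leib: "D (f * g) = D f * g + sscale (ssgn p r) (f * D g)"
    if "ssym_homog r f" for r f g using D that by (simp add: superderivation_def)
  have leib': "E (f * g) = E f * g + sscale (ssgn q r) (f * E g)"
    if "ssym_homog r f" for r f g using E that by (simp add: superderivation_def)
  show "D (E (f * g)) - sscale (ssgn p q) (E (D (f * g))) =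
      (D (E f) - sscale (ssgn p q) (E (D f))) * g +
      sscale (ssgn (p \<noteq> q) r) (f * (D (E g) - sscale (ssgn p q) (E (D g))))"
    unfolding leib[OF f] leib'[OF f] lin leib[OF f] leib'[OF f] leib[OF hE[OF f]] leib'[OF hD[OF f]]
    by (cases p; cases q; cases r)
      (simp_all add: ssgn_simps sscale_simps neg sscale_m1 algebra_simps)
qed

text \<open>The supercommutators are superderivations that kill all generators.\<close>

lemma ders_supercommute:
  "even_der d (even_der e f) = even_der e (even_der d f)"
  "even_der d (odd_der e f) = odd_der e (even_der d f)"
proof -
  have one: "even_der e 1 = 0" "odd_der e 1 = 0" for e :: 'a
    by (simp_all add: one_eq_mon der_mon sscale_simps)
  have "even_der d (even_der e f) - sscale (ssgn False False) (even_der e (even_der d f)) = 0"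
    by (rule superderivation_eqI[OF superderivation_supercommutator superderivation_zero])
      (simp_all add: superderivation_even_der homog_der gen_derivatives one der_linear sscale_simps)
  then show "even_der d (even_der e f) = even_der e (even_der d f)"
    by (simp add: ssgn_simps sscale_simps)
  have "even_der d (odd_der e f) - sscale (ssgn False True) (odd_der e (even_der d f)) = 0"
    by (rule superderivation_eqI[OF superderivation_supercommutator superderivation_zero])
      (simp_all add: superderivation_even_der superderivation_odd_der homog_der gen_derivatives one der_linear sscale_simps)
  then show "even_der d (odd_der e f) = odd_der e (even_der d f)"
    by (simp add: ssgn_simps sscale_simps)
qed

section \<open>The Fourier transform in the odd variables\<close>

definition symdiff :: "'i fset \<Rightarrow> 'i fset \<Rightarrow> 'i fset" where
  "symdiff A B = (A |-| B) |\<union>| (B |-| A)"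

text \<open>The position of \<open>e\<close> in \<open>I\<close>, counted from 1, is one more than the number of elements of \<open>I\<close>
  below \<open>e\<close>; so every \<open>e\<close> contributes its position plus $|I| - 1$, as in \<open>xi\<close>.\<close>

definition star_exp :: "'i::linorder fset \<Rightarrow> 'i fset \<Rightarrow> nat" where
  "star_exp I A = (\<Sum>e\<in>fset (A |\<inter>| I). card {d \<in> fset I. d < e} + fcard I)"

text \<open>The complement is taken as a symmetric difference with \<open>I\<close>. On monomials with odd
  part inside \<open>I\<close> this is the complement in \<open>I\<close>, and odd variables outside \<open>I\<close> are left alone;
  in this way \<open>star I\<close> is a bijection of the whole algebra, and its exchange rules
  hold without any condition on the argument.\<close>

definition star :: "'i::linorder fset \<Rightarrow> ('i, 'k) ssym \<Rightarrow> ('i, 'k::comm_ring_1) ssym" where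
  "star I f = Ssym (lin_ext (\<lambda>(a, A). Poly_Mapping.single (a, symdiff A I) ((- 1) ^ star_exp I A)) (coeffs f))"

lemma coeffs_star: "coeffs (star I f) =
    lin_ext (\<lambda>(a, A). Poly_Mapping.single (a, symdiff A I) ((- 1) ^ star_exp I A)) (coeffs f)"
  by (simp add: star_def Ssym_inverse)

lemma star_linear:
  "star I (f + g) = star I f + star I g" "star I (sscale c f) = sscale c (star I f)"
  "star I 0 = 0"
  by (simp_all add: coeffs_star coeffs_simps lin_ext_add lin_ext_pscale flip: coeffs_inject)

lemma star_sum: "star I (sum h X) = (\<Sum>x\<in>X. star I (h x))"
  by (induction X rule: infinite_finite_induct) (simp_all add: star_linear)

lemma star_mon: "star I (mon a A) = sscale ((- 1) ^ star_exp I A) (mon a (symdiff A I))"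
  by (simp add: coeffs_star coeffs_mon coeffs_sscale_mon flip: coeffs_inject)

lemma star_even:
  "star I (even_gen e * f) = even_gen e * star I f"
  "star I (even_der e f) = even_der e (star I f)"
  by (induction f rule: ssym_all_induct)
    (simp_all add: star_linear star_mon gen_mult_mon der_mon der_linear distrib_left sscale_simps mult_ac
      flip: sscale_mult)

lemma even_card_symdiff:
  assumes "finite A" "finite B"
  shows "even (card (A - B \<union> (B - A)) + (card A + card B))"
proof -
  have "card (A - B \<union> (B - A)) = card (A - B) + card (B - A)"
    using assms by (intro card_Un_disjoint) auto
  moreover have "card A = card (A - B) + card (A \<inter> B)" "card B = card (B - A) + card (A \<inter> B)"
    using assms by (simp_all add: card_Diff_subset_Int Int_commute card_mono le_add_diff_inverse2
        ordered_cancel_comm_monoid_diff_class.diff_add)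
  ultimately have "card (A - B \<union> (B - A)) + (card A + card B) =
      2 * (card (A - B) + card (B - A) + card (A \<inter> B))" by simp
  then show ?thesis by simp
qed

text \<open>The reason behind the signs in \<open>star_exp\<close>: moving $\theta_e$ to its place in $\theta_A$ and removing it
  from the complement costs together as many transpositions, modulo 2, as there are elements of
  \<open>I\<close> below \<open>e\<close>. Elements of \<open>A\<close> outside \<open>I\<close> are passed twice.\<close>

lemma even_inversions_symdiff:
  "even (inversions {|e|} A + inversions {|e|} (symdiff A I) + card {d \<in> fset I. d < e})"
proof -
  have inv: "inversions {|e|} A = card {d \<in> fset A. d < e}" for A
  proof -
    have "{(s, t). s |\<in>| {|e|} \<and> t |\<in>| A \<and> t < s} = Pair e ` {d \<in> fset A. d < e}" by auto
    then show ?thesis by (simp add: inversions_def card_image inj_on_def)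
  qed
  have "{d \<in> fset (symdiff A I). d < e} = {d \<in> fset A. d < e} - {d \<in> fset I. d < e} \<union>
      ({d \<in> fset I. d < e} - {d \<in> fset A. d < e})"
    by (auto simp: symdiff_def)
  then show ?thesis
    using even_card_symdiff[of "{d \<in> fset A. d < e}" "{d \<in> fset I. d < e}"] by (simp add: inv algebra_simps)
qed

text \<open>If \<open>e\<close> is not in \<open>A\<close>, the three signs involved are the two of \<open>even_inversions_symdiff\<close> and the
  contribution of \<open>e\<close> to \<open>star_exp\<close>; they multiply to $(-1)^{|I|}$. Otherwise both sides vanish.\<close>

lemma star_odd_gen:
  assumes e: "e |\<in>| I"
  shows "star I (odd_gen e * f) = sscale ((- 1) ^ fcard I) (odd_der e (star I f))"
proof (induction f rule: ssym_all_induct)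
  case (mon c a A)
  show ?case
  proof (cases "e |\<in>| A")
    case True
    then show ?thesis
      using e by (simp add: star_linear gen_mult_mon star_mon der_linear der_mon symdiff_def sscale_simps flip: sscale_mult)
  next
    case False
    have "finsert e A |\<inter>| I = finsert e (A |\<inter>| I)" using e by auto
    then have exp: "star_exp I (finsert e A) = card {d \<in> fset I. d < e} + fcard I + star_exp I A"
      using False by (simp add: star_exp_def)
    have set: "symdiff (finsert e A) I = symdiff A I |-| {|e|}" "e |\<in>| symdiff A I"
      using e False by (auto simp: symdiff_def)
    have sgn: "(- 1 :: 'b) ^ (inversions {|e|} A + star_exp I (finsert e A)) =
        (- 1) ^ (fcard I + (star_exp I A + inversions {|e|} (symdiff A I)))"
      using even_inversions_symdiff[of e A I] unfolding exp by (intro minus_one_power_eq) presburger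
    have "star I (odd_gen e * sscale c (mon a A)) =
        sscale (c * (- 1) ^ (inversions {|e|} A + star_exp I (finsert e A))) (mon a (symdiff (finsert e A) I))"
      using False by (simp add: star_linear gen_mult_mon star_mon sscale_simps power_add mult.assoc flip: sscale_mult)
    also have "\<dots> = sscale ((- 1) ^ fcard I) (odd_der e (star I (sscale c (mon a A))))"
      unfolding sgn
      using set by (simp add: star_linear star_mon der_linear der_mon sscale_simps power_add mult_ac)
    finally show ?thesis .
  qed
qed (simp_all add: star_linear der_linear sscale_simps distrib_left)

text \<open>The elements of \<open>A\<close> contribute to the first sign and those of the complement to the second,
  so that the product does not depend on \<open>A\<close>.\<close>

lemma star_star: "star I (star I f) = sscale ((- 1) ^ star_exp I I) f"
proof (induction f rule: ssym_all_induct)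
  case (mon c a A)
  have set: "symdiff (symdiff A I) I = A" "symdiff A I |\<inter>| I = I |-| A"
    by (auto simp: symdiff_def)
  have "star_exp I A + star_exp I (symdiff A I) = star_exp I I"
  proof -
    have "fset I = fset (A |\<inter>| I) \<union> fset (I |-| A)" by auto
    then show ?thesis
      unfolding star_exp_def set finter_absorb
      by (subst (3) \<open>fset I = _\<close>) (rule sum.union_disjoint[symmetric]; auto)
  qed
  then have "(- 1 :: 'b) ^ star_exp I A * (- 1) ^ star_exp I (symdiff A I) = (- 1) ^ star_exp I I"
    by (simp flip: power_add)
  then show ?case
    by (simp add: star_linear star_mon sscale_simps set mult.assoc) (simp add: mult.commute)
qed (simp_all add: star_linear sscale_simps)

text \<open>This is \<open>star_odd_gen\<close> conjugated by \<open>star I\<close>, which is its own inverse up to a sign.\<close>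

lemma star_odd_der:
  assumes e: "e |\<in>| I"
  shows "star I (odd_der e f) = sscale ((- 1) ^ fcard I) (odd_gen e * star I f)"
proof -
  define c :: 'b where "c = (- 1) ^ star_exp I I"
  define s :: 'b where "s = (- 1) ^ fcard I"
  have cs: "c * c = 1" "s * s = 1" by (simp_all add: c_def s_def flip: power_mult_distrib)
  have "star I (star I (odd_gen e * star I f)) = sscale s (star I (odd_der e (star I (star I f))))"
    by (simp add: star_odd_gen[OF e] star_linear s_def)
  then have "sscale c (odd_gen e * star I f) = sscale c (sscale s (star I (odd_der e f)))"
    by (simp add: star_star star_linear der_linear sscale_simps mult.commute flip: c_def)
  then have "sscale (s * (c * c)) (odd_gen e * star I f) = sscale ((c * c) * (s * s)) (star I (odd_der e f))"
    by (metis sscale_simps(5) mult.assoc mult.commute)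
  then show ?thesis by (simp add: cs sscale_simps s_def)
qed

lemma star_homog:
  assumes "ssym_homog q f"
  shows "ssym_homog (odd (fcard I) \<noteq> q) (star I f)"
  using assms
proof (induction rule: homog_induct)
  case (mon a A c)
  have "fset (symdiff A I) = fset A - fset I \<union> (fset I - fset A)"
    by (auto simp: symdiff_def)
  then have "even (fcard (symdiff A I) + (fcard A + fcard I))"
    using even_card_symdiff[of "fset A" "fset I"] by (simp add: fcard.rep_eq)
  with mon show ?case by (auto simp: star_linear star_mon intro!: homog_scale homog_mon)
qed (simp_all add: star_linear homog_zero homog_add)

lemma star_on:
  assumes "f \<in> ssym_on J" "fset I \<subseteq> J"
  shows "star I f \<in> ssym_on J"
  using assms(1)
proof (induction rule: ssym_on_induct)
  case (mon a A c)
  then have "fset (symdiff A I) \<subseteq> J" using assms(2) by (auto simp: symdiff_def)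
  with mon show ?case by (simp add: star_linear star_mon ssym_on_scale ssym_on_mon)
qed (simp_all add: star_linear ssym_on_zero ssym_on_add)

lemma star_bij: "fset I \<subseteq> J \<Longrightarrow> bij_betw (star I) (ssym_on J) (ssym_on J)"
  by (rule bij_betw_byWitness[where f' = "\<lambda>f. sscale ((- 1) ^ star_exp I I) (star I f)"])
    (auto simp: star_linear star_star sscale_simps star_on ssym_on_scale simp flip: power_mult_distrib)

section \<open>Ordered products and the subalgebras they span\<close>

definition grid :: "nat \<Rightarrow> nat \<Rightarrow> (int \<times> int) fset" where
  "grid m n = Abs_fset ({1..int m} \<times> {1..int n})"

lemma fset_grid: "fset (grid m n) = {1..int m} \<times> {1..int n}"
  by (simp add: grid_def Abs_fset_inverse)

lemma fcard_grid: "fcard (grid m n) = m * n"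
  by (simp add: fcard.rep_eq fset_grid card_cartesian_product)

lemma power_gen_mult_mon:
  "even_gen e ^ k * mon a A = mon (Poly_Mapping.single e k + a) A"
proof (induction k)
  case (Suc k)
  have "Poly_Mapping.single e (Suc k) = Poly_Mapping.single e 1 + Poly_Mapping.single e k"
    by (simp flip: single_add)
  with Suc show ?case by (simp add: mult.assoc gen_mult_mon add.assoc)
qed simp

text \<open>No signs arise here: each new odd variable comes before all those already present.\<close>

lemma prod_list_ordered:
  fixes d \<epsilon> :: "'i::linorder \<Rightarrow> nat"
  assumes "sorted_wrt (<) es" and "\<forall>e\<in>set es. \<epsilon> e \<in> {0, 1}"
  shows "(\<Prod>e\<leftarrow>es. even_gen e ^ d e * odd_gen e ^ \<epsilon> e :: ('i, 'k::comm_ring_1) ssym) =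
    mon (\<Sum>e\<in>set es. Poly_Mapping.single e (d e)) (fset_of_list (filter (\<lambda>e. \<epsilon> e = 1) es))"
  using assms
proof (induction es)
  case Nil
  then show ?case by (simp add: one_eq_mon)
next
  case (Cons e es)
  let ?a = "\<Sum>e\<in>set es. Poly_Mapping.single e (d e)"
  let ?A = "fset_of_list (filter (\<lambda>e. \<epsilon> e = 1) es)"
  have lt: "e < d" if "d |\<in>| ?A" for d using that Cons.prems(1) by (auto simp: fset_of_list_elem)
  then have e: "e |\<notin>| ?A" by blast
  have "{(s, t). s |\<in>| {|e|} \<and> t |\<in>| ?A \<and> t < s} = {}" using lt by fastforce
  then have inv: "inversions {|e|} ?A = 0" unfolding inversions_def by (simp only: card.empty)
  have IH: "(\<Prod>e\<leftarrow>es. even_gen e ^ d e * odd_gen e ^ \<epsilon> e :: ('i, 'k) ssym) = mon ?a ?A"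
    by (rule Cons.IH) (use Cons.prems in auto)
  have "e \<notin> set es" using Cons.prems(1) by auto
  then show ?case
    using Cons.prems(2) e inv
    by (auto simp: IH mult.assoc gen_mult_mon power_gen_mult_mon sscale_simps simp del: fset_of_list_simps
        simp add: fset_of_list_simps(2))
qed

lemma sorted_product:
  assumes "sorted_wrt (<) (xs :: 'a::order list)" "sorted_wrt (<) (ys :: 'b::order list)"
  shows "sorted_wrt (<) (List.product xs ys)"
  using assms(1)
proof (induction xs)
  case (Cons x xs)
  then show ?case
    using assms(2) by (auto simp: sorted_wrt_append sorted_wrt_map less_prod_def' intro: sorted_wrt_mono_rel[rotated])
qed simp

text \<open>Lexicographic order is the order by which monomials of \<open>ssym\<close> are normalised, so the two
  ordered products in the definition of the map are the monomials that \<open>star\<close>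
  relates. The third part matches its sign with \<open>xi\<close>: below \<open>(k, l)\<close> there are
  $n (k - 1) + l - 1$ grid points.\<close>

lemma prod_grid:
  fixes d \<epsilon> :: "int \<Rightarrow> int \<Rightarrow> nat"
  assumes "\<forall>k\<in>{1..int m}. \<forall>l\<in>{1..int n}. \<epsilon> k l \<in> {0, 1 :: nat}"
  defines "A \<equiv> fset_of_list (filter (\<lambda>(k, l). \<epsilon> k l = 1) (List.product [1..int m] [1..int n]))"
    and "a \<equiv> \<Sum>(k, l)\<in>{1..int m} \<times> {1..int n}. Poly_Mapping.single (k, l) (d k l)"
  shows "(\<Prod>(k, l)\<leftarrow>List.product [1..int m] [1..int n]. z' k l ^ d k l * z' (- k) l ^ \<epsilon> k l) = mon a A"
    and "(\<Prod>(k, l)\<leftarrow>List.product [1..int m] [1..int n]. z k l ^ d k l * z k (- l) ^ (1 - \<epsilon> k l)) =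
      mon a (symdiff A (grid m n))"
    and "star_exp (grid m n) A = xi m n \<epsilon>"
proof -
  let ?es = "List.product [1..int m] [1..int n]"
  have sorted: "sorted_wrt (<) ?es" by (intro sorted_product sorted_wrt_upto)
  have set: "set ?es = {1..int m} \<times> {1..int n}" by simp
  have "(\<Prod>(k, l)\<leftarrow>?es. z' k l ^ d k l * z' (- k) l ^ \<epsilon> k l) =
      (\<Prod>e\<leftarrow>?es. even_gen e ^ case_prod d e * odd_gen e ^ case_prod \<epsilon> e)"
    by (intro arg_cong[where f = prod_list] map_cong) (auto simp: z'_def)
  also have "\<dots> = mon a A"
    by (subst prod_list_ordered[OF sorted])
      (use assms(1) in \<open>auto simp: a_def A_def case_prod_unfold\<close>)
  finally show "(\<Prod>(k, l)\<leftarrow>?es. z' k l ^ d k l * z' (- k) l ^ \<epsilon> k l) = mon a A" .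
  have *: "1 - \<epsilon> k l = 1 \<longleftrightarrow> \<epsilon> k l \<noteq> 1" if "k \<in> {1..int m}" "l \<in> {1..int n}" for k l
    using assms(1) that by force
  have "(\<Prod>(k, l)\<leftarrow>?es. z k l ^ d k l * z k (- l) ^ (1 - \<epsilon> k l)) =
      (\<Prod>e\<leftarrow>?es. even_gen e ^ case_prod d e * odd_gen e ^ (1 - case_prod \<epsilon> e))"
    by (intro arg_cong[where f = prod_list] map_cong) (auto simp: z_def)
  also have "\<dots> = mon a (fset_of_list (filter (\<lambda>e. 1 - case_prod \<epsilon> e = 1) ?es))"
    by (subst prod_list_ordered[OF sorted])
      (use assms(1) in \<open>auto simp: a_def case_prod_unfold\<close>)
  also have "fset_of_list (filter (\<lambda>e. 1 - case_prod \<epsilon> e = 1) ?es) = symdiff A (grid m n)"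
    using * by (auto simp: A_def symdiff_def fset_of_list_elem fset_grid)
  finally show "(\<Prod>(k, l)\<leftarrow>?es. z k l ^ d k l * z k (- l) ^ (1 - \<epsilon> k l)) = mon a (symdiff A (grid m n))" .
  have below: "card {d \<in> fset (grid m n). d < (k, l)} + fcard (grid m n) =
      nat (int n * (k - 1) + l + int m * int n - 1)" if "k \<in> {1..int m}" "l \<in> {1..int n}" for k l
  proof -
    have "{d \<in> fset (grid m n). d < (k, l)} = {1..<k} \<times> {1..int n} \<union> {k} \<times> {1..<l}"
      using that by (auto simp: fset_grid less_prod_def')
    also have "card \<dots> = card ({1..<k} \<times> {1..int n}) + card ({k} \<times> {1..<l})"
      by (rule card_Un_disjoint) auto
    also have "\<dots> = nat (k - 1) * n + nat (l - 1)" by (simp add: card_cartesian_product)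
    finally have "int (card {d \<in> fset (grid m n). d < (k, l)}) = (k - 1) * int n + (l - 1)"
      using that by (simp add: int_nat_eq)
    then have "int (card {d \<in> fset (grid m n). d < (k, l)} + fcard (grid m n)) =
        int n * (k - 1) + l + int m * int n - 1"
      by (simp add: fcard_grid algebra_simps)
    then show ?thesis by (metis nat_int)
  qed
  have \<epsilon>: "\<epsilon> k l = (if (k, l) |\<in>| A then 1 else 0)" if "k \<in> {1..int m}" "l \<in> {1..int n}" for k l
  proof -
    have "(k, l) |\<in>| A \<longleftrightarrow> \<epsilon> k l = 1" using that by (simp add: A_def fset_of_list_elem)
    then show ?thesis using assms(1) that by force
  qed
  have "xi m n \<epsilon> = (\<Sum>(k, l)\<in>{1..int m} \<times> {1..int n}.
      (card {d \<in> fset (grid m n). d < (k, l)} + fcard (grid m n)) * \<epsilon> k l)"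
    unfolding xi_def sum.cartesian_product by (intro sum.cong) (auto simp: below)
  also have "\<dots> = (\<Sum>e\<in>fset (grid m n). if e \<in> fset A then card {d \<in> fset (grid m n). d < e} + fcard (grid m n) else 0)"
    unfolding fset_grid by (intro sum.cong refl) (clarsimp simp: \<epsilon>)
  also have "\<dots> = star_exp (grid m n) A"
    unfolding star_exp_def inf_fset.rep_eq by (subst sum.inter_restrict[symmetric]) (simp_all add: Int_commute)
  finally show "star_exp (grid m n) A = xi m n \<epsilon>" by simp
qed

lemma generated_eq_ssym_on:
  fixes G :: "('i::linorder, 'k::field) ssym set"
  assumes "G = even_gen ` I \<union> odd_gen ` I"
  shows "ssym_span {prod_list us |us. set us \<subseteq> G} = ssym_on I"
proof
  show "ssym_span {prod_list us |us. set us \<subseteq> G} \<subseteq> ssym_on I"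
  proof (rule ssym.span_minimal)
    have "prod_list us \<in> ssym_on I" if "set us \<subseteq> G" for us :: "('i, 'k) ssym list"
      using that by (induction us) (auto simp: assms ssym_on_gen_mult one_eq_mon ssym_on_mon)
    then show "{prod_list us |us. set us \<subseteq> G} \<subseteq> ssym_on I" by auto
    show "ssym.subspace (ssym_on I)"
      by (simp add: ssym.subspace_def ssym_on_zero ssym_on_add ssym_on_scale)
  qed
  show "ssym_on I \<subseteq> ssym_span {prod_list us |us. set us \<subseteq> G}" (is "_ \<subseteq> ?S")
  proof
    fix f :: "('i, 'k) ssym" assume "f \<in> ssym_on I"
    moreover have "g * f \<in> ?S" if "g \<in> G" "f \<in> ?S" for g f
      using that(2)
    proof (induction rule: ssym.span_induct_alt)
      case base
      then show ?case by (simp add: ssym.span_zero)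
    next
      case (step c x y)
      then obtain us where "x = prod_list us" "set us \<subseteq> G" by auto
      then have "g * x \<in> {prod_list us |us. set us \<subseteq> G}"
        using that(1) by (auto intro!: exI[of _ "g # us"])
      with step show ?case
        by (simp add: distrib_left ssym.span_add ssym.span_scale ssym.span_base flip: sscale_mult)
    qed
    ultimately show "f \<in> ?S"
    proof (induction rule: ssym_on_gen_induct)
      case one
      show ?case by (rule ssym.span_base) (auto intro!: exI[of _ "[]"])
    qed (auto simp: assms ssym.span_add ssym.span_scale)
  qed
qed

lemma I2_iff: "j \<in> I2 n \<longleftrightarrow> j \<noteq> 0 \<and> \<bar>j\<bar> \<le> int n"
  by (auto simp: I2_def)

lemma SU_eq: "SU m n = ssym_on ({1..int m} \<times> {1..int n})"
  and SU'_eq: "SU' m n = ssym_on ({1..int m} \<times> {1..int n})"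
proof -
  let ?I = "{1..int m} \<times> {1..int n}"
  have "{z i j |i j. i \<in> {1..int m} \<and> j \<in> I2 n} = even_gen ` ?I \<union> (odd_gen ` ?I :: 'a salg set)"
  proof
    show "even_gen ` ?I \<union> (odd_gen ` ?I :: 'a salg set) \<subseteq> {z i j |i j. i \<in> {1..int m} \<and> j \<in> I2 n}"
    proof safe
      fix k l assume kl: "k \<in> {1..int m}" "l \<in> {1..int n}"
      then show "\<exists>i j. even_gen (k, l) = (z i j :: 'a salg) \<and> i \<in> {1..int m} \<and> j \<in> I2 n"
        by (intro exI[of _ k] exI[of _ l]) (auto simp: z_def I2_iff)
      from kl show "\<exists>i j. odd_gen (k, l) = (z i j :: 'a salg) \<and> i \<in> {1..int m} \<and> j \<in> I2 n"
        by (intro exI[of _ k] exI[of _ "- l"]) (auto simp: z_def I2_iff)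
    qed
  next
    have "z i j \<in> even_gen ` ?I \<union> (odd_gen ` ?I :: 'a salg set)" if "i \<in> {1..int m}" "j \<in> I2 n" for i j
      using that by (cases "j > 0") (auto simp: z_def I2_iff intro!: imageI)
    then show "{z i j |i j. i \<in> {1..int m} \<and> j \<in> I2 n} \<subseteq> even_gen ` ?I \<union> (odd_gen ` ?I :: 'a salg set)"
      by blast
  qed
  then show "SU m n = (ssym_on ?I :: 'a salg set)"
    unfolding SU_def by (rule generated_eq_ssym_on)
  have "{z' k l |k l. k \<in> I2 m \<and> l \<in> {1..int n}} = even_gen ` ?I \<union> (odd_gen ` ?I :: 'b salg set)"
  proof
    show "even_gen ` ?I \<union> (odd_gen ` ?I :: 'b salg set) \<subseteq> {z' k l |k l. k \<in> I2 m \<and> l \<in> {1..int n}}"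
    proof safe
      fix k l assume kl: "k \<in> {1..int m}" "l \<in> {1..int n}"
      then show "\<exists>i j. even_gen (k, l) = (z' i j :: 'b salg) \<and> i \<in> I2 m \<and> j \<in> {1..int n}"
        by (intro exI[of _ k] exI[of _ l]) (auto simp: z'_def I2_iff)
      from kl show "\<exists>i j. odd_gen (k, l) = (z' i j :: 'b salg) \<and> i \<in> I2 m \<and> j \<in> {1..int n}"
        by (intro exI[of _ "- k"] exI[of _ l]) (auto simp: z'_def I2_iff)
    qed
  next
    have "z' k l \<in> even_gen ` ?I \<union> (odd_gen ` ?I :: 'b salg set)" if "k \<in> I2 m" "l \<in> {1..int n}" for k l
      using that by (cases "k > 0") (auto simp: z'_def I2_iff intro!: imageI)
    then show "{z' k l |k l. k \<in> I2 m \<and> l \<in> {1..int n}} \<subseteq> even_gen ` ?I \<union> (odd_gen ` ?I :: 'b salg set)"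
      by blast
  qed
  then show "SU' m n = (ssym_on ?I :: 'b salg set)"
    unfolding SU'_def by (rule generated_eq_ssym_on)
qed

lemma is_Phi_star: "is_Phi m n (star (grid m n))"
  unfolding is_Phi_def lin_on_def
proof (intro conjI allI impI ballI)
  fix d \<epsilon> assume "\<forall>k\<in>{1..int m}. \<forall>l\<in>{1..int n}. \<epsilon> k l \<in> {0, 1 :: nat}"
  note * = prod_grid[OF this]
  show "star (grid m n) (\<Prod>(k, l)\<leftarrow>List.product [1..int m] [1..int n]. z' k l ^ d k l * z' (- k) l ^ \<epsilon> k l) =
    sscale ((- 1) ^ xi m n \<epsilon>)
      (\<Prod>(k, l)\<leftarrow>List.product [1..int m] [1..int n]. z k l ^ d k l * z k (- l) ^ (1 - \<epsilon> k l))"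
    unfolding *(1,2) star_mon *(3) ..
qed (simp_all add: star_linear)

text \<open>Every monomial supported on the grid is one of the ordered products, with $\varepsilon$ the
  indicator function of its odd part.\<close>

lemma is_Phi_unique:
  fixes \<Phi> \<Psi> :: "'k::field salg \<Rightarrow> 'k salg"
  assumes \<Phi>: "is_Phi m n \<Phi>" and \<Psi>: "is_Phi m n \<Psi>" and f: "f \<in> SU' m n"
  shows "\<Psi> f = \<Phi> f"
proof -
  have scale0: "sscale 0 f = 0" for f :: "'k salg" by (simp add: sscale_simps)
  have zero: "\<Omega> 0 = 0" if "is_Phi m n \<Omega>" for \<Omega> :: "'k salg \<Rightarrow> 'k salg"
    using that unfolding is_Phi_def lin_on_def SU'_eq by (metis ssym_on_zero scale0)
  have "f \<in> SU' m n \<and> \<Psi> f = \<Phi> f"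
    using f unfolding SU'_eq
  proof (induction rule: ssym_on_induct)
    case (mon a A c)
    define \<epsilon> where "\<epsilon> k l = (if (k, l) |\<in>| A then 1 else 0 :: nat)" for k l
    have \<epsilon>: "\<forall>k\<in>{1..int m}. \<forall>l\<in>{1..int n}. \<epsilon> k l \<in> {0, 1 :: nat}" by (simp add: \<epsilon>_def)
    have A: "fset_of_list (filter (\<lambda>(k, l). \<epsilon> k l = 1) (List.product [1..int m] [1..int n])) = A"
      using mon(2) by (auto simp: \<epsilon>_def fset_of_list_elem)
    have a: "(\<Sum>(k, l)\<in>{1..int m} \<times> {1..int n}. Poly_Mapping.single (k, l) (Poly_Mapping.lookup a (k, l))) = a"
    proof (rule poly_mapping_eqI)
      fix e
      have "Poly_Mapping.lookup a e = 0" if "e \<notin> {1..int m} \<times> {1..int n}"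
        using mon(1) that by (meson in_keys_iff subsetD)
      then show "Poly_Mapping.lookup (\<Sum>(k, l)\<in>{1..int m} \<times> {1..int n}.
          Poly_Mapping.single (k, l) (Poly_Mapping.lookup a (k, l))) e = Poly_Mapping.lookup a e"
        by (simp add: case_prod_unfold lookup_sum lookup_single when_def sum.delta')
    qed
    have eq: "(\<Prod>(k, l)\<leftarrow>List.product [1..int m] [1..int n].
        z' k l ^ Poly_Mapping.lookup a (k, l) * z' (- k) l ^ \<epsilon> k l :: 'k salg) = mon a A"
      using prod_grid(1)[OF \<epsilon>, of "\<lambda>k l. Poly_Mapping.lookup a (k, l)"] unfolding A a .
    have "\<Psi> (mon a A) = \<Phi> (mon a A)"
      using \<Phi> \<Psi> \<epsilon> unfolding is_Phi_def eq[symmetric] by auto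
    moreover have "mon a A \<in> (SU' m n :: 'k salg set)" using mon by (simp add: SU'_eq ssym_on_mon)
    ultimately show ?case
      using \<Phi> \<Psi> unfolding is_Phi_def lin_on_def SU'_eq by (auto simp: ssym_on_scale)
  next
    case (add f g)
    then show ?case
      using \<Phi> \<Psi> unfolding is_Phi_def lin_on_def SU'_eq by (auto simp: ssym_on_add)
  qed (use zero[OF \<Phi>] zero[OF \<Psi>] in \<open>simp add: ssym_on_zero\<close>)
  then show ?thesis by simp
qed

section \<open>The two oscillator actions as quadratic operators\<close>

lemma dz_linear:
  "dz i j (f + g) = dz i j f + dz i j g" "dz i j (sscale c f) = sscale c (dz i j f)" "dz i j 0 = 0"
  "dz i j (sum h X) = (\<Sum>x\<in>X. dz i j (h x))"
  "dz' i j (f + g) = dz' i j f + dz' i j g" "dz' i j (sscale c f) = sscale c (dz' i j f)" "dz' i j 0 = 0"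
  "dz' i j (sum h X) = (\<Sum>x\<in>X. dz' i j (h x))"
proof -
  show *: "dz i j (f + g) = dz i j f + dz i j g" "dz i j (sscale c f) = sscale c (dz i j f)" "dz i j 0 = 0"
    "dz' i j (f + g) = dz' i j f + dz' i j g" "dz' i j (sscale c f) = sscale c (dz' i j f)" "dz' i j 0 = 0"
    for f g c by (simp_all add: dz_def dz'_def der_linear)
  show "dz i j (sum h X) = (\<Sum>x\<in>X. dz i j (h x))" "dz' i j (sum h X) = (\<Sum>x\<in>X. dz' i j (h x))"
    by (induction X rule: infinite_finite_induct) (simp_all add: *)
qed

lemma sum_I2: "(\<Sum>r\<in>I2 n. h r) = (\<Sum>r\<in>{1..int n}. h r + h (- r))"
proof -
  have "(\<Sum>r\<in>I2 n. h r) = (\<Sum>r\<in>{1..int n}. h r) + (\<Sum>r\<in>{- int n..-1}. h r)"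
    unfolding I2_def by (rule sum.union_disjoint) auto
  also have "(\<Sum>r\<in>{- int n..-1}. h r) = (\<Sum>r\<in>{1..int n}. h (- r))"
    by (rule sum.reindex_bij_witness[of _ uminus uminus]) auto
  finally show ?thesis by (simp add: sum.distrib)
qed

lemma p_U_quadratic:
  "p_U m n X f = (\<Sum>k\<in>{1..int m}. \<Sum>i\<in>{1..int n}. \<Sum>j\<in>{1..int n}.
      sscale (X i j) (z k i * dz k j f) + sscale (X i (- j)) (z k i * dz k (- j) f)
      + sscale (X (- i) j) (z k (- i) * dz k j f) + sscale (X (- i) (- j)) (z k (- i) * dz k (- j) f))"
  unfolding p_U_def sum_I2 sum_distrib_right distrib_right sscale_mult(1)[symmetric] sum.distrib[symmetric]
  by (rule sum.cong[OF refl], subst sum.swap) (simp add: add_ac)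

lemma pt_U'_quadratic:
  "pt_U' m n X f = (\<Sum>l\<in>{1..int n}. \<Sum>r\<in>{1..int m}. \<Sum>k\<in>{1..int m}.
      sscale (X r k) (z' r l * dz' k l f) + sscale (X (- r) k) (z' (- r) l * dz' k l f)
      + sscale (X r (- k)) (z' r l * dz' (- k) l f) + sscale (X (- r) (- k)) (z' (- r) l * dz' (- k) l f))"
  unfolding pt_U'_def sum_I2 sum_distrib_right distrib_right sscale_mult(1)[symmetric] sum.distrib[symmetric]
  by (subst sum.swap, rule sum.cong[OF refl], subst sum.swap) (simp add: add_ac)

text \<open>The oscillator actions are given by sums over $i \le j$ or $i < j$, whereas the operators of degree two
  are summed over the full square. This splitting and its variants for symmetric and
  skew-symmetric coefficients mediate between the two.\<close>

lemma sum_square_split: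
  fixes F :: "int \<Rightarrow> int \<Rightarrow> 'a::comm_monoid_add"
  shows "(\<Sum>i\<in>{1..N}. \<Sum>j\<in>{1..N}. F i j) =
    (\<Sum>i\<in>{1..N}. F i i) + (\<Sum>i\<in>{1..N}. \<Sum>j\<in>{i<..N}. F i j + F j i)"
proof -
  have "(\<Sum>j\<in>{1..N}. F i j) = F i i + ((\<Sum>j\<in>{i<..N}. F i j) + (\<Sum>j\<in>{1..<i}. F i j))"
    if "i \<in> {1..N}" for i
  proof -
    have "{1..N} = insert i ({i<..N} \<union> {1..<i})" using that by auto
    moreover have "sum (F i) ({i<..N} \<union> {1..<i}) = sum (F i) {i<..N} + sum (F i) {1..<i}"
      by (rule sum.union_disjoint) auto
    ultimately show ?thesis by simp
  qed
  moreover have "(\<Sum>i\<in>{1..N}. \<Sum>j\<in>{1..<i}. F i j) = (\<Sum>i\<in>{1..N}. \<Sum>j\<in>{i<..N}. F j i)"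
  proof -
    have "(\<Sum>i\<in>{1..N}. \<Sum>j\<in>{1..<i}. F i j) = (\<Sum>(i, j)\<in>Sigma {1..N} (\<lambda>i. {1..<i}). F i j)"
      by (rule sum.Sigma) auto
    also have "\<dots> = (\<Sum>(i, j)\<in>Sigma {1..N} (\<lambda>i. {i<..N}). F j i)"
      by (rule sum.reindex_bij_witness[of _ prod.swap prod.swap]) auto
    also have "\<dots> = (\<Sum>i\<in>{1..N}. \<Sum>j\<in>{i<..N}. F j i)"
      by (rule sum.Sigma[symmetric]) auto
    finally show ?thesis .
  qed
  ultimately show ?thesis by (simp add: sum.distrib)
qed

lemma sum_symmetric:
  assumes "\<And>i j. i \<in> {1..N} \<Longrightarrow> j \<in> {1..N} \<Longrightarrow> x i j = x j i"
  shows "(\<Sum>i\<in>{1..N::int}. \<Sum>j\<in>{1..N}. sscale (x i j) (B i j)) =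
    (\<Sum>i\<in>{1..N}. \<Sum>j\<in>{i..N}. sscale (x i j) (if i = j then B i i else B i j + B j i))"
proof -
  have "(\<Sum>j\<in>{i..N}. sscale (x i j) (if i = j then B i i else B i j + B j i)) =
      sscale (x i i) (B i i) + (\<Sum>j\<in>{i<..N}. sscale (x i j) (B i j) + sscale (x j i) (B j i))"
    if "i \<in> {1..N}" for i
  proof -
    have "{i..N} = insert i {i<..N}" using that by auto
    moreover have "sscale (x i j) (if i = j then B i i else B i j + B j i) =
        sscale (x i j) (B i j) + sscale (x j i) (B j i)" if "j \<in> {i<..N}" for j
      using that \<open>i \<in> {1..N}\<close> assms[of i j] by (simp add: sscale_simps)
    ultimately show ?thesis by simp
  qed
  then show ?thesis unfolding sum_square_split by (simp add: sum.distrib)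
qed

lemma sum_skew:
  fixes x :: "int \<Rightarrow> int \<Rightarrow> 'k::field_char_0"
  assumes "\<And>i j. i \<in> {1..N} \<Longrightarrow> j \<in> {1..N} \<Longrightarrow> x i j = - x j i"
  shows "(\<Sum>i\<in>{1..N::int}. \<Sum>j\<in>{1..N}. sscale (x i j) (B i j)) =
    (\<Sum>i\<in>{1..N}. \<Sum>j\<in>{i<..N}. sscale (x i j) (B i j - B j i))"
proof -
  have "x i i = 0" if "i \<in> {1..N}" for i
    using assms[OF that that] by (simp add: eq_neg_iff_add_eq_0 flip: mult_2)
  moreover have "sscale (x i j) (B i j - B j i) = sscale (x i j) (B i j) + sscale (x j i) (B j i)"
    if "i \<in> {1..N}" "j \<in> {i<..N}" for i j
    using that assms[of j i] by (simp add: ssym.scale_right_diff_distrib)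
  ultimately show ?thesis unfolding sum_square_split by (simp add: sscale_simps)
qed

lemma z_dz_odd:
  assumes "l > 0" "b > 0"
  shows "dz k (- l) (z a (- b) * f) = (if a = k \<and> b = l then f else 0) - z a (- b) * dz k (- l) f"
    "dz' (- l) k (z' (- b) a * f) = (if a = k \<and> b = l then f else 0) - z' (- b) a * dz' (- l) k f"
  using assms
  by (auto simp: dz_def z_def dz'_def z'_def superderivation_gen(2)[OF superderivation_odd_der]
      gen_derivatives ssgn_simps sscale_m1)

lemma dz_commute:
  assumes "l > 0" "b > 0"
  shows "dz k l (dz a (- b) f) = dz a (- b) (dz k l f)" "dz' l k (dz' (- b) a f) = dz' (- b) a (dz' l k f)"
  using assms by (simp_all add: dz_def dz'_def ders_supercommute)

lemma z_commute:
  assumes "l > 0"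
  shows "z k l * (g * f) = g * (z k l * f)" "z' l k * (g * f) = g * (z' l k * f)"
  using assms even_gen_commute[of "(k, l)" "g * f"] even_gen_commute[of "(l, k)" "g * f"]
  by (simp_all add: z_def z'_def mult.assoc even_gen_commute[of _ f])

lemma of_nat_mult_eq_sscale:
  fixes f :: "('i::linorder, 'k::field) ssym"
  shows "of_nat c * f = sscale (of_nat c) f"
  by (induction c) (simp_all add: sscale_simps distrib_right ssym.scale_left_distrib)

text \<open>The oscillator action in a form that treats the four blocks of \<open>X\<close> alike. The diagonal blocks \<open>X i j\<close>
  and \<open>X (- i) (- j) = - X j i\<close> combine into \<open>a_U'\<close>: writing $\partial' z'$ as $1 - z' \partial'$ for odd
  generators gives the shift by $m \delta_{i,j}$. The symmetric block gives \<open>b_U'\<close> and the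
  skew-symmetric one \<open>c_U'\<close>.\<close>

lemma p_U'_quadratic:
  fixes X :: "'k::field_char_0 smat"
  assumes "X \<in> peri n"
  shows "p_U' m n X f = (\<Sum>k\<in>{1..int m}. \<Sum>i\<in>{1..int n}. \<Sum>j\<in>{1..int n}.
      sscale (X i j) (z' k i * dz' k j f) + sscale (X i (- j)) (z' k i * (z' (- k) j * f))
      + sscale (X (- i) j) (dz' (- k) i (dz' k j f)) + sscale (X (- i) (- j)) (dz' (- k) i (z' (- k) j * f)))"
proof -
  let ?M = "{1..int m}" and ?N = "{1..int n}"
  have rel: "X (- i) (- j) = - X j i" "X i (- j) = X j (- i)" "X (- i) j = - X (- j) i"
    if "i \<in> ?N" "j \<in> ?N" for i j
    using assms that unfolding peri_def by blast+
  define A where "A i j = (\<Sum>k\<in>?M. z' k i * dz' k j f)" for i j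
  define B where "B i j = (\<Sum>k\<in>?M. z' k i * (z' (- k) j * f))" for i j
  define C where "C i j = (\<Sum>k\<in>?M. dz' (- k) i (dz' k j f))" for i j
  define D where "D i j = (\<Sum>k\<in>?M. dz' (- k) i (z' (- k) j * f))" for i j
  have a: "a_U' m i j f = A i j - D j i" for i j
  proof -
    have "D j i = (\<Sum>k\<in>?M. (if i = j then f else 0) - z' (- k) i * dz' (- k) j f)"
      unfolding D_def by (intro sum.cong) (auto simp: z_dz_odd)
    also have "\<dots> = sscale (if i = j then of_nat m else 0) f - (\<Sum>k\<in>?M. z' (- k) i * dz' (- k) j f)"
      by (simp add: sum_subtractf sscale_simps of_nat_mult_eq_sscale)
    finally show ?thesis by (simp add: a_U'_def A_def sum_I2 sum.distrib)
  qed
  have b: "b_U' m i j f = (if i = j then B i i else B i j + B j i)" for i j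
  proof -
    have "z' (- k) i * z' k j * f = z' k j * (z' (- k) i * f)" if "k \<in> ?M" for k
      using that by (simp add: mult.assoc z_commute)
    then show ?thesis by (simp add: b_U'_def B_def sum_I2 sum.distrib mult.assoc)
  qed
  have c: "c_U' m i j f = C i j - C j i" for i j
  proof -
    have "dz' k i (dz' (- k) j f) = dz' (- k) j (dz' k i f)" if "k \<in> ?M" for k
      using that by (simp add: dz_commute)
    then show ?thesis
      by (simp add: c_U'_def C_def sum_I2 sum_subtractf sscale_simps sscale_m1)
  qed
  have "(\<Sum>i\<in>?N. \<Sum>j\<in>?N. sscale (X (- i) (- j)) (D i j)) = (\<Sum>i\<in>?N. \<Sum>j\<in>?N. sscale (X (- j) (- i)) (D j i))"
    by (rule sum.swap)
  also have "\<dots> = (\<Sum>i\<in>?N. \<Sum>j\<in>?N. - sscale (X i j) (D j i))"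
    by (intro sum.cong) (auto simp: rel)
  finally have "(\<Sum>i\<in>?N. \<Sum>j\<in>?N. sscale (X i j) (a_U' m i j f)) =
      (\<Sum>i\<in>?N. \<Sum>j\<in>?N. sscale (X i j) (A i j)) + (\<Sum>i\<in>?N. \<Sum>j\<in>?N. sscale (X (- i) (- j)) (D i j))"
    by (simp add: a ssym.scale_right_diff_distrib sum_subtractf sum_negf)
  moreover have "(\<Sum>i\<in>?N. \<Sum>j\<in>{i..int n}. sscale (X i (- j)) (b_U' m i j f)) =
      (\<Sum>i\<in>?N. \<Sum>j\<in>?N. sscale (X i (- j)) (B i j))"
    unfolding b by (rule sum_symmetric[symmetric]) (rule rel)
  moreover have "(\<Sum>i\<in>?N. \<Sum>j\<in>{i<..int n}. sscale (X (- i) j) (c_U' m i j f)) =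
      (\<Sum>i\<in>?N. \<Sum>j\<in>?N. sscale (X (- i) j) (C i j))"
    unfolding c by (rule sum_skew[symmetric]) (rule rel)
  ultimately have "p_U' m n X f = (\<Sum>i\<in>?N. \<Sum>j\<in>?N. sscale (X i j) (A i j) + sscale (X i (- j)) (B i j)
      + sscale (X (- i) j) (C i j) + sscale (X (- i) (- j)) (D i j))"
    by (simp add: p_U'_def sum.distrib add_ac)
  also have "\<dots> = (\<Sum>i\<in>?N. \<Sum>j\<in>?N. \<Sum>k\<in>?M.
      sscale (X i j) (z' k i * dz' k j f) + sscale (X i (- j)) (z' k i * (z' (- k) j * f))
      + sscale (X (- i) j) (dz' (- k) i (dz' k j f)) + sscale (X (- i) (- j)) (dz' (- k) i (z' (- k) j * f)))"
    by (simp add: A_def B_def C_def D_def ssym.scale_sum_right sum.distrib)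
  also have "\<dots> = (\<Sum>i\<in>?N. \<Sum>k\<in>?M. \<Sum>j\<in>?N.
      sscale (X i j) (z' k i * dz' k j f) + sscale (X i (- j)) (z' k i * (z' (- k) j * f))
      + sscale (X (- i) j) (dz' (- k) i (dz' k j f)) + sscale (X (- i) (- j)) (dz' (- k) i (z' (- k) j * f)))"
    by (rule sum.cong[OF refl], rule sum.swap)
  also have "\<dots> = (\<Sum>k\<in>?M. \<Sum>i\<in>?N. \<Sum>j\<in>?N.
      sscale (X i j) (z' k i * dz' k j f) + sscale (X i (- j)) (z' k i * (z' (- k) j * f))
      + sscale (X (- i) j) (dz' (- k) i (dz' k j f)) + sscale (X (- i) (- j)) (dz' (- k) i (z' (- k) j * f)))"
    by (rule sum.swap)
  finally show ?thesis .
qed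

text \<open>The mirror image of \<open>p_U'_quadratic\<close>; here the multiplications sit in the skew-symmetric block and
  the second order operators in the symmetric one.\<close>

lemma pt_U_quadratic:
  fixes X :: "'k::field_char_0 smat"
  assumes "X \<in> peri_t m"
  shows "pt_U m n X f = (\<Sum>l\<in>{1..int n}. \<Sum>r\<in>{1..int m}. \<Sum>k\<in>{1..int m}.
      sscale (X r k) (z r l * dz k l f) + sscale (X (- r) k) (dz r (- l) (dz k l f))
      + sscale (X r (- k)) (z r l * (z k (- l) * f)) + sscale (X (- r) (- k)) (dz r (- l) (z k (- l) * f)))"
proof -
  let ?M = "{1..int m}" and ?N = "{1..int n}"
  have rel: "X (- i) (- j) = - X j i" "X (- i) j = X (- j) i" "X i (- j) = - X j (- i)"
    if "i \<in> ?M" "j \<in> ?M" for i j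
    using assms that unfolding peri_t_def by blast+
  define A where "A r k = (\<Sum>l\<in>?N. z r l * dz k l f)" for r k
  define B where "B r k = (\<Sum>l\<in>?N. dz r (- l) (dz k l f))" for r k
  define C where "C r k = (\<Sum>l\<in>?N. z r l * (z k (- l) * f))" for r k
  define D where "D r k = (\<Sum>l\<in>?N. dz r (- l) (z k (- l) * f))" for r k
  have a: "at_U n i j f = A i j - D j i" for i j
  proof -
    have "D j i = (\<Sum>l\<in>?N. (if i = j then f else 0) - z i (- l) * dz j (- l) f)"
      unfolding D_def by (intro sum.cong) (auto simp: z_dz_odd)
    also have "\<dots> = sscale (if i = j then of_nat n else 0) f - (\<Sum>l\<in>?N. z i (- l) * dz j (- l) f)"
      by (simp add: sum_subtractf sscale_simps of_nat_mult_eq_sscale)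
    finally show ?thesis by (simp add: at_U_def A_def sum_I2 sum.distrib)
  qed
  have b: "bt_U n i j f = (if i = j then B i i else B i j + B j i)" for i j
  proof -
    have "dz i l (dz j (- l) f) = dz j (- l) (dz i l f)" if "l \<in> ?N" for i j l
      using that by (simp add: dz_commute)
    then show ?thesis by (simp add: bt_U_def B_def sum_I2 sum.distrib add.commute)
  qed
  have c: "ct_U n i j f = C i j - C j i" for i j
  proof -
    have "z i (- l) * z j l * f = z j l * (z i (- l) * f)" if "l \<in> ?N" for l
      using that by (simp add: mult.assoc z_commute)
    then show ?thesis
      by (simp add: ct_U_def C_def sum_I2 sum_subtractf sscale_simps sscale_m1 mult.assoc)
  qed
  have "(\<Sum>i\<in>?M. \<Sum>j\<in>?M. sscale (X (- i) (- j)) (D i j)) = (\<Sum>i\<in>?M. \<Sum>j\<in>?M. sscale (X (- j) (- i)) (D j i))"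
    by (rule sum.swap)
  also have "\<dots> = (\<Sum>i\<in>?M. \<Sum>j\<in>?M. - sscale (X i j) (D j i))"
    by (intro sum.cong) (auto simp: rel)
  finally have "(\<Sum>i\<in>?M. \<Sum>j\<in>?M. sscale (X i j) (at_U n i j f)) =
      (\<Sum>i\<in>?M. \<Sum>j\<in>?M. sscale (X i j) (A i j)) + (\<Sum>i\<in>?M. \<Sum>j\<in>?M. sscale (X (- i) (- j)) (D i j))"
    by (simp add: a ssym.scale_right_diff_distrib sum_subtractf sum_negf)
  moreover have "(\<Sum>i\<in>?M. \<Sum>j\<in>{i..int m}. sscale (X (- i) j) (bt_U n i j f)) =
      (\<Sum>i\<in>?M. \<Sum>j\<in>?M. sscale (X (- i) j) (B i j))"
    unfolding b by (rule sum_symmetric[symmetric]) (rule rel)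
  moreover have "(\<Sum>i\<in>?M. \<Sum>j\<in>{i<..int m}. sscale (X i (- j)) (ct_U n i j f)) =
      (\<Sum>i\<in>?M. \<Sum>j\<in>?M. sscale (X i (- j)) (C i j))"
    unfolding c by (rule sum_skew[symmetric]) (rule rel)
  ultimately have "pt_U m n X f = (\<Sum>i\<in>?M. \<Sum>j\<in>?M. sscale (X i j) (A i j) + sscale (X (- i) j) (B i j)
      + sscale (X i (- j)) (C i j) + sscale (X (- i) (- j)) (D i j))"
    by (simp add: pt_U_def sum.distrib add_ac)
  also have "\<dots> = (\<Sum>r\<in>?M. \<Sum>k\<in>?M. \<Sum>l\<in>?N.
      sscale (X r k) (z r l * dz k l f) + sscale (X (- r) k) (dz r (- l) (dz k l f))
      + sscale (X r (- k)) (z r l * (z k (- l) * f)) + sscale (X (- r) (- k)) (dz r (- l) (z k (- l) * f)))"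
    by (simp add: A_def B_def C_def D_def ssym.scale_sum_right sum.distrib)
  also have "\<dots> = (\<Sum>r\<in>?M. \<Sum>l\<in>?N. \<Sum>k\<in>?M.
      sscale (X r k) (z r l * dz k l f) + sscale (X (- r) k) (dz r (- l) (dz k l f))
      + sscale (X r (- k)) (z r l * (z k (- l) * f)) + sscale (X (- r) (- k)) (dz r (- l) (z k (- l) * f)))"
    by (rule sum.cong[OF refl], rule sum.swap)
  also have "\<dots> = (\<Sum>l\<in>?N. \<Sum>r\<in>?M. \<Sum>k\<in>?M.
      sscale (X r k) (z r l * dz k l f) + sscale (X (- r) k) (dz r (- l) (dz k l f))
      + sscale (X r (- k)) (z r l * (z k (- l) * f)) + sscale (X (- r) (- k)) (dz r (- l) (z k (- l) * f)))"
    by (rule sum.swap)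
  finally show ?thesis .
qed

lemma star_generators:
  fixes f :: "'k::field salg"
  assumes "k \<in> {1..int m}" "l \<in> {1..int n}"
  defines "\<sigma> \<equiv> ssgn (odd (m * n)) True :: 'k" and "\<Phi> \<equiv> star (grid m n)"
  shows "\<Phi> (z' k l * f) = z k l * \<Phi> f" "\<Phi> (z' (- k) l * f) = sscale \<sigma> (dz k (- l) (\<Phi> f))"
    "\<Phi> (dz' k l f) = dz k l (\<Phi> f)" "\<Phi> (dz' (- k) l f) = sscale \<sigma> (z k (- l) * \<Phi> f)"
proof -
  have e: "(k, l) |\<in>| grid m n" using assms by (simp add: fset_grid)
  have \<sigma>: "(- 1) ^ (m * n) = \<sigma>" by (simp add: \<sigma>_def ssgn_def minus_one_power_iff)
  show "\<Phi> (z' k l * f) = z k l * \<Phi> f" "\<Phi> (z' (- k) l * f) = sscale \<sigma> (dz k (- l) (\<Phi> f))"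
    "\<Phi> (dz' k l f) = dz k l (\<Phi> f)" "\<Phi> (dz' (- k) l f) = sscale \<sigma> (z k (- l) * \<Phi> f)"
    using assms(1,2) star_odd_gen[OF e, of f] star_odd_der[OF e, of f]
    by (auto simp: \<Phi>_def z_def z'_def dz_def dz'_def star_even fcard_grid \<sigma>)
qed

lemma smat_homog_entries:
  assumes "smat_homog p X" "i > 0" "j > 0"
  shows "if p then X i j = 0 \<and> X (- i) (- j) = 0 else X i (- j) = 0 \<and> X (- i) j = 0"
  using assms unfolding smat_homog_def
  by (metis neg_less_0_iff_less not_less_iff_gr_or_eq)

text \<open>Term by term, the exchange rules turn \<open>p_U'_quadratic\<close> into \<open>p_U_quadratic\<close>. A diagonal block of \<open>X\<close>
  meets the factor $(-1)^{mn}$ twice or not at all, an off-diagonal block exactly once; so the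
  total sign is $(-1)^{mn p}$.\<close>

lemma star_p:
  fixes X :: "'k::field_char_0 smat"
  assumes "X \<in> peri n" "smat_homog p X"
  shows "star (grid m n) (p_U' m n X f) = sscale (ssgn (odd (m * n)) p) (p_U m n X (star (grid m n) f))"
proof -
  define s where "s p = (ssgn (odd (m * n)) p :: 'k)" for p
  have s: "s True * s True = 1" "s False = 1" by (simp_all add: s_def ssgn_def)
  note * = smat_homog_entries[OF assms(2)]
  show ?thesis
    unfolding p_U'_quadratic[OF assms(1)] p_U_quadratic star_sum ssym.scale_sum_right s_def[symmetric]
  proof (intro sum.cong refl, goal_cases)
    case (1 k i j)
    note star_generators[where ?'k = 'k, OF 1(1) 1(2), folded s_def] star_generators[where ?'k = 'k, OF 1(1) 1(3), folded s_def]
    then show ?case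
      using *[of i j] 1(2,3)
      by (cases p) (simp_all add: star_linear sscale_simps s mult_ac flip: sscale_mult)
  qed
qed

lemma star_pt:
  fixes X :: "'k::field_char_0 smat"
  assumes "X \<in> peri_t m" "smat_homog p X"
  shows "star (grid m n) (pt_U' m n X f) = sscale (ssgn (odd (m * n)) p) (pt_U m n X (star (grid m n) f))"
proof -
  define s where "s p = (ssgn (odd (m * n)) p :: 'k)" for p
  have s: "s True * s True = 1" "s False = 1" by (simp_all add: s_def ssgn_def)
  note * = smat_homog_entries[OF assms(2)]
  show ?thesis
    unfolding pt_U_quadratic[OF assms(1)] pt_U'_quadratic star_sum ssym.scale_sum_right s_def[symmetric]
  proof (intro sum.cong refl, goal_cases)
    case (1 l r k)
    note star_generators[where ?'k = 'k, OF 1(2) 1(1), folded s_def] star_generators[where ?'k = 'k, OF 1(3) 1(1), folded s_def]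
    then show ?case
      using *[of r k] 1(2,3)
      by (cases p) (simp_all add: star_linear dz_linear sscale_simps s mult_ac flip: sscale_mult)
  qed
qed

section \<open>The periplectic Lie superalgebras\<close>

text \<open>The three block conditions as one. With $J v = -v$ the matrix $J X$ is, up to signs
  which depend on the parities only, symmetric: this is the invariance of an odd bilinear form.
  The two algebras differ only in which diagonal quadrant of indices carries the sign \<open>+\<close>.\<close>

lemma peri_t_iff:
  "X \<in> peri_t m \<longleftrightarrow> X \<in> gl m \<and>
    (\<forall>u\<in>I2 m. \<forall>v\<in>I2 m. X (- v) u = (if u > 0 \<and> v > 0 then 1 else - 1) * X (- u) v)"
  (is "_ \<longleftrightarrow> _ \<and> ?R")
proof -
  have "?R" if rel: "\<forall>i\<in>{1..int m}. \<forall>j\<in>{1..int m}.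
     X (- i) (- j) = - X j i \<and> X (- i) j = X (- j) i \<and> X i (- j) = - X j (- i)"
  proof (intro ballI)
    fix u v assume uv: "u \<in> I2 m" "v \<in> I2 m"
    consider "u > 0" "v > 0" | "u > 0" "v < 0" | "u < 0" "v > 0" | "u < 0" "v < 0"
      using uv unfolding I2_iff by (meson linorder_neqE)
    then show "X (- v) u = (if u > 0 \<and> v > 0 then 1 else - 1) * X (- u) v"
    proof cases
      case 1
      then show ?thesis using bspec[OF bspec[OF rel, of v], of u] uv by (simp add: I2_iff)
    next
      case 2
      then show ?thesis using bspec[OF bspec[OF rel, of u], of "- v"] uv by (simp add: I2_iff)
    next
      case 3
      then show ?thesis using bspec[OF bspec[OF rel, of v], of "- u"] uv by (simp add: I2_iff)
    next
      case 4
      then show ?thesis using bspec[OF bspec[OF rel, of "- v"], of "- u"] uv by (simp add: I2_iff)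
    qed
  qed
  moreover have "X (- i) (- j) = - X j i \<and> X (- i) j = X (- j) i \<and> X i (- j) = - X j (- i)"
    if R: "?R" and ij: "i \<in> {1..int m}" "j \<in> {1..int m}" for i j
    using bspec[OF bspec[OF R, of "- j"], of i] bspec[OF bspec[OF R, of j], of i]
      bspec[OF bspec[OF R, of "- j"], of "- i"] ij
    by (simp add: I2_iff)
  ultimately show ?thesis unfolding peri_t_def by blast
qed

lemma peri_iff:
  "X \<in> peri n \<longleftrightarrow> X \<in> gl n \<and>
    (\<forall>u\<in>I2 n. \<forall>v\<in>I2 n. X (- v) u = (if u < 0 \<and> v < 0 then 1 else - 1) * X (- u) v)"
  (is "_ \<longleftrightarrow> _ \<and> ?R")
proof -
  have "?R" if rel: "\<forall>i\<in>{1..int n}. \<forall>j\<in>{1..int n}.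
     X (- i) (- j) = - X j i \<and> X i (- j) = X j (- i) \<and> X (- i) j = - X (- j) i"
  proof (intro ballI)
    fix u v assume uv: "u \<in> I2 n" "v \<in> I2 n"
    consider "u > 0" "v > 0" | "u > 0" "v < 0" | "u < 0" "v > 0" | "u < 0" "v < 0"
      using uv unfolding I2_iff by (meson linorder_neqE)
    then show "X (- v) u = (if u < 0 \<and> v < 0 then 1 else - 1) * X (- u) v"
    proof cases
      case 1
      then show ?thesis using bspec[OF bspec[OF rel, of v], of u] uv by (simp add: I2_iff)
    next
      case 2
      then show ?thesis using bspec[OF bspec[OF rel, of u], of "- v"] uv by (simp add: I2_iff)
    next
      case 3
      then show ?thesis using bspec[OF bspec[OF rel, of v], of "- u"] uv by (simp add: I2_iff)
    next
      case 4
      then show ?thesis using bspec[OF bspec[OF rel, of "- v"], of "- u"] uv by (simp add: I2_iff)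
    qed
  qed
  moreover have "X (- i) (- j) = - X j i \<and> X i (- j) = X j (- i) \<and> X (- i) j = - X (- j) i"
    if R: "?R" and ij: "i \<in> {1..int n}" "j \<in> {1..int n}" for i j
    using bspec[OF bspec[OF R, of "- j"], of i] bspec[OF bspec[OF R, of j], of i]
      bspec[OF bspec[OF R, of "- j"], of "- i"] ij
    by (simp add: I2_iff)
  ultimately show ?thesis unfolding peri_def by blast
qed

lemma smat_homog_bracket:
  assumes "smat_homog p X" "smat_homog q Y"
  shows "smat_homog (p \<noteq> q) (smat_bracket n p q X Y)"
  unfolding smat_homog_def
proof (intro allI impI)
  fix i j assume nz: "smat_bracket n p q X Y i j \<noteq> 0"
  have "\<exists>r. X i r * Y r j \<noteq> 0 \<or> Y i r * X r j \<noteq> 0"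
  proof (rule ccontr)
    assume "\<not> ?thesis"
    then have "X i r * Y r j = 0" "Y i r * X r j = 0" for r by blast+
    then show False using nz by (simp add: smat_bracket_def)
  qed
  then obtain r where "X i r \<noteq> 0 \<and> Y r j \<noteq> 0 \<or> Y i r \<noteq> 0 \<and> X r j \<noteq> 0"
    by (metis mult_zero_left mult_zero_right)
  then show "((i < 0) \<noteq> (j < 0)) = (p \<noteq> q)"
    using assms unfolding smat_homog_def by blast
qed

lemma I2_neg: "r \<in> I2 n \<Longrightarrow> - r \<in> I2 n"
  by (simp add: I2_iff)

lemma sum_I2_neg: "(\<Sum>r\<in>I2 n. h (- r)) = (\<Sum>r\<in>I2 n. h r)"
  by (rule sum.reindex_bij_witness[of _ uminus uminus]) (auto simp: I2_neg)

text \<open>For both algebras at once, \<open>t\<close> being positivity or negativity of indices. Moving the symmetry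
  condition through a product exchanges the factors, $(J X Y)_{vu} = - (-1)^{pq} \tau_{uv} (J Y X)_{uv}$, which is
  \<open>key\<close>; in the supercommutator the two products therefore change places, with the sign that it prescribes.\<close>

lemma bracket_polarity:
  fixes X Y :: "'k::field smat"
  assumes t: "t = (\<lambda>u. u > 0) \<or> t = (\<lambda>u. u < 0)"
    and X: "\<forall>u\<in>I2 n. \<forall>v\<in>I2 n. X (- v) u = (if t u \<and> t v then 1 else - 1) * X (- u) v"
    and Y: "\<forall>u\<in>I2 n. \<forall>v\<in>I2 n. Y (- v) u = (if t u \<and> t v then 1 else - 1) * Y (- u) v"
    and hom: "smat_homog p X" "smat_homog q Y" and uv: "u \<in> I2 n" "v \<in> I2 n"
  shows "smat_bracket n p q X Y (- v) u = (if t u \<and> t v then 1 else - 1) * smat_bracket n p q X Y (- u) v"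
proof -
  let ?\<tau> = "\<lambda>u v. if t u \<and> t v then 1 else - 1 :: 'k"
  have key: "(\<Sum>r\<in>I2 n. X (- v) r * Y r u) = - (ssgn p q * ?\<tau> u v * (\<Sum>r\<in>I2 n. Y (- u) r * X r v))"
    if X: "\<forall>u\<in>I2 n. \<forall>v\<in>I2 n. X (- v) u = ?\<tau> u v * X (- u) v"
      and Y: "\<forall>u\<in>I2 n. \<forall>v\<in>I2 n. Y (- v) u = ?\<tau> u v * Y (- u) v"
      and hom: "smat_homog p X" "smat_homog q Y" for X Y p q
  proof -
    have "X (- v) r * Y r u = - (ssgn p q * ?\<tau> u v * (Y (- u) (- r) * X (- r) v))" if r: "r \<in> I2 n" for r
    proof (cases "Y (- u) (- r) * X (- r) v = 0")
      case True
      have "X (- v) r = ?\<tau> r v * X (- r) v" "Y r u = ?\<tau> u (- r) * Y (- u) (- r)"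
        using bspec[OF bspec[OF X r], of v] bspec[OF bspec[OF Y, of u], of "- r"] uv r
        by (auto simp: I2_neg)
      with True show ?thesis by auto
    next
      case False
      have 1: "X (- v) r = ?\<tau> r v * X (- r) v" "Y r u = ?\<tau> u (- r) * Y (- u) (- r)"
        using bspec[OF bspec[OF X r], of v] bspec[OF bspec[OF Y, of u], of "- r"] uv r
        by (auto simp: I2_neg)
      have "p = ((- r < 0) \<noteq> (v < 0))" "q = ((- u < 0) \<noteq> (- r < 0))"
        using False hom unfolding smat_homog_def by force+
      moreover have "r \<noteq> 0" "u \<noteq> 0" "v \<noteq> 0" using r uv by (auto simp: I2_iff)
      ultimately have "?\<tau> r v * ?\<tau> u (- r) = - (ssgn p q * ?\<tau> u v)"
        using t by (auto simp: ssgn_def)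
      then have "?\<tau> r v * ?\<tau> u (- r) * (Y (- u) (- r) * X (- r) v) =
          - (ssgn p q * ?\<tau> u v) * (Y (- u) (- r) * X (- r) v)" by simp
      then show ?thesis unfolding 1 by (simp only: mult_ac minus_mult_left)
    qed
    then have "(\<Sum>r\<in>I2 n. X (- v) r * Y r u) =
        (\<Sum>r\<in>I2 n. - (ssgn p q * ?\<tau> u v * (Y (- u) (- r) * X (- r) v)))"
      by (rule sum.cong[OF refl])
    also have "\<dots> = - (ssgn p q * ?\<tau> u v * (\<Sum>r\<in>I2 n. Y (- u) (- r) * X (- r) v))"
      by (simp only: sum_negf sum_distrib_left)
    also have "(\<Sum>r\<in>I2 n. Y (- u) (- r) * X (- r) v) = (\<Sum>r\<in>I2 n. Y (- u) r * X r v)"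
      by (rule sum_I2_neg)
    finally show ?thesis .
  qed
  have s: "ssgn q p = (ssgn p q :: 'k)" "ssgn p q * ssgn p q = (1 :: 'k)" by (auto simp: ssgn_def)
  show ?thesis
    unfolding smat_bracket_def key[OF X Y hom] key[OF Y X hom(2,1)] s
    using s(2) by (simp add: algebra_simps)
qed

lemma bracket_gl: "X \<in> gl n \<Longrightarrow> Y \<in> gl n \<Longrightarrow> smat_bracket n p q X Y \<in> gl n"
proof -
  assume XY: "X \<in> gl n" "Y \<in> gl n"
  have "smat_bracket n p q X Y i j = 0" if "i \<notin> I2 n \<or> j \<notin> I2 n" for i j
  proof -
    have 0: "X a b = 0" "Y a b = 0" if "a \<notin> I2 n \<or> b \<notin> I2 n" for a b
      using XY that unfolding gl_def by blast+
    have "X i r * Y r j = 0" "Y i r * X r j = 0" for r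
      using that 0[of i r] 0[of r j] by auto
    then show ?thesis by (simp add: smat_bracket_def)
  qed
  then show ?thesis unfolding gl_def by blast
qed

lemma bracket_closed:
  assumes "smat_homog p X" "smat_homog q Y"
  shows "X \<in> peri n \<Longrightarrow> Y \<in> peri n \<Longrightarrow> smat_bracket n p q X Y \<in> peri n"
    and "X \<in> peri_t n \<Longrightarrow> Y \<in> peri_t n \<Longrightarrow> smat_bracket n p q X Y \<in> peri_t n"
proof -
  assume "X \<in> peri n" "Y \<in> peri n"
  then show "smat_bracket n p q X Y \<in> peri n"
    unfolding peri_iff
    by (elim conjE, intro conjI ballI bracket_gl) (assumption | rule bracket_polarity[of "\<lambda>u. u < 0"] disjI2 refl assms)+
next
  assume "X \<in> peri_t n" "Y \<in> peri_t n"
  then show "smat_bracket n p q X Y \<in> peri_t n"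
    unfolding peri_t_iff
    by (elim conjE, intro conjI ballI bracket_gl) (assumption | rule bracket_polarity[of "\<lambda>u. u > 0"] disjI1 refl assms)+
qed

lemma gl_linear:
  "X \<in> gl n \<Longrightarrow> Y \<in> gl n \<Longrightarrow> (\<lambda>i j. X i j + Y i j) \<in> gl n"
  "X \<in> gl n \<Longrightarrow> (\<lambda>i j. c * X i j) \<in> gl n" for X Y :: "'k::field smat"
  unfolding gl_def mem_Collect_eq by (metis add.right_neutral) (metis mult_zero_right)

lemma peri_linear:
  "X \<in> peri n \<Longrightarrow> Y \<in> peri n \<Longrightarrow> (\<lambda>i j. X i j + Y i j) \<in> peri n"
  "X \<in> peri n \<Longrightarrow> (\<lambda>i j. c * X i j) \<in> peri n"
  "X \<in> peri_t n \<Longrightarrow> Y \<in> peri_t n \<Longrightarrow> (\<lambda>i j. X i j + Y i j) \<in> peri_t n"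
  "X \<in> peri_t n \<Longrightarrow> (\<lambda>i j. c * X i j) \<in> peri_t n"
  unfolding peri_iff peri_t_iff
  by (intro conjI ballI gl_linear; (elim conjE)?; (assumption)?; drule (1) bspec;
      (drule (1) bspec)?; simp add: distrib_left mult.left_commute)+

section \<open>The natural actions\<close>

text \<open>On the generators both sides are matrix products; \<open>w\<close> stands for \<open>z i\<close> in $S(U)$ and for
  \<open>\<lambda>k. z' k l\<close> in $S(U')$.\<close>

lemma natural_bracket:
  fixes w :: "int \<Rightarrow> 'k::field salg"
  assumes D: "superderivation p D" and E: "superderivation q E"
    and Dw: "\<And>j. j \<in> I2 n \<Longrightarrow> D (w j) = (\<Sum>r\<in>I2 n. sscale (X r j) (w r))"
    and Ew: "\<And>j. j \<in> I2 n \<Longrightarrow> E (w j) = (\<Sum>r\<in>I2 n. sscale (Y r j) (w r))"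
    and j: "j \<in> I2 n"
  shows "D (E (w j)) - sscale (ssgn p q) (E (D (w j))) =
    (\<Sum>r\<in>I2 n. sscale (smat_bracket n p q X Y r j) (w r))"
proof -
  have "(\<Sum>r\<in>I2 n. sscale (Y r j) (\<Sum>s\<in>I2 n. sscale (X s r) (w s))) =
      (\<Sum>s\<in>I2 n. sscale (\<Sum>r\<in>I2 n. X s r * Y r j) (w s))" for X Y :: "'k smat"
    unfolding ssym.scale_sum_right ssym.scale_sum_left
    by (subst sum.swap) (simp add: mult.commute)
  note * = this[of Y X] this[of X Y]
  have "D (E (w j)) = (\<Sum>r\<in>I2 n. sscale (Y r j) (\<Sum>s\<in>I2 n. sscale (X s r) (w s)))"
    unfolding Ew[OF j] superderivation_linear[OF D] by (intro sum.cong) (simp_all add: Dw)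
  moreover have "E (D (w j)) = (\<Sum>r\<in>I2 n. sscale (X r j) (\<Sum>s\<in>I2 n. sscale (Y s r) (w s)))"
    unfolding Dw[OF j] superderivation_linear[OF E] by (intro sum.cong) (simp_all add: Ew)
  ultimately show ?thesis
    unfolding * smat_bracket_def
    by (simp add: ssym.scale_left_diff_distrib sum_subtractf ssym.scale_sum_right)
qed

text \<open>The ambient algebra has variables with index outside the grid as well; they have to
  be treated separately when superderivations are compared on generators.\<close>

lemma natural_outside:
  assumes "e \<notin> {1..int m} \<times> {1..int n}"
  shows "p_U m n X (even_gen e) = 0" "p_U m n X (odd_gen e) = 0"
    "pt_U' m n X (even_gen e) = 0" "pt_U' m n X (odd_gen e) = 0"
  using assms unfolding p_U_def pt_U'_def
  by (auto intro!: sum.neutral simp: dz_def dz'_def gen_derivatives I2_iff)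

lemma homog_z_mult:
  assumes "j \<noteq> 0" "ssym_homog q f"
  shows "ssym_homog ((j < 0) \<noteq> q) (z i j * f)" "ssym_homog ((j < 0) \<noteq> q) (z' j i * f)"
    "ssym_homog ((j < 0) \<noteq> q) (dz i j f)" "ssym_homog ((j < 0) \<noteq> q) (dz' j i f)"
  using assms homog_gen_mult[OF assms(2)] homog_der[OF assms(2)]
  by (auto simp: z_def z'_def dz_def dz'_def)

lemma homog_natural:
  assumes X: "smat_homog p X" and f: "ssym_homog q f"
  shows "ssym_homog (p \<noteq> q) (p_U m n X f)" "ssym_homog (p \<noteq> q) (pt_U' m n X f)"
proof -
  have "ssym_homog (p \<noteq> q) (sscale (X r j) (z i r * dz i j f))"
    "ssym_homog (p \<noteq> q) (sscale (X r j) (z' r i * dz' j i f))" if "r \<noteq> 0" "j \<noteq> 0" for r j i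
  proof -
    have "((r < 0) \<noteq> ((j < 0) \<noteq> q)) = (p \<noteq> q)" if "X r j \<noteq> 0"
      using X that unfolding smat_homog_def by blast
    then show "ssym_homog (p \<noteq> q) (sscale (X r j) (z i r * dz i j f))"
      "ssym_homog (p \<noteq> q) (sscale (X r j) (z' r i * dz' j i f))"
      using homog_z_mult(1)[OF that(1) homog_z_mult(3)[OF that(2) f], of i i]
        homog_z_mult(2)[OF that(1) homog_z_mult(4)[OF that(2) f], of i i]
      by (cases "X r j = 0"; simp add: sscale_simps homog_zero homog_scale)+
  qed
  then show "ssym_homog (p \<noteq> q) (p_U m n X f)" "ssym_homog (p \<noteq> q) (pt_U' m n X f)"
    unfolding p_U_def pt_U'_def sum_distrib_right sscale_mult(1)[symmetric]
    by (auto intro!: homog_sum simp: I2_iff)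
qed

text \<open>Both sides are superderivations, and on generators they agree by \<open>natural_bracket\<close>.\<close>

lemma p_U_bracket:
  assumes X: "smat_homog p X" and Y: "smat_homog q Y"
  shows "p_U m n (smat_bracket n p q X Y) f =
    p_U m n X (p_U m n Y f) - sscale (ssgn p q) (p_U m n Y (p_U m n X f))"
proof -
  note D = superderivation_p_U[OF X, of m n] superderivation_p_U[OF Y, of m n]
  have *: "p_U m n X (p_U m n Y (z k j)) - sscale (ssgn p q) (p_U m n Y (p_U m n X (z k j))) =
      p_U m n (smat_bracket n p q X Y) (z k j)" if "k \<in> {1..int m}" "j \<in> I2 n" for k j
    by (subst natural_bracket[OF D, of n "z k" X Y])
      (use that in \<open>simp_all add: natural_action(1)[OF that(1)]\<close>)
  have gen: "even_gen (k, l) = z k l" "odd_gen (k, l) = z k (- l)" "l \<in> I2 n" "- l \<in> I2 n"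
    if "l \<in> {1..int n}" for k l
    using that by (auto simp: z_def I2_iff)
  show ?thesis
  proof (rule superderivation_eqI[OF superderivation_p_U[OF smat_homog_bracket[OF X Y]]
        superderivation_supercommutator[OF D homog_natural(1)[OF X] homog_natural(1)[OF Y]]])
    fix e :: "int \<times> int"
    show "p_U m n (smat_bracket n p q X Y) (even_gen e) =
        p_U m n X (p_U m n Y (even_gen e)) - sscale (ssgn p q) (p_U m n Y (p_U m n X (even_gen e)))"
      using * by (cases e, cases "e \<in> {1..int m} \<times> {1..int n}")
        (simp_all add: natural_outside gen superderivation_linear[OF D(1)] superderivation_linear[OF D(2)] sscale_simps)
    show "p_U m n (smat_bracket n p q X Y) (odd_gen e) =
        p_U m n X (p_U m n Y (odd_gen e)) - sscale (ssgn p q) (p_U m n Y (p_U m n X (odd_gen e)))"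
      using * by (cases e, cases "e \<in> {1..int m} \<times> {1..int n}")
        (simp_all add: natural_outside gen superderivation_linear[OF D(1)] superderivation_linear[OF D(2)] sscale_simps)
  qed
qed

lemma pt_U'_bracket:
  assumes X: "smat_homog p X" and Y: "smat_homog q Y"
  shows "pt_U' m n (smat_bracket m p q X Y) f =
    pt_U' m n X (pt_U' m n Y f) - sscale (ssgn p q) (pt_U' m n Y (pt_U' m n X f))"
proof -
  note D = superderivation_pt_U'[OF X, of m n] superderivation_pt_U'[OF Y, of m n]
  have *: "pt_U' m n X (pt_U' m n Y (z' k l)) - sscale (ssgn p q) (pt_U' m n Y (pt_U' m n X (z' k l))) =
      pt_U' m n (smat_bracket m p q X Y) (z' k l)" if "k \<in> I2 m" "l \<in> {1..int n}" for k l
    by (subst natural_bracket[OF D, of m "\<lambda>k. z' k l" X Y])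
      (use that in \<open>simp_all add: natural_action(2)[OF _ that(2)]\<close>)
  have gen: "even_gen (k, l) = z' k l" "odd_gen (k, l) = z' (- k) l" "k \<in> I2 m" "- k \<in> I2 m"
    if "k \<in> {1..int m}" for k l
    using that by (auto simp: z'_def I2_iff)
  show ?thesis
  proof (rule superderivation_eqI[OF superderivation_pt_U'[OF smat_homog_bracket[OF X Y]]
        superderivation_supercommutator[OF D homog_natural(2)[OF X] homog_natural(2)[OF Y]]])
    fix e :: "int \<times> int"
    show "pt_U' m n (smat_bracket m p q X Y) (even_gen e) =
        pt_U' m n X (pt_U' m n Y (even_gen e)) - sscale (ssgn p q) (pt_U' m n Y (pt_U' m n X (even_gen e)))"
      using * by (cases e, cases "e \<in> {1..int m} \<times> {1..int n}")
        (simp_all add: natural_outside gen superderivation_linear[OF D(1)] superderivation_linear[OF D(2)] sscale_simps)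
    show "pt_U' m n (smat_bracket m p q X Y) (odd_gen e) =
        pt_U' m n X (pt_U' m n Y (odd_gen e)) - sscale (ssgn p q) (pt_U' m n Y (pt_U' m n X (odd_gen e)))"
      using * by (cases e, cases "e \<in> {1..int m} \<times> {1..int n}")
        (simp_all add: natural_outside gen superderivation_linear[OF D(1)] superderivation_linear[OF D(2)] sscale_simps)
  qed
qed

section \<open>Supercommutation of the two actions\<close>

lemma superderivation_scale: "superderivation p D \<Longrightarrow> superderivation p (\<lambda>f. sscale c (D f))"
  for D :: "('i::linorder, 'k::field) ssym \<Rightarrow> ('i, 'k) ssym"
  unfolding superderivation_def
  by (simp add: ssym.scale_right_distrib mult.commute flip: sscale_mult)

lemma homog_z: "r \<noteq> 0 \<Longrightarrow> ssym_homog (r < 0) (z' r i)"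
  by (auto simp: z'_def homog_gen)

lemma pt_U'_z_mult:
  assumes X: "smat_homog p X" and r: "r \<in> I2 m" "i \<in> {1..int n}"
  shows "pt_U' m n X (z' r i * f) =
    (\<Sum>s\<in>I2 m. sscale (X s r) (z' s i * f)) + sscale (ssgn p (r < 0)) (z' r i * pt_U' m n X f)"
proof -
  have "pt_U' m n X (z' r i * f) =
      pt_U' m n X (z' r i) * f + sscale (ssgn p (r < 0)) (z' r i * pt_U' m n X f)"
    using superderivation_pt_U'[OF X, of m n] homog_z[of r i] r(1)
    unfolding superderivation_def I2_iff by blast
  then show ?thesis
    using natural_action(2)[OF r, of X] by (simp add: sum_distrib_right sscale_mult(1))
qed

text \<open>The derivatives transform under the dual of the natural representation. As the
  supercommutator of \<open>pt_U' m n X\<close> with a derivative is a superderivation, it is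
  enough to evaluate it on generators, where only constants occur.\<close>

lemma pt_U'_dz:
  assumes X: "smat_homog p X" and s: "s \<in> I2 m" "l \<in> {1..int n}"
  shows "pt_U' m n X (dz' s l f) =
    sscale (ssgn p (s < 0)) (dz' s l (pt_U' m n X f) - (\<Sum>k\<in>I2 m. sscale (X s k) (dz' k l f)))"
proof -
  let ?D = "pt_U' m n X" and ?c = "ssgn p (s < 0)"
  let ?R = "\<lambda>f. \<Sum>k\<in>I2 m. sscale (- (?c * X s k)) (dz' k l f)"
  have nz: "s \<noteq> 0" using s(1) by (simp add: I2_iff)
  note D = superderivation_pt_U'[OF X, of m n]
  have L: "superderivation (p \<noteq> (s < 0)) (\<lambda>f. ?D (dz' s l f) - sscale ?c (dz' s l (?D f)))"
    by (rule superderivation_supercommutator[OF D superderivation_dz(2)[OF nz] homog_natural(2)[OF X] homog_z_mult(4)[OF nz]])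
  have R: "superderivation (p \<noteq> (s < 0)) ?R"
  proof (rule superderivation_sum)
    fix k assume k: "k \<in> I2 m"
    show "superderivation (p \<noteq> (s < 0)) (\<lambda>f. sscale (- (?c * X s k)) (dz' k l f))"
    proof (cases "X s k = 0")
      case True
      then show ?thesis by (simp add: sscale_simps superderivation_zero)
    next
      case False
      then have "(k < 0) = (p \<noteq> (s < 0))" using X unfolding smat_homog_def by blast
      moreover have "superderivation (k < 0) (dz' k l)"
        using k by (intro superderivation_dz) (simp add: I2_iff)
      ultimately have "superderivation (p \<noteq> (s < 0)) (dz' k l)" by simp
      then show ?thesis by (rule superderivation_scale)
    qed
  qed
  have gen: "?D (dz' s l (z' a b)) - sscale ?c (dz' s l (?D (z' a b))) = ?R (z' a b)"
    if ab: "a \<in> I2 m" "b \<in> {1..int n}" for a b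
  proof -
    have nz': "k \<noteq> 0" if "k \<in> I2 m" for k using that by (simp add: I2_iff)
    have d: "dz' k l (z' r b) = (if r = k then if b = l then 1 else 0 else 0)"
      if "k \<in> I2 m" "r \<in> I2 m" for k r
      by (simp add: z_derivatives(2) nz'[OF that(1)] nz'[OF that(2)])
    have fin: "finite (I2 m)" by (simp add: I2_def)
    have if_sscale: "sscale c (if P then x else 0) = (if P then sscale c x else 0)"
      for c P and x :: "'a salg" by (simp add: sscale_simps)
    have "?D (dz' s l (z' a b)) = 0"
      by (simp add: d[OF s(1) ab(1)] superderivation_one[OF D] superderivation_linear(3)[OF D])
    moreover have "dz' s l (?D (z' a b)) = sscale (X s a) (if b = l then 1 else 0)"
    proof -
      have "dz' s l (?D (z' a b)) = (\<Sum>r\<in>I2 m. if r = s then sscale (X r a) (if b = l then 1 else 0) else 0)"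
        unfolding natural_action(2)[OF ab] dz_linear
        by (intro sum.cong refl) (simp add: d s(1) if_sscale)
      then show ?thesis using fin s(1) by simp
    qed
    moreover have "?R (z' a b) = (\<Sum>k\<in>I2 m. if a = k then sscale (- (?c * X s k)) (if b = l then 1 else 0) else 0)"
      by (intro sum.cong refl) (simp add: d ab(1) if_sscale)
    then have "?R (z' a b) = sscale (- (?c * X s a)) (if b = l then 1 else 0)"
      using fin ab(1) by simp
    ultimately show ?thesis by simp
  qed
  have in_grid: "even_gen (k, l) = z' k l" "odd_gen (k, l) = z' (- k) l" "k \<in> I2 m" "- k \<in> I2 m"
    if "k \<in> {1..int m}" for k l
    using that by (auto simp: z'_def I2_iff)
  have out: "dz' k l (even_gen e) = 0" "dz' k l (odd_gen e) = 0"
    if "e \<notin> {1..int m} \<times> {1..int n}" "k \<in> I2 m" for e k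
    using that s(2) by (auto simp: dz'_def gen_derivatives I2_iff)
  have "?D (dz' s l f) - sscale ?c (dz' s l (?D f)) = ?R f"
  proof (rule superderivation_eqI[OF L R])
    fix e :: "int \<times> int"
    show "?D (dz' s l (even_gen e)) - sscale ?c (dz' s l (?D (even_gen e))) = ?R (even_gen e)"
    proof (cases "e \<in> {1..int m} \<times> {1..int n}")
      case True
      then obtain a b where e: "e = (a, b)" "a \<in> {1..int m}" "b \<in> {1..int n}" by blast
      show ?thesis using gen[OF in_grid(3)[OF e(2)] e(3)] unfolding e(1) in_grid(1)[OF e(2)] .
    qed (simp add: out natural_outside s(1) superderivation_linear[OF D] dz_linear sscale_simps)
    show "?D (dz' s l (odd_gen e)) - sscale ?c (dz' s l (?D (odd_gen e))) = ?R (odd_gen e)"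
    proof (cases "e \<in> {1..int m} \<times> {1..int n}")
      case True
      then obtain a b where e: "e = (a, b)" "a \<in> {1..int m}" "b \<in> {1..int n}" by blast
      show ?thesis using gen[OF in_grid(4)[OF e(2)] e(3)] unfolding e(1) in_grid(2)[OF e(2)] .
    qed (simp add: out natural_outside s(1) superderivation_linear[OF D] dz_linear sscale_simps)
  qed
  then have "?D (dz' s l f) = sscale ?c (dz' s l (?D f)) + ?R f" by (simp add: diff_eq_eq add.commute)
  also have "?R f = - sscale ?c (\<Sum>k\<in>I2 m. sscale (X s k) (dz' k l f))"
    by (simp add: ssym.scale_sum_right sum_negf)
  finally show ?thesis by (simp add: ssym.scale_right_diff_distrib)
qed

lemma ssgn_square: "ssgn p q * ssgn p q = 1" "ssgn p q * (ssgn p q * c) = c"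
  by (auto simp: ssgn_def)

text \<open>$\sum_r z'_{r,i} \partial'_{r,j}$ is the contraction of a vector with a covector, hence invariant under all of
  $\mathfrak{gl}(W_m)$: in the sum over \<open>r\<close> the two actions of \<open>X\<close> cancel after renaming indices.\<close>

lemma supercommute_a:
  assumes X: "smat_homog p X" and ij: "i \<in> {1..int n}" "j \<in> {1..int n}"
  shows "pt_U' m n X (a_U' m i j f) = a_U' m i j (pt_U' m n X f)"
proof -
  let ?D = "pt_U' m n X"
  note lin = superderivation_linear[OF superderivation_pt_U'[OF X, of m n]]
  have lin_diff: "?D (g - h) = ?D g - ?D h" for g h
    using lin(1)[of g "sscale (- 1) h"] lin(2)[of "- 1" h] by (simp add: sscale_m1)
  have "?D (\<Sum>r\<in>I2 m. z' r i * dz' r j f) =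
      (\<Sum>r\<in>I2 m. (\<Sum>s\<in>I2 m. sscale (X s r) (z' s i * dz' r j f)) + z' r i * dz' r j (?D f)
        - (\<Sum>s\<in>I2 m. sscale (X r s) (z' r i * dz' s j f)))"
    unfolding lin(4)
  proof (rule sum.cong[OF refl])
    fix r assume r: "r \<in> I2 m"
    have "?D (z' r i * dz' r j f) = (\<Sum>s\<in>I2 m. sscale (X s r) (z' s i * dz' r j f))
        + sscale (ssgn p (r < 0)) (z' r i * sscale (ssgn p (r < 0)) (dz' r j (?D f) - (\<Sum>s\<in>I2 m. sscale (X r s) (dz' s j f))))"
      by (simp only: pt_U'_z_mult[OF X r ij(1)] pt_U'_dz[OF X r ij(2)])
    also have "\<dots> = (\<Sum>s\<in>I2 m. sscale (X s r) (z' s i * dz' r j f)) + (z' r i * dz' r j (?D f)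
        - (\<Sum>s\<in>I2 m. sscale (X r s) (z' r i * dz' s j f)))"
      unfolding sscale_mult(2)[symmetric] ssym.scale_scale ssgn_square ssym.scale_one right_diff_distrib sum_distrib_left ..
    finally show "?D (z' r i * dz' r j f) = (\<Sum>s\<in>I2 m. sscale (X s r) (z' s i * dz' r j f))
        + z' r i * dz' r j (?D f) - (\<Sum>s\<in>I2 m. sscale (X r s) (z' r i * dz' s j f))" by (simp only: add_diff_eq)
  qed
  also have "\<dots> = (\<Sum>r\<in>I2 m. z' r i * dz' r j (?D f))"
    unfolding sum_subtractf sum.distrib
    by (subst sum.swap) simp
  finally show ?thesis by (simp add: a_U'_def lin_diff lin)
qed

lemma ssgn_neg:
  fixes r :: int
  assumes "r \<noteq> 0"
  shows "ssgn p (r < 0) * ssgn p (- r < 0) = (ssgn p True :: 'k::comm_ring_1)"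
  using assms by (auto simp: ssgn_def)

text \<open>Here the invariant is $\sum_r z'_{r,i} z'_{-r,j}$, given by the odd bilinear form on $W_m$; \<open>pol\<close> is the
  condition that \<open>X\<close> preserves this form. For $i = j$ the sum over all \<open>r\<close> counts \<open>b_U'\<close> twice.\<close>

lemma supercommute_b:
  fixes X :: "'k::field_char_0 smat"
  assumes Xp: "X \<in> peri_t m" and X: "smat_homog p X" and ij: "i \<in> {1..int n}" "j \<in> {1..int n}"
  shows "pt_U' m n X (b_U' m i j f) = sscale (ssgn p True) (b_U' m i j (pt_U' m n X f))"
proof -
  let ?D = "pt_U' m n X"
  define B where "B f = (\<Sum>r\<in>I2 m. z' r i * (z' (- r) j * f))" for f :: "'k salg"
  note lin = superderivation_linear[OF superderivation_pt_U'[OF X, of m n]]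
  have pol: "X r (- s) = - (ssgn p (r < 0) * X s (- r))" if "r \<in> I2 m" "s \<in> I2 m" for r s
  proof (cases "X s (- r) = 0")
    case False
    then have "p = ((s < 0) \<noteq> (- r < 0))" using X unfolding smat_homog_def by blast
    moreover have "X r (- s) = (if - s > 0 \<and> - r > 0 then 1 else - 1) * X s (- r)"
      using Xp that I2_neg[of r m] I2_neg[of s m] unfolding peri_t_iff by (metis minus_minus)
    moreover have "r \<noteq> 0" "s \<noteq> 0" using that by (auto simp: I2_iff)
    ultimately show ?thesis by (auto simp: ssgn_def)
  next
    case True
    moreover have "X r (- s) = (if - s > 0 \<and> - r > 0 then 1 else - 1) * X s (- r)"
      using Xp that I2_neg[of r m] I2_neg[of s m] unfolding peri_t_iff by (metis minus_minus)
    ultimately show ?thesis by simp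
  qed
  have nz: "r \<noteq> 0" if "r \<in> I2 m" for r using that by (simp add: I2_iff)
  have "?D (B f) = (\<Sum>r\<in>I2 m. (\<Sum>s\<in>I2 m. sscale (X s r) (z' s i * (z' (- r) j * f)))
      + (\<Sum>s\<in>I2 m. sscale (ssgn p (r < 0) * X s (- r)) (z' r i * (z' s j * f)))
      + sscale (ssgn p True) (z' r i * (z' (- r) j * ?D f)))"
    unfolding B_def lin(4)
  proof (rule sum.cong[OF refl])
    fix r assume r: "r \<in> I2 m"
    have "?D (z' r i * (z' (- r) j * f)) = (\<Sum>s\<in>I2 m. sscale (X s r) (z' s i * (z' (- r) j * f)))
        + sscale (ssgn p (r < 0)) (z' r i * ((\<Sum>s\<in>I2 m. sscale (X s (- r)) (z' s j * f))
          + sscale (ssgn p (- r < 0)) (z' (- r) j * ?D f)))"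
      by (simp only: pt_U'_z_mult[OF X r ij(1)] pt_U'_z_mult[OF X I2_neg[OF r] ij(2)])
    also have "\<dots> = (\<Sum>s\<in>I2 m. sscale (X s r) (z' s i * (z' (- r) j * f)))
        + ((\<Sum>s\<in>I2 m. sscale (ssgn p (r < 0) * X s (- r)) (z' r i * (z' s j * f)))
          + sscale (ssgn p True) (z' r i * (z' (- r) j * ?D f)))"
      unfolding distrib_left sum_distrib_left sscale_mult(2)[symmetric] ssym.scale_right_distrib
        ssym.scale_sum_right ssym.scale_scale ssgn_neg[OF nz[OF r]] ..
    finally show "?D (z' r i * (z' (- r) j * f)) = (\<Sum>s\<in>I2 m. sscale (X s r) (z' s i * (z' (- r) j * f)))
        + (\<Sum>s\<in>I2 m. sscale (ssgn p (r < 0) * X s (- r)) (z' r i * (z' s j * f)))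
        + sscale (ssgn p True) (z' r i * (z' (- r) j * ?D f))" by (simp only: add.assoc)
  qed
  also have "(\<Sum>r\<in>I2 m. (\<Sum>s\<in>I2 m. sscale (X s r) (z' s i * (z' (- r) j * f)))
      + (\<Sum>s\<in>I2 m. sscale (ssgn p (r < 0) * X s (- r)) (z' r i * (z' s j * f)))
      + sscale (ssgn p True) (z' r i * (z' (- r) j * ?D f))) =
      (\<Sum>r\<in>I2 m. \<Sum>s\<in>I2 m. sscale (X s r) (z' s i * (z' (- r) j * f)))
      + (\<Sum>r\<in>I2 m. \<Sum>s\<in>I2 m. sscale (ssgn p (r < 0) * X s (- r)) (z' r i * (z' s j * f)))
      + sscale (ssgn p True) (B (?D f))"
    by (simp add: sum.distrib B_def ssym.scale_sum_right)
  also have "(\<Sum>r\<in>I2 m. \<Sum>s\<in>I2 m. sscale (X s r) (z' s i * (z' (- r) j * f))) =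
      (\<Sum>r\<in>I2 m. \<Sum>s\<in>I2 m. sscale (X s (- r)) (z' s i * (z' r j * f)))"
    by (subst sum_I2_neg[symmetric]) simp
  also have "\<dots> = (\<Sum>r\<in>I2 m. \<Sum>s\<in>I2 m. sscale (X r (- s)) (z' r i * (z' s j * f)))"
    by (rule sum.swap)
  also have "\<dots> = - (\<Sum>r\<in>I2 m. \<Sum>s\<in>I2 m. sscale (ssgn p (r < 0) * X s (- r)) (z' r i * (z' s j * f)))"
    unfolding sum_negf[symmetric] by (intro sum.cong refl, subst pol) simp_all
  finally have B: "?D (B f) = sscale (ssgn p True) (B (?D f))" by simp
  show ?thesis
  proof (cases "i = j")
    case False
    then show ?thesis using B by (simp add: b_U'_def B_def mult.assoc)
  next
    case True
    \<comment> \<open>the terms for \<open>r\<close> and \<open>- r\<close> agree because even generators are central\<close>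
    have *: "B g = sscale 2 (b_U' m i j g)" for g
    proof -
      have "z' (- r) i * (z' r i * g) = z' r i * (z' (- r) i * g)" if "r \<in> {1..int m}" for r
        using that by (simp add: z_commute)
      then have "B g = b_U' m i j g + b_U' m i j g"
        unfolding B_def sum_I2 b_U'_def True by (simp add: mult.assoc sum.distrib)
      also have "\<dots> = sscale (1 + 1) (b_U' m i j g)"
        by (simp only: ssym.scale_left_distrib ssym.scale_one)
      finally show ?thesis by simp
    qed
    have "sscale 2 (?D (b_U' m i j f)) = sscale 2 (sscale (ssgn p True) (b_U' m i j (?D f)))"
      using B by (simp add: * lin sscale_simps mult.commute)
    then show ?thesis by (simp add: ssym.scale_cancel_left del: ssym.scale_scale)
  qed
qed

text \<open>Now the form on the dual space is contracted with two derivatives, and again \<open>pol\<close> expresses the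
  invariance of this form.\<close>

lemma supercommute_c:
  assumes Xp: "X \<in> peri_t m" and X: "smat_homog p X" and ij: "i \<in> {1..int n}" "j \<in> {1..int n}"
  shows "pt_U' m n X (c_U' m i j f) = sscale (ssgn p True) (c_U' m i j (pt_U' m n X f))"
proof -
  let ?D = "pt_U' m n X" and ?s = "\<lambda>r. if r < 0 then - 1 else 1"
  note lin = superderivation_linear[OF superderivation_pt_U'[OF X, of m n]]
  have dz_diff: "dz' k l (g - h) = dz' k l g - dz' k l h" for k l and g h :: "'a salg"
    using dz_linear(5)[of k l g "sscale (- 1) h"] dz_linear(6)[of k l "- 1" h] by (simp add: sscale_m1)
  have nz: "r \<noteq> 0" if "r \<in> I2 m" for r using that by (simp add: I2_iff)
  have pol: "?s (- r) * ssgn p True * X (- r) k = - (?s k * ssgn p (- k < 0) * X (- k) r)"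
    if "r \<in> I2 m" "k \<in> I2 m" for r k
  proof -
    have *: "X (- r) k = (if k > 0 \<and> r > 0 then 1 else - 1) * X (- k) r"
      using Xp that unfolding peri_t_iff by blast
    show ?thesis
    proof (cases "X (- k) r = 0")
      case False
      then have "p = ((- k < 0) \<noteq> (r < 0))" using X unfolding smat_homog_def by blast
      then show ?thesis using nz[OF that(1)] nz[OF that(2)] by (auto simp: * ssgn_def)
    qed (simp add: *)
  qed
  have "?D (c_U' m i j f) = (\<Sum>r\<in>I2 m. sscale (ssgn p True) (sscale (?s r) (dz' (- r) i (dz' r j (?D f))))
      - (\<Sum>k\<in>I2 m. sscale (?s r * ssgn p True * X r k) (dz' (- r) i (dz' k j f)))
      - (\<Sum>k\<in>I2 m. sscale (?s r * ssgn p (- r < 0) * X (- r) k) (dz' k i (dz' r j f))))"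
    unfolding c_U'_def lin(2,4)
  proof (intro sum.cong refl)
    fix r assume r: "r \<in> I2 m"
    have "?D (dz' (- r) i (dz' r j f)) = sscale (ssgn p (- r < 0)) (sscale (ssgn p (r < 0))
          (dz' (- r) i (dz' r j (?D f)) - (\<Sum>k\<in>I2 m. sscale (X r k) (dz' (- r) i (dz' k j f))))
        - (\<Sum>k\<in>I2 m. sscale (X (- r) k) (dz' k i (dz' r j f))))"
      using r by (simp only: pt_U'_dz[OF X] ij I2_neg dz_linear dz_diff)
    also have "\<dots> = sscale (ssgn p True)
          (dz' (- r) i (dz' r j (?D f)) - (\<Sum>k\<in>I2 m. sscale (X r k) (dz' (- r) i (dz' k j f))))
        - sscale (ssgn p (- r < 0)) (\<Sum>k\<in>I2 m. sscale (X (- r) k) (dz' k i (dz' r j f)))"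
      using ssgn_neg[OF nz[OF r], of p, where ?'k = 'a]
      by (simp only: ssym.scale_right_diff_distrib ssym.scale_scale mult.commute[of "ssgn p (- r < 0)"])
    finally show "sscale (?s r) (?D (dz' (- r) i (dz' r j f))) =
      sscale (ssgn p True) (sscale (?s r) (dz' (- r) i (dz' r j (?D f))))
      - (\<Sum>k\<in>I2 m. sscale (?s r * ssgn p True * X r k) (dz' (- r) i (dz' k j f)))
      - (\<Sum>k\<in>I2 m. sscale (?s r * ssgn p (- r < 0) * X (- r) k) (dz' k i (dz' r j f)))"
      by (simp add: ssym.scale_right_diff_distrib ssym.scale_sum_right mult_ac)
  qed
  also have "\<dots> = sscale (ssgn p True) (c_U' m i j (?D f))
      - (\<Sum>r\<in>I2 m. \<Sum>k\<in>I2 m. sscale (?s r * ssgn p True * X r k) (dz' (- r) i (dz' k j f)))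
      - (\<Sum>r\<in>I2 m. \<Sum>k\<in>I2 m. sscale (?s r * ssgn p (- r < 0) * X (- r) k) (dz' k i (dz' r j f)))"
    by (simp only: sum_subtractf c_U'_def ssym.scale_sum_right)
  also have "(\<Sum>r\<in>I2 m. \<Sum>k\<in>I2 m. sscale (?s r * ssgn p True * X r k) (dz' (- r) i (dz' k j f))) =
      (\<Sum>r\<in>I2 m. \<Sum>k\<in>I2 m. sscale (?s (- r) * ssgn p True * X (- r) k) (dz' r i (dz' k j f)))"
    by (subst sum_I2_neg[symmetric]) simp
  also have "\<dots> = - (\<Sum>r\<in>I2 m. \<Sum>k\<in>I2 m. sscale (?s k * ssgn p (- k < 0) * X (- k) r) (dz' r i (dz' k j f)))"
    unfolding sum_negf[symmetric] by (intro sum.cong refl) (simp only: pol ssym.scale_minus_left)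
  also have "(\<Sum>r\<in>I2 m. \<Sum>k\<in>I2 m. sscale (?s k * ssgn p (- k < 0) * X (- k) r) (dz' r i (dz' k j f))) =
      (\<Sum>r\<in>I2 m. \<Sum>k\<in>I2 m. sscale (?s r * ssgn p (- r < 0) * X (- r) k) (dz' k i (dz' r j f)))"
    by (rule sum.swap)
  finally show ?thesis by simp
qed

lemma supercommute_U':
  fixes X :: "'k::field_char_0 smat"
  assumes X: "X \<in> peri_t m" "smat_homog p X" and Y: "smat_homog q Y"
  shows "pt_U' m n X (p_U' m n Y f) = sscale (ssgn p q) (p_U' m n Y (pt_U' m n X f))"
proof -
  let ?D = "pt_U' m n X" and ?N = "{1..int n}"
  note lin = superderivation_linear[OF superderivation_pt_U'[OF X(2), of m n]]
  have "if q then Y i j = 0 else Y i (- j) = 0 \<and> Y (- i) j = 0" if "i \<in> ?N" "j \<in> ?N" for i j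
    using smat_homog_entries[OF Y, of i j] that by (simp split: if_splits)
  then have coef: "sscale (Y i j) (?D (a_U' m i j f)) = sscale (ssgn p q) (sscale (Y i j) (a_U' m i j (?D f)))"
    "sscale (Y i (- j)) (?D (b_U' m i j f)) = sscale (ssgn p q) (sscale (Y i (- j)) (b_U' m i j (?D f)))"
    "sscale (Y (- i) j) (?D (c_U' m i j f)) = sscale (ssgn p q) (sscale (Y (- i) j) (c_U' m i j (?D f)))"
    if "i \<in> ?N" "j \<in> ?N" for i j
    using that by (cases q; force simp: supercommute_a[OF X(2)] supercommute_b[OF X] supercommute_c[OF X]
        sscale_simps ssgn_simps mult.commute)+
  show ?thesis
    unfolding p_U'_def lin ssym.scale_right_distrib ssym.scale_sum_right
    by (intro arg_cong2[where f = "(+)"] sum.cong refl coef) auto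
qed

section \<open>Linearity and stability of the four actions\<close>

text \<open>Linearity in both arguments, for all matrices and on the whole algebra. It is available at this
  generality because the actions are defined by formulas in the entries of a matrix; this saves
  side conditions when words are evaluated.\<close>

definition bilinear_action :: "('k smat \<Rightarrow> 'k salg \<Rightarrow> 'k::field salg) \<Rightarrow> bool" where
  "bilinear_action \<rho> \<longleftrightarrow> (\<forall>X. lin_on UNIV (\<rho> X)) \<and>
     (\<forall>X Y f. \<rho> (\<lambda>i j. X i j + Y i j) f = \<rho> X f + \<rho> Y f) \<and>
     (\<forall>c X f. \<rho> (\<lambda>i j. c * X i j) f = sscale c (\<rho> X f))"

lemma bilinear_action_simps:
  assumes "bilinear_action \<rho>"
  shows "\<rho> X (f + g) = \<rho> X f + \<rho> X g" "\<rho> X (sscale c f) = sscale c (\<rho> X f)" "\<rho> X 0 = 0"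
    "\<rho> X (f - g) = \<rho> X f - \<rho> X g"
    "\<rho> (\<lambda>i j. X i j + Y i j) f = \<rho> X f + \<rho> Y f" "\<rho> (\<lambda>i j. c * X i j) f = sscale c (\<rho> X f)"
proof -
  show *: "\<rho> X (f + g) = \<rho> X f + \<rho> X g" "\<rho> X (sscale c f) = sscale c (\<rho> X f)"
    "\<rho> (\<lambda>i j. X i j + Y i j) f = \<rho> X f + \<rho> Y f" "\<rho> (\<lambda>i j. c * X i j) f = sscale c (\<rho> X f)" for f g c
    using assms by (simp_all add: bilinear_action_def lin_on_def)
  show "\<rho> X 0 = 0" using *(2)[of 0 0] by simp
  show "\<rho> X (f - g) = \<rho> X f - \<rho> X g" using *(1)[of f "sscale (- 1) g"] *(2)[of "- 1" g] by simp
qed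

lemma bilinear_natural: "bilinear_action (p_U m n)" "bilinear_action (pt_U' m n)"
  unfolding bilinear_action_def lin_on_def p_U_def pt_U'_def sum_distrib_right sscale_mult(1)[symmetric]
  by (simp_all add: dz_linear distrib_left sum.distrib ssym.scale_left_distrib ssym.scale_right_distrib
      ssym.scale_sum_right mult.commute flip: sscale_mult(2))

lemma oscillator_linear:
  "at_U n i j (f + g) = at_U n i j f + at_U n i j g" "at_U n i j (sscale c f) = sscale c (at_U n i j f)"
  "bt_U n i j (f + g) = bt_U n i j f + bt_U n i j g" "bt_U n i j (sscale c f) = sscale c (bt_U n i j f)"
  "ct_U n i j (f + g) = ct_U n i j f + ct_U n i j g" "ct_U n i j (sscale c f) = sscale c (ct_U n i j f)"
  "a_U' m i j (f + g) = a_U' m i j f + a_U' m i j g" "a_U' m i j (sscale c f) = sscale c (a_U' m i j f)"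
  "b_U' m i j (f + g) = b_U' m i j f + b_U' m i j g" "b_U' m i j (sscale c f) = sscale c (b_U' m i j f)"
  "c_U' m i j (f + g) = c_U' m i j f + c_U' m i j g" "c_U' m i j (sscale c f) = sscale c (c_U' m i j f)"
  unfolding at_U_def bt_U_def ct_U_def a_U'_def b_U'_def c_U'_def
  by (simp_all add: dz_linear distrib_left sum.distrib ssym.scale_right_distrib ssym.scale_right_diff_distrib
      ssym.scale_sum_right mult.commute flip: sscale_mult)

lemma bilinear_oscillator: "bilinear_action (pt_U m n)" "bilinear_action (p_U' m n)"
  unfolding bilinear_action_def lin_on_def pt_U_def p_U'_def
  by (simp_all add: oscillator_linear sum.distrib ssym.scale_left_distrib ssym.scale_right_distrib
      ssym.scale_sum_right mult.commute add_ac)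

lemma ssym_on_z:
  assumes "f \<in> ssym_on ({1..int m} \<times> {1..int n})"
  shows "i \<in> {1..int m} \<Longrightarrow> j \<in> I2 n \<Longrightarrow> z i j * f \<in> ssym_on ({1..int m} \<times> {1..int n})"
    "k \<in> I2 m \<Longrightarrow> l \<in> {1..int n} \<Longrightarrow> z' k l * f \<in> ssym_on ({1..int m} \<times> {1..int n})"
    "dz a b f \<in> ssym_on ({1..int m} \<times> {1..int n})" "dz' a b f \<in> ssym_on ({1..int m} \<times> {1..int n})"
  using assms by (auto simp: z_def z'_def dz_def dz'_def I2_iff intro!: ssym_on_gen_mult ssym_on_der)

lemma ssym_on_diff: "f \<in> ssym_on I \<Longrightarrow> g \<in> ssym_on I \<Longrightarrow> f - g \<in> ssym_on I"
  using ssym_on_add[of f I "- g"] ssym_on_scale[of g I "- 1"] by (simp add: sscale_m1)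

lemma actions_stable:
  assumes f: "f \<in> ssym_on ({1..int m} \<times> {1..int n})"
  shows "p_U m n X f \<in> ssym_on ({1..int m} \<times> {1..int n})" "pt_U' m n X f \<in> ssym_on ({1..int m} \<times> {1..int n})"
    "pt_U m n X f \<in> ssym_on ({1..int m} \<times> {1..int n})" "p_U' m n X f \<in> ssym_on ({1..int m} \<times> {1..int n})"
proof -
  have I2: "r \<in> I2 N" "- r \<in> I2 N" if "r \<in> {1..int N}" for r N using that by (simp_all add: I2_iff)
  note intros = ssym_on_sum ssym_on_scale ssym_on_add ssym_on_diff ssym_on_z f I2_neg
  show "p_U m n X f \<in> ssym_on ({1..int m} \<times> {1..int n})"
    unfolding p_U_def sum_distrib_right sscale_mult(1)[symmetric] by (intro intros)
  show "pt_U' m n X f \<in> ssym_on ({1..int m} \<times> {1..int n})"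
    unfolding pt_U'_def sum_distrib_right sscale_mult(1)[symmetric] by (intro intros)
  have "at_U n i j f \<in> ssym_on ({1..int m} \<times> {1..int n})" "bt_U n i j f \<in> ssym_on ({1..int m} \<times> {1..int n})"
    "ct_U n i j f \<in> ssym_on ({1..int m} \<times> {1..int n})" if "i \<in> {1..int m}" "j \<in> {1..int m}" for i j
    using that unfolding at_U_def bt_U_def ct_U_def mult.assoc by (auto intro!: intros)
  then show "pt_U m n X f \<in> ssym_on ({1..int m} \<times> {1..int n})"
    unfolding pt_U_def by (auto intro!: ssym_on_add ssym_on_sum ssym_on_scale)
  have "a_U' m i j f \<in> ssym_on ({1..int m} \<times> {1..int n})" "b_U' m i j f \<in> ssym_on ({1..int m} \<times> {1..int n})"
    "c_U' m i j f \<in> ssym_on ({1..int m} \<times> {1..int n})" if "i \<in> {1..int n}" "j \<in> {1..int n}" for i j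
    using that unfolding a_U'_def b_U'_def c_U'_def mult.assoc by (auto intro!: intros simp: I2)
  then show "p_U' m n X f \<in> ssym_on ({1..int m} \<times> {1..int n})"
    unfolding p_U'_def by (auto intro!: ssym_on_add ssym_on_sum ssym_on_scale)
qed

section \<open>Modules over enveloping superalgebras\<close>

definition superrep :: "nat \<Rightarrow> 'k smat set \<Rightarrow> ('k smat \<Rightarrow> 'k salg \<Rightarrow> 'k::field salg) \<Rightarrow> bool" where
  "superrep N g \<rho> \<longleftrightarrow> bilinear_action \<rho> \<and>
     (\<forall>p q. \<forall>x\<in>g. \<forall>y\<in>g. smat_homog p x \<and> smat_homog q y \<longrightarrow>
        (\<forall>f. \<rho> (smat_bracket N p q x y) f = \<rho> x (\<rho> y f) - sscale (ssgn p q) (\<rho> y (\<rho> x f))))"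

definition lie_closed :: "nat \<Rightarrow> 'k::field smat set \<Rightarrow> bool" where
  "lie_closed N g \<longleftrightarrow> (\<forall>x\<in>g. \<forall>y\<in>g. (\<lambda>i j. x i j + y i j) \<in> g) \<and> (\<forall>c. \<forall>x\<in>g. (\<lambda>i j. c * x i j) \<in> g) \<and>
     (\<forall>p q. \<forall>x\<in>g. \<forall>y\<in>g. smat_homog p x \<and> smat_homog q y \<longrightarrow> smat_bracket N p q x y \<in> g)"

lemma lie_closed_peri: "lie_closed n (peri n)" "lie_closed m (peri_t m)"
  by (simp_all add: lie_closed_def peri_linear bracket_closed)

lemma superrep_natural: "superrep n (peri n) (p_U m n)" "superrep m (peri_t m) (pt_U' m n)"
  by (simp_all add: superrep_def bilinear_natural p_U_bracket pt_U'_bracket)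

definition lin_eval :: "('a \<Rightarrow> 'k salg) \<Rightarrow> ('a \<Rightarrow>\<^sub>0 'k) \<Rightarrow> 'k::field salg" where
  "lin_eval h t = (\<Sum>a\<in>Poly_Mapping.keys t. sscale (Poly_Mapping.lookup t a) (h a))"

lemma lin_eval_superset:
  assumes "finite A" "Poly_Mapping.keys t \<subseteq> A"
  shows "lin_eval h t = (\<Sum>a\<in>A. sscale (Poly_Mapping.lookup t a) (h a))"
  unfolding lin_eval_def
  by (rule sum.mono_neutral_left) (use assms in \<open>auto simp: in_keys_iff\<close>)

lemma lin_eval_add: "lin_eval h (s + t) = lin_eval h s + lin_eval h t"
proof -
  let ?A = "Poly_Mapping.keys s \<union> Poly_Mapping.keys t"
  have "finite ?A" "Poly_Mapping.keys s \<subseteq> ?A" "Poly_Mapping.keys t \<subseteq> ?A" "Poly_Mapping.keys (s + t) \<subseteq> ?A"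
    using keys_add[of s t] by auto
  then show ?thesis
    by (simp add: lin_eval_superset[of ?A] lookup_add ssym.scale_left_distrib sum.distrib)
qed

lemma lin_eval_pscale: "lin_eval h (pscale c t) = sscale c (lin_eval h t)"
proof -
  have "Poly_Mapping.keys (pscale c t) \<subseteq> Poly_Mapping.keys t" by (auto dest: keys_pscale)
  then show ?thesis
    by (simp add: lin_eval_superset[of "Poly_Mapping.keys t"] ssym.scale_sum_right)
qed

lemma lin_eval_simps:
  "lin_eval h 0 = 0" "lin_eval h (Poly_Mapping.single a c) = sscale c (h a)"
  "lin_eval h (s - t) = lin_eval h s - lin_eval h t"
proof -
  show "lin_eval h 0 = 0" "lin_eval h (Poly_Mapping.single a c) = sscale c (h a)"
    by (cases "c = 0"; simp add: lin_eval_def)+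
  have "pscale (- 1) t = - t" by (rule poly_mapping_eqI) simp
  then show "lin_eval h (s - t) = lin_eval h s - lin_eval h t"
    using lin_eval_add[of h s "pscale (- 1) t"] lin_eval_pscale[of h "- 1" t] by simp
qed

lemma lin_eval_lin_ext: "lin_eval h (lin_ext k s) = lin_eval (\<lambda>a. lin_eval h (k a)) s"
proof -
  have "lin_eval h (\<Sum>a\<in>A. pscale (c a) (k a)) = (\<Sum>a\<in>A. sscale (c a) (lin_eval h (k a)))" for A c
    by (induction A rule: infinite_finite_induct) (simp_all add: lin_eval_simps lin_eval_add lin_eval_pscale)
  then show ?thesis by (simp add: lin_ext_def lin_eval_def[of _ s])
qed

lemma free_act_eq: "free_act \<rho> \<sigma> t f = lin_eval (\<lambda>(xs, ys). foldr \<rho> xs (foldr \<sigma> ys f)) t"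
  by (simp add: free_act_def lin_eval_def case_prod_unfold)

lemma foldr_linear:
  assumes "bilinear_action \<rho>"
  shows "foldr \<rho> xs (f + g) = foldr \<rho> xs f + foldr \<rho> xs g"
    "foldr \<rho> xs (sscale c f) = sscale c (foldr \<rho> xs f)" "foldr \<rho> xs 0 = 0"
    "foldr \<rho> xs (f - g) = foldr \<rho> xs f - foldr \<rho> xs g"
  by (induction xs) (simp_all add: bilinear_action_simps[OF assms])

lemma foldr_lin_eval:
  assumes "bilinear_action \<rho>"
  shows "foldr \<rho> xs (lin_eval h t) = lin_eval (\<lambda>a. foldr \<rho> xs (h a)) t"
proof -
  have "foldr \<rho> xs (sum k A) = (\<Sum>a\<in>A. foldr \<rho> xs (k a))" for k :: "'b \<Rightarrow> 'a salg" and A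
    by (induction A rule: infinite_finite_induct) (simp_all add: foldr_linear[OF assms])
  then show ?thesis by (simp add: lin_eval_def foldr_linear[OF assms])
qed

lemma free_act_tens:
  assumes "bilinear_action \<rho>"
  shows "free_act \<rho> \<sigma> (tens s t) f =
    lin_eval (\<lambda>xs. foldr \<rho> xs (lin_eval (\<lambda>ys. foldr \<sigma> ys f) t)) s"
  by (simp add: free_act_eq tens_def lin_eval_lin_ext lin_eval_simps foldr_lin_eval[OF assms])

lemma lin_eval_subspace: "pm.subspace {s. \<forall>f. lin_eval (h f) s = 0}"
  by (simp add: pm.subspace_def lin_eval_simps lin_eval_add lin_eval_pscale)

text \<open>The three kinds of generators of the ideal express linearity in the sum, linearity in the
  scalar, and the bracket relation, each inside a word.\<close>

lemma env_ideal_acts_zero: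
  assumes \<rho>: "superrep N g \<rho>" and s: "s \<in> env_ideal N g"
  shows "lin_eval (\<lambda>xs. foldr \<rho> xs f) s = 0"
proof -
  have b: "bilinear_action \<rho>" using \<rho> by (simp add: superrep_def)
  have br: "\<rho> (smat_bracket N p q x y) f = \<rho> x (\<rho> y f) - sscale (ssgn p q) (\<rho> y (\<rho> x f))"
    if "x \<in> g" "y \<in> g" "smat_homog p x" "smat_homog q y" for p q x y f
    using \<rho> that by (simp add: superrep_def)
  have "env_ideal N g \<subseteq> {s. \<forall>f. lin_eval (\<lambda>xs. foldr \<rho> xs f) s = 0}"
    unfolding env_ideal_def
    by (rule pm.span_minimal[OF _ lin_eval_subspace])
      (auto simp: lin_eval_simps lin_eval_pscale bilinear_action_simps[OF b] foldr_linear[OF b] br)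
  with s show ?thesis by blast
qed

lemma env2_null_acts_zero:
  assumes \<rho>: "superrep M g \<rho>" and \<sigma>: "superrep N h \<sigma>" and t: "t \<in> env2_null M g N h"
  shows "free_act \<rho> \<sigma> t f = 0"
proof -
  have b: "bilinear_action \<rho>" using \<rho> by (simp add: superrep_def)
  have zero: "lin_eval (\<lambda>_. 0) s = 0" for s :: "'a smat list \<Rightarrow>\<^sub>0 'a" by (simp add: lin_eval_def)
  have "env2_null M g N h \<subseteq> {t. \<forall>f. lin_eval (\<lambda>(xs, ys). foldr \<rho> xs (foldr \<sigma> ys f)) t = 0}"
    unfolding env2_null_def
    by (rule pm.span_minimal[OF _ lin_eval_subspace])
      (auto simp: free_act_tens[OF b] env_ideal_acts_zero[OF \<rho>] env_ideal_acts_zero[OF \<sigma>] foldr_linear[OF b] zero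
        simp flip: free_act_eq)
  with t show ?thesis by (auto simp: free_act_eq)
qed

lemma keys_subspace: "pm.subspace {t :: 'a \<Rightarrow>\<^sub>0 'k::field. Poly_Mapping.keys t \<subseteq> K}"
proof (rule pm.subspaceI)
  show "s + t \<in> {t. Poly_Mapping.keys t \<subseteq> K}" if "s \<in> {t. Poly_Mapping.keys t \<subseteq> K}" "t \<in> {t. Poly_Mapping.keys t \<subseteq> K}" for s t
    using that keys_add[of s t] by auto
qed (auto dest: keys_pscale)

text \<open>The intertwining property is known for elements of the two Lie superalgebras only. So all words that
  occur in a representative of a class must have their letters there, and this
  requires that the defining relations introduce no other letters.\<close>

lemma env_ideal_in_free:
  assumes "lie_closed N g"
  shows "env_ideal N g \<subseteq> free_alg g"
proof -
  let ?W = "{xs. set xs \<subseteq> g}"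
  have "env_ideal N g \<subseteq> {t. Poly_Mapping.keys t \<subseteq> ?W}"
    unfolding env_ideal_def
  proof (rule pm.span_minimal[OF _ keys_subspace])
    let ?S = "{t. Poly_Mapping.keys t \<subseteq> ?W} :: ('a smat list \<Rightarrow>\<^sub>0 'a) set"
    have word: "word xs \<in> ?S" if "set xs \<subseteq> g" for xs using that by simp
    have diff: "s - t \<in> ?S" if "s \<in> ?S" "t \<in> ?S" for s t
      using that by (rule pm.subspace_diff[OF keys_subspace])
    have scale: "pscale c t \<in> ?S" if "t \<in> ?S" for c t
      using that by (rule pm.subspace_scale[OF keys_subspace])
    show "{word (us @ [\<lambda>i j. x i j + y i j] @ ws) - word (us @ [x] @ ws) - word (us @ [y] @ ws)
        |us ws x y. set us \<subseteq> g \<and> set ws \<subseteq> g \<and> x \<in> g \<and> y \<in> g}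
     \<union> {word (us @ [\<lambda>i j. c * x i j] @ ws) - pscale c (word (us @ [x] @ ws))
        |us ws c x. set us \<subseteq> g \<and> set ws \<subseteq> g \<and> x \<in> g}
     \<union> {word (us @ [x, y] @ ws) - pscale (ssgn p q) (word (us @ [y, x] @ ws))
          - word (us @ [smat_bracket N p q x y] @ ws)
        |us ws p q x y. set us \<subseteq> g \<and> set ws \<subseteq> g \<and> x \<in> g \<and> y \<in> g \<and>
           smat_homog p x \<and> smat_homog q y} \<subseteq> ?S"
      using assms unfolding lie_closed_def
      by (intro Un_least subsetI; elim CollectE exE conjE; hypsubst)
        (intro diff scale word; simp)+
  qed
  then show ?thesis by (auto simp: free_alg_def)
qed

lemma keys_tens:
  assumes "(xs, ys) \<in> Poly_Mapping.keys (tens s t)"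
  shows "xs \<in> Poly_Mapping.keys s \<and> ys \<in> Poly_Mapping.keys t"
proof (rule ccontr)
  assume "\<not> ?thesis"
  then have "Poly_Mapping.lookup s a * Poly_Mapping.lookup (lin_ext (\<lambda>ys. word (a, ys)) t) (xs, ys) = 0"
    if "a \<in> Poly_Mapping.keys s" for a
    using that by (auto simp: lookup_lin_ext_superset[OF finite_keys order_refl] lookup_single when_def in_keys_iff
        intro!: sum.neutral)
  then have "Poly_Mapping.lookup (tens s t) (xs, ys) = 0"
    unfolding tens_def lookup_lin_ext_superset[OF finite_keys order_refl] by (rule sum.neutral[rule_format])
  with assms show False by (simp add: in_keys_iff)
qed

lemma env2_null_in_free:
  assumes "lie_closed M g" "lie_closed N h"
  shows "env2_null M g N h \<subseteq> env2_free g h"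
proof -
  let ?W = "{(xs, ys). set xs \<subseteq> g \<and> set ys \<subseteq> h}"
  have "env2_null M g N h \<subseteq> {t. Poly_Mapping.keys t \<subseteq> ?W}"
    unfolding env2_null_def
  proof (rule pm.span_minimal[OF _ keys_subspace])
    have "Poly_Mapping.keys (tens s t) \<subseteq> ?W" if "s \<in> free_alg g" "t \<in> free_alg h" for s t
      using that by (auto simp: free_alg_def dest!: keys_tens)
    then show "{tens s t |s t. s \<in> env_ideal M g \<and> t \<in> free_alg h} \<union>
        {tens s t |s t. s \<in> free_alg g \<and> t \<in> env_ideal N h} \<subseteq> {t. Poly_Mapping.keys t \<subseteq> ?W}"
      using env_ideal_in_free[OF assms(1)] env_ideal_in_free[OF assms(2)] by blast
  qed
  then show ?thesis by (auto simp: env2_free_def)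
qed

lemma env2_act_eq:
  assumes \<rho>: "superrep M g \<rho>" and \<sigma>: "superrep N h \<sigma>" and C: "C \<in> env2 M g N h" and t: "t \<in> C"
  shows "env2_act \<rho> \<sigma> C f = free_act \<rho> \<sigma> t f"
proof -
  from C obtain t0 where C: "C = {t0 + u |u. u \<in> env2_null M g N h}" by (auto simp: env2_def)
  have "free_act \<rho> \<sigma> s f = free_act \<rho> \<sigma> t0 f" if "s \<in> C" for s
    using that env2_null_acts_zero[OF \<rho> \<sigma>] by (auto simp: C free_act_eq lin_eval_add)
  then have "(\<lambda>t. free_act \<rho> \<sigma> t f) ` C = {free_act \<rho> \<sigma> t f}" using t by force
  then show ?thesis by (simp add: env2_act_def)
qed

text \<open>Each letter contributes its sign, and the signs multiply because $p \mapsto (-1)^{Pp}$ is a character.\<close>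

lemma intertwine_words:
  fixes \<Phi> :: "'k::field salg \<Rightarrow> 'k salg"
  assumes int: "\<And>p x f. x \<in> g \<Longrightarrow> smat_homog p x \<Longrightarrow> \<Phi> (\<rho> x f) = sscale (ssgn P p) (\<rho>' x (\<Phi> f))"
    and b: "bilinear_action \<rho>'" and xs: "set xs \<subseteq> g" "word_homog q xs"
  shows "\<Phi> (foldr \<rho> xs f) = sscale (ssgn P q) (foldr \<rho>' xs (\<Phi> f))"
  using xs
proof (induction xs arbitrary: q)
  case Nil
  then show ?case by (simp add: ssgn_simps)
next
  case (Cons x xs)
  then obtain r where r: "smat_homog r x" "word_homog (q \<noteq> r) xs" by auto
  have "\<Phi> (foldr \<rho> (x # xs) f) = sscale (ssgn P r) (\<rho>' x (sscale (ssgn P (q \<noteq> r)) (foldr \<rho>' xs (\<Phi> f))))"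
    using Cons r by (simp add: int)
  also have "\<dots> = sscale (ssgn P r * ssgn P (q \<noteq> r)) (foldr \<rho>' (x # xs) (\<Phi> f))"
    by (simp add: bilinear_action_simps[OF b])
  also have "ssgn P r * ssgn P (q \<noteq> r) = (ssgn P q :: 'k)" by (auto simp: ssgn_def)
  finally show ?case .
qed

text \<open>A homogeneous class is evaluated on a homogeneous representative; its words all have the same
  total parity \<open>q\<close>, hence produce the same sign.\<close>

lemma intertwine_env2:
  fixes \<Phi> :: "'k::field salg \<Rightarrow> 'k salg"
  assumes lin: "lin_on UNIV \<Phi>"
    and g: "\<And>p x f. x \<in> g \<Longrightarrow> smat_homog p x \<Longrightarrow> \<Phi> (\<rho> x f) = sscale (ssgn P p) (\<rho>' x (\<Phi> f))"
    and h: "\<And>p x f. x \<in> h \<Longrightarrow> smat_homog p x \<Longrightarrow> \<Phi> (\<sigma> x f) = sscale (ssgn P p) (\<sigma>' x (\<Phi> f))"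
    and rep: "superrep M g \<rho>" "superrep N h \<sigma>" "superrep M g \<rho>'" "superrep N h \<sigma>'"
    and cl: "lie_closed M g" "lie_closed N h"
    and C: "C \<in> env2 M g N h" "env2_homog q C"
  shows "\<Phi> (env2_act \<rho> \<sigma> C f) = sscale (ssgn P q) (env2_act \<rho>' \<sigma>' C (\<Phi> f))"
proof -
  have b: "bilinear_action \<rho>'" "bilinear_action \<sigma>'" using rep by (simp_all add: superrep_def)
  obtain t where t: "t \<in> C"
    "\<forall>(xs, ys)\<in>Poly_Mapping.keys t. \<exists>r. word_homog r xs \<and> word_homog (q \<noteq> r) ys"
    using C(2) by (auto simp: env2_homog_def)
  from C(1) obtain t0 where C': "C = {t0 + u |u. u \<in> env2_null M g N h}" and t0: "t0 \<in> env2_free g h"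
    by (auto simp: env2_def)
  then obtain u where u: "t = t0 + u" "u \<in> env2_free g h"
    using t(1) env2_null_in_free[OF cl] by blast
  have words: "set xs \<subseteq> g" "set ys \<subseteq> h" if "(xs, ys) \<in> Poly_Mapping.keys t" for xs ys
    using that t0 u(2) keys_add[of t0 u] unfolding u(1) env2_free_def by blast+
  have \<Phi>: "\<Phi> (foldr \<rho> xs (foldr \<sigma> ys f)) = sscale (ssgn P q) (foldr \<rho>' xs (foldr \<sigma>' ys (\<Phi> f)))"
    if k: "(xs, ys) \<in> Poly_Mapping.keys t" for xs ys
  proof -
    obtain r where r: "word_homog r xs" "word_homog (q \<noteq> r) ys"
      using bspec[OF t(2) k] unfolding prod.case by blast
    have "\<Phi> (foldr \<rho> xs (foldr \<sigma> ys f)) =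
        sscale (ssgn P r) (foldr \<rho>' xs (sscale (ssgn P (q \<noteq> r)) (foldr \<sigma>' ys (\<Phi> f))))"
      using intertwine_words[where \<Phi> = \<Phi>, OF g b(1) words(1)[OF k] r(1)]
        intertwine_words[where \<Phi> = \<Phi>, OF h b(2) words(2)[OF k] r(2)] by simp
    also have "\<dots> = sscale (ssgn P r * ssgn P (q \<noteq> r)) (foldr \<rho>' xs (foldr \<sigma>' ys (\<Phi> f)))"
      by (simp add: foldr_linear[OF b(1)])
    also have "ssgn P r * ssgn P (q \<noteq> r) = (ssgn P q :: 'k)" by (auto simp: ssgn_def)
    finally show ?thesis .
  qed
  have lin': "\<Phi> (f + g) = \<Phi> f + \<Phi> g" "\<Phi> (sscale c f) = sscale c (\<Phi> f)" for f g c
    using lin by (simp_all add: lin_on_def)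
  have "\<Phi> 0 = 0" using lin'(2)[of 0 0] by simp
  then have sum: "\<Phi> (sum k A) = (\<Sum>a\<in>A. \<Phi> (k a))" for k :: "'k smat list \<times> 'k smat list \<Rightarrow> 'k salg" and A
    by (induction A rule: infinite_finite_induct) (simp_all add: lin')
  have "\<Phi> (free_act \<rho> \<sigma> t f) = sscale (ssgn P q) (free_act \<rho>' \<sigma>' t (\<Phi> f))"
    unfolding free_act_def sum ssym.scale_sum_right
    by (intro sum.cong refl) (auto simp: lin' \<Phi> mult.commute)
  then show ?thesis
    by (simp add: env2_act_eq[OF rep(1,2) C(1) t(1)] env2_act_eq[OF rep(3,4) C(1) t(1)])
qed

section \<open>Transport of structure along the Fourier transform\<close>

lemma star_sign_square: "(- 1) ^ star_exp I A * (- 1) ^ star_exp I A = (1 :: 'k::comm_ring_1)"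
  by (simp flip: power_mult_distrib)

lemma star_inject: "star I f = star I g \<Longrightarrow> f = g" for f g :: "(_, 'k::field) ssym"
  by (drule arg_cong[where f = "\<lambda>f. sscale ((- 1) ^ star_exp I I) (star I f)"])
    (simp add: star_star star_sign_square)

text \<open>The inverse of \<open>star I\<close> is \<open>star I\<close> up to a sign, so intertwining in one direction gives it in the other.\<close>

lemma intertwine_back:
  assumes int: "\<And>f. star I (\<rho> x f) = sscale (ssgn P p) (\<rho>' x (star I f))"
    and b: "bilinear_action \<rho>" "bilinear_action \<rho>'"
  shows "star I (\<rho>' x f) = sscale (ssgn P p) (\<rho> x (star I f))"
proof -
  let ?c = "(- 1) ^ star_exp I I"
  have "star I (star I (\<rho> x (star I f))) = sscale (ssgn P p) (star I (\<rho>' x (star I (star I f))))"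
    by (simp only: int star_linear)
  then have "sscale ?c (\<rho> x (star I f)) = sscale ?c (sscale (ssgn P p) (star I (\<rho>' x f)))"
    by (simp add: star_star star_linear bilinear_action_simps[OF b(2)] mult.commute)
  then have "\<rho> x (star I f) = sscale (ssgn P p) (star I (\<rho>' x f))"
    by (simp add: ssym.scale_cancel_left del: ssym.scale_scale)
  then show ?thesis by (simp add: ssgn_square)
qed

text \<open>The bracket relation is tested after applying \<open>star I\<close>, which is injective; the sign of a bracket
  under \<open>star I\<close> is the product of the signs of its two factors.\<close>

lemma superrep_transfer:
  assumes \<rho>: "superrep N g \<rho>" and cl: "lie_closed N g" and b': "bilinear_action \<rho>'"
    and int: "\<And>p x f. x \<in> g \<Longrightarrow> smat_homog p x \<Longrightarrow> star I (\<rho>' x f) = sscale (ssgn P p) (\<rho> x (star I f))"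
  shows "superrep N g \<rho>'"
  unfolding superrep_def
proof (intro conjI b' allI ballI impI; elim conjE)
  fix p q x y f assume x: "x \<in> g" "smat_homog p x" and y: "y \<in> g" "smat_homog q y"
  have b: "bilinear_action \<rho>" using \<rho> by (simp add: superrep_def)
  have star_diff: "star I (f - g) = star I f - star I g" for f g :: "'a salg"
    using star_linear(1)[of I f "sscale (- 1) g"] star_linear(2)[of I "- 1" g] by simp
  have br: "smat_bracket N p q x y \<in> g" "smat_homog (p \<noteq> q) (smat_bracket N p q x y)"
    using cl x y unfolding lie_closed_def by (blast, intro smat_homog_bracket)
  have s: "ssgn P (p \<noteq> q) = (ssgn P p * ssgn P q :: 'a)" by (auto simp: ssgn_def)
  have \<rho>_bracket: "\<rho> (smat_bracket N p q x y) g = \<rho> x (\<rho> y g) - sscale (ssgn p q) (\<rho> y (\<rho> x g))" for g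
    using \<rho> x y by (simp add: superrep_def)
  have "star I (\<rho>' (smat_bracket N p q x y) f) =
      sscale (ssgn P p * ssgn P q) (\<rho> x (\<rho> y (star I f)) - sscale (ssgn p q) (\<rho> y (\<rho> x (star I f))))"
    by (simp only: int[OF br] s \<rho>_bracket)
  also have "\<dots> = star I (\<rho>' x (\<rho>' y f) - sscale (ssgn p q) (\<rho>' y (\<rho>' x f)))"
    by (simp add: star_diff star_linear int[OF x] int[OF y] bilinear_action_simps[OF b]
        ssym.scale_right_diff_distrib mult_ac)
  finally show "\<rho>' (smat_bracket N p q x y) f = \<rho>' x (\<rho>' y f) - sscale (ssgn p q) (\<rho>' y (\<rho>' x f))"
    by (rule star_inject)
qed

lemma homog_transfer:
  fixes \<rho> \<rho>' :: "'x \<Rightarrow> 'k salg \<Rightarrow> 'k::field salg"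
  assumes int: "star I (\<rho>' x f) = sscale c (\<rho> x (star I f))"
    and hom: "\<And>q f. ssym_homog q f \<Longrightarrow> ssym_homog (p \<noteq> q) (\<rho> x f)" and f: "ssym_homog q f"
  shows "ssym_homog (p \<noteq> q) (\<rho>' x f)"
proof -
  let ?e = "(- 1) ^ star_exp I I :: 'k"
  have "ssym_homog (odd (fcard I) \<noteq> (p \<noteq> (odd (fcard I) \<noteq> q))) (sscale ?e (star I (star I (\<rho>' x f))))"
    unfolding int by (intro homog_scale star_homog hom f)
  moreover have "(odd (fcard I) \<noteq> (p \<noteq> (odd (fcard I) \<noteq> q))) = (p \<noteq> q)" by auto
  ultimately show ?thesis by (simp only: star_star ssym.scale_scale star_sign_square ssym.scale_one)
qed

lemma env2_moduleI:
  assumes "superrep M g \<rho>" "superrep N h \<sigma>"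
    and "\<And>x f. f \<in> S \<Longrightarrow> \<rho> x f \<in> S" "\<And>x f. f \<in> S \<Longrightarrow> \<sigma> x f \<in> S"
    and "\<And>p q x f. x \<in> g \<Longrightarrow> smat_homog p x \<Longrightarrow> ssym_homog q f \<Longrightarrow> ssym_homog (p \<noteq> q) (\<rho> x f)"
    and "\<And>p q x f. x \<in> h \<Longrightarrow> smat_homog p x \<Longrightarrow> ssym_homog q f \<Longrightarrow> ssym_homog (p \<noteq> q) (\<sigma> x f)"
    and "\<And>p q x y f. x \<in> g \<Longrightarrow> y \<in> h \<Longrightarrow> smat_homog p x \<Longrightarrow> smat_homog q y \<Longrightarrow>
      \<rho> x (\<sigma> y f) = sscale (ssgn p q) (\<sigma> y (\<rho> x f))"
  shows "env2_module M g N h S \<rho> \<sigma>"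
proof -
  have b: "bilinear_action \<rho>" "bilinear_action \<sigma>" using assms(1,2) by (simp_all add: superrep_def)
  have lin: "lin_on S (\<rho> x)" "lin_on S (\<sigma> x)" for x
    by (simp_all add: lin_on_def bilinear_action_simps[OF b(1)] bilinear_action_simps[OF b(2)])
  show ?thesis
    unfolding env2_module_def homog_on_def
    by (intro conjI ballI allI impI image_subsetI; (elim conjE)?)
      (assumption | rule lin assms(3-7) env2_null_acts_zero[OF assms(1,2)])+
qed

theorem theorem7p8p1:
  fixes m n :: nat
  assumes "m \<ge> 1" and "n \<ge> 1"
  shows "\<exists>\<Phi> :: 'k::{alg_closed_field, field_char_0} salg \<Rightarrow> 'k salg.
    is_Phi m n \<Phi> \<and>
    (\<forall>\<Psi>. is_Phi m n \<Psi> \<longrightarrow> (\<forall>f\<in>SU' m n. \<Psi> f = \<Phi> f)) \<and>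
    env2_iso m (peri_t m) n (peri n)
      (SU' m n) (pt_U' m n) (p_U' m n)
      (SU m n) (pt_U m n) (p_U m n)
      (odd (m * n)) \<Phi>"
proof (intro exI conjI allI impI ballI)
  let ?\<Phi> = "star (grid m n) :: 'k salg \<Rightarrow> 'k salg" and ?P = "odd (m * n)"
  let ?S = "ssym_on ({1..int m} \<times> {1..int n}) :: 'k salg set"
  show "is_Phi m n ?\<Phi>" by (rule is_Phi_star)
  show "\<Psi> f = ?\<Phi> f" if "is_Phi m n \<Psi>" "f \<in> SU' m n" for \<Psi> f
    using is_Phi_unique[OF is_Phi_star that] .
  note bil = bilinear_natural bilinear_oscillator
  have int_pt: "?\<Phi> (pt_U m n x f) = sscale (ssgn ?P p) (pt_U' m n x (?\<Phi> f))"
    if "smat_homog p x" "x \<in> peri_t m" for p x f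
    using star_pt[OF that(2,1)] bil(2,3) by (rule intertwine_back)
  have int_p: "?\<Phi> (p_U m n y f) = sscale (ssgn ?P p) (p_U' m n y (?\<Phi> f))"
    if "smat_homog p y" "y \<in> peri n" for p y f
    using star_p[OF that(2,1)] bil(4,1) by (rule intertwine_back)
  have rep: "superrep n (peri n) (p_U' m n :: 'k smat \<Rightarrow> _)" "superrep m (peri_t m) (pt_U m n :: 'k smat \<Rightarrow> _)"
    by (rule superrep_transfer[OF superrep_natural(1) lie_closed_peri(1) bil(4) star_p];assumption)
      (rule superrep_transfer[OF superrep_natural(2) lie_closed_peri(2) bil(3) int_pt]; assumption)
  have mod': "env2_module m (peri_t m) n (peri n) ?S (pt_U' m n) (p_U' m n)"
  proof (rule env2_moduleI[OF superrep_natural(2) rep(1)])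
    show "ssym_homog (p \<noteq> q) (p_U' m n x f)"
      if "x \<in> peri n" "smat_homog p x" "ssym_homog q f" for p q x and f :: "'k salg"
      using star_p[OF that(1,2)] homog_natural(1)[OF that(2)] that(3) by (rule homog_transfer)
  qed ((rule actions_stable homog_natural supercommute_U'; assumption)+)
  have mod: "env2_module m (peri_t m) n (peri n) ?S (pt_U m n) (p_U m n)"
  proof (rule env2_moduleI[OF rep(2) superrep_natural(1)])
    show "ssym_homog (p \<noteq> q) (pt_U m n x f)"
      if "x \<in> peri_t m" "smat_homog p x" "ssym_homog q f" for p q x and f :: "'k salg"
      using int_pt[OF that(2,1)] homog_natural(2)[OF that(2)] that(3) by (rule homog_transfer)
    show "pt_U m n x (p_U m n y f) = sscale (ssgn p q) (p_U m n y (pt_U m n x f))"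
      if "x \<in> peri_t m" "y \<in> peri n" "smat_homog p x" "smat_homog q y" for p q x y and f :: "'k salg"
    proof (rule star_inject)
      have "?\<Phi> (pt_U m n x (p_U m n y f)) =
          sscale (ssgn ?P p * ssgn ?P q * ssgn p q) (p_U' m n y (pt_U' m n x (?\<Phi> f)))"
        using that by (simp only: int_pt int_p bilinear_action_simps[OF bil(2)] supercommute_U' ssym.scale_scale mult.assoc)
      also have "\<dots> = ?\<Phi> (sscale (ssgn p q) (p_U m n y (pt_U m n x f)))"
        using that by (simp only: int_pt int_p star_linear bilinear_action_simps[OF bil(4)] ssym.scale_scale mult_ac)
      finally show "?\<Phi> (pt_U m n x (p_U m n y f)) = ?\<Phi> (sscale (ssgn p q) (p_U m n y (pt_U m n x f)))" .
    qed
  qed ((rule actions_stable homog_natural; assumption)+)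
  have "lin_on A ?\<Phi>" for A by (simp add: lin_on_def star_linear)
  moreover have "bij_betw ?\<Phi> ?S ?S" by (rule star_bij) (simp add: fset_grid)
  moreover have "homog_on ?S ?P ?\<Phi>"
    using star_homog[of _ _ "grid m n"] by (auto simp: homog_on_def fcard_grid)
  moreover have "?\<Phi> (env2_act (pt_U' m n) (p_U' m n) C f) =
      sscale (ssgn ?P q) (env2_act (pt_U m n) (p_U m n) C (?\<Phi> f))"
    if "C \<in> env2 m (peri_t m) n (peri n)" "env2_homog q C" for C q f
    using that by (intro intertwine_env2[OF calculation(1) star_pt star_p superrep_natural(2) rep superrep_natural(1)
        lie_closed_peri(2,1)])
  ultimately show "env2_iso m (peri_t m) n (peri n) (SU' m n) (pt_U' m n) (p_U' m n)
      (SU m n) (pt_U m n) (p_U m n) ?P ?\<Phi>"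
    unfolding env2_iso_def SU_eq SU'_eq using mod mod' by blast
qed

end
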